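(* Let $s_1,s_2\in\overline{\mathbf R_\flat}$ be such that $s_1<\frac12$ and $0<s_2\le\frac12$. Then the following is true: (1) the map $(a,f)\mapsto\operatorname{Tp}_{\mathfrak V}(a)f$ from $\widehat{\mathcal A}_0(\mathbf C^{2d})\times\mathcal H_0(\mathbf R^d)$ to $\mathcal H_0'(\mathbf R^d)$ is uniquely extendable to a continuous map from $\widehat{\mathcal C}_{s_1}(\mathbf C^{2d})\times\mathcal H_{s_1}(\mathbf R^d)$ to $\mathcal H_{s_1}(\mathbf R^d)$, and from $\widehat{\mathcal C}_{s_1}^\star(\mathbf C^{2d})\times\mathcal H_{s_1}'(\mathbf R^d)$ to $\mathcal H_{s_1}'(\mathbf R^d)$; (2) the map $(a,f)\mapsto\operatorname{Tp}_{\mathfrak V}(a)f$ from $\widehat{\mathcal A}_0(\mathbf C^{2d})\times\mathcal H_0(\mathbf R^d)$ to $\mathcal H_0'(\mathbf R^d)$ is uniquely extendable to a continuous map from $\widehat{\mathcal C}_{0,s_2}(\mathbf C^{2d})\times\mathcal H_{0,s_2}(\mathbf R^d)$ to $\mathcal H_{0,s_2}(\mathbf R^d)$, and from $\widehat{\mathcal C}_{0,s_2}^\star(\mathbf C^{2d})\times\mathcal H_{0,s_2}'(\mathbf R^d)$ to $\mathcal H_{0,s_2}'(\mathbf R^d)$.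
   Context: **Indices and weights.** $\mathbf N=\{0,1,2,\dots\}$. $\overline{\mathbf R_\flat}=[0,\infty)\cup\{\flat_\sigma:\sigma>0\}$, where the $\flat_\sigma$ are formal symbols, ordered so that $x_1<\flat_{\sigma_1}<\flat_{\sigma_2}<x_2$ whenever $x_1<\frac12\le x_2$ and $\sigma_1<\sigma_2$. For $r>0$ and $\alpha\in\mathbf N^d$: $\vartheta_{r,s}(\alpha)=e^{r|\alpha|^{1/(2s)}}$ if $s\in(0,\infty)$; $\vartheta_{r,s}(\alpha)=r^{|\alpha|}(\alpha!)^{1/(2\sigma)}$ if $s=\flat_\sigma$; $\vartheta_{r,0}(\alpha)=1$ if $|\alpha|\le r$ and $=\infty$ if $|\alpha|>r$. Conventions: $a/\infty=0$ for all $a\in(0,\infty]$, $\infty\cdot0=0$. For $\omega:\Lambda\to[0,\infty]$, $\ell_{[\omega]}(\Lambda)$ is the set of $c:\Lambda\to\mathbf C$ with $\|c\,\omega\|_{\ell^p(\Lambda)}<\infty$, with this (quasi-/semi-)norm, $p\in(0,\infty]$ fixed (the limit spaces below do not depend on $p$). **Pilipović spaces.** $\ell_s(\mathbf N^d)=\operatorname{ind\,lim}_{r>0}\ell_{[\vartheta_{r,s}]}$, $\ell_s^\star=\operatorname{proj\,lim}_{r>0}\ell_{[1/\vartheta_{r,s}]}$, and for $s>0$, $\ell_{0,s}=\operatorname{proj\,lim}_{r>0}\ell_{[\vartheta_{r,s}]}$, $\ell_{0,s}^\star=\operatorname{ind\,lim}_{r>0}\ell_{[1/\vartheta_{r,s}]}$.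 With the Hermite functions $h_\alpha(x)=\pi^{-d/4}(-1)^{|\alpha|}(2^{|\alpha|}\alpha!)^{-1/2}e^{|x|^2/2}\partial^\alpha e^{-|x|^2}$, the spaces $\mathcal H_s,\mathcal H_s',\mathcal H_{0,s},\mathcal H_{0,s}'$ on $\mathbf R^d$ consist of the formal Hermite series $f=\sum_\alpha c(f;\alpha)h_\alpha$ with coefficients in $\ell_s,\ell_s^\star,\ell_{0,s},\ell_{0,s}^\star$, with transported topologies. $\mathcal H_0$ ($s=0$) consists of finite linear combinations of Hermite functions, $\mathcal H_0'$ of all formal Hermite series; the pairing $(f,g)_{L^2}=\sum c(f;\alpha)\overline{c(g;\alpha)}$ is defined on $\mathcal H_0'\times\mathcal H_0$. **Symbol spaces.** On $\mathbf N^{2d}\ni(\alpha,\beta)$ put $\omega_{r_2,r_1}(\alpha,\beta)=\vartheta_{r_2,s}(\alpha)/\vartheta_{r_1,s}(\beta)$, $\omega^\star_{r_2,r_1}(\alpha,\beta)=\vartheta_{r_1,s}(\beta)/\vartheta_{r_2,s}(\alpha)$. With limits over positive parameters: $\ell_{\mathcal C,s}=\operatorname{ind\,lim}_{r_2}\operatorname{proj\,lim}_{r_1}\ell_{[\omega_{r_2,r_1}]}$, $\ell_{\mathcal C,0,s}=\operatorname{ind\,lim}_{r_1}\operatorname{proj\,lim}_{r_2}\ell_{[\omega_{r_2,r_1}]}$, $\ell_{\mathcal C,s}^\star=\operatorname{ind\,lim}_{r_1}\operatorname{proj\,lim}_{r_2}\ell_{[\omega^\star_{r_2,r_1}]}$,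 $\ell_{\mathcal C,0,s}^\star=\operatorname{ind\,lim}_{r_2}\operatorname{proj\,lim}_{r_1}\ell_{[\omega^\star_{r_2,r_1}]}$. As sets, projective/inductive limits are intersections/unions. With $e_\alpha(z)=z^\alpha/\sqrt{\alpha!}$, $\widehat{\mathcal C}_s,\widehat{\mathcal C}_{0,s},\widehat{\mathcal C}_s^\star,\widehat{\mathcal C}_{0,s}^\star$ (on $\mathbf C^{2d}$) are the spaces of formal series $a(z,w)=\sum c(a;\alpha,\beta)e_\alpha(z)e_\beta(\overline w)$, $z,w\in\mathbf C^d$, with coefficients in the corresponding sequence space, with transported topology. $\widehat{\mathcal A}_0(\mathbf C^{2d})$ is the space of such series with finitely many non-zero coefficients. **Toeplitz operators.** Let $\phi(x)=\pi^{-d/4}e^{-|x|^2/2}$ and $V_\phi f(x,\xi)=(2\pi)^{-d/2}\int_{\mathbf R^d}f(y)\overline{\phi(y-x)}e^{-i\langle y,\xi\rangle}\,dy$. For $a\in\widehat{\mathcal A}_0(\mathbf C^{2d})$ and $f\in\mathcal H_0(\mathbf R^d)$, $\operatorname{Tp}_{\mathfrak V}(a)f$ is defined by $$(\operatorname{Tp}_{\mathfrak V}(a)f,g)_{L^2(\mathbf R^d)}=(\mathfrak a\cdot V_\phi f,V_\phi g)_{L^2(\mathbf R^{2d})},\quad g\in\mathcal H_0(\mathbf R^d),\qquad\text{where }\mathfrak a(\sqrt2\,x,-\sqrt2\,\xi)=a(z,z),\ z=x+i\xi.$$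
   Formalization: "Continuous" is read as hypocontinuous (jointly continuous once one variable lies in a bounded set), since joint continuity on the full product fails (symbols with only α=0 give the duality pairing); uniqueness is shown even among separately continuous extensions. *)

theory Defs
  imports "HOL-Analysis.Analysis"
begin

section \<open>Indices and weights\<close>

text \<open>
  The raw type also contains \<open>Num x\<close> for \<open>x < 0\<close> and \<open>Flat \<sigma>\<close> for \<open>\<sigma> \<le> 0\<close>; these are excluded
  by \<open>R_flat\<close>. \<open>Flat \<sigma>\<close> is the formal symbol usually written as a flat sign with subscript \<open>\<sigma>\<close>.
\<close>

datatype pindex = Num real | Flat real

definition R_flat :: "pindex set" where
  "R_flat = Num ` {0..} \<union> Flat ` {0<..}"

instantiation pindex :: linorder
begin

fun less_pindex :: "pindex \<Rightarrow> pindex \<Rightarrow> bool" where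
  "Num x < Num y \<longleftrightarrow> x < y"
| "Num x < Flat \<sigma> \<longleftrightarrow> x < 1/2"
| "Flat \<sigma> < Num x \<longleftrightarrow> 1/2 \<le> x"
| "Flat \<sigma> < Flat \<tau> \<longleftrightarrow> \<sigma> < \<tau>"

definition less_eq_pindex :: "pindex \<Rightarrow> pindex \<Rightarrow> bool" where
  "less_eq_pindex s t \<longleftrightarrow> s < t \<or> s = t"

instance
proof
  fix x y z :: pindex
  show "(x < y) = (x \<le> y \<and> \<not> y \<le> x)"
    by (cases x; cases y; auto simp: less_eq_pindex_def)
  show "x \<le> x" by (simp add: less_eq_pindex_def)
  show "x \<le> y \<Longrightarrow> y \<le> z \<Longrightarrow> x \<le> z"
    by (cases x; cases y; cases z; auto simp: less_eq_pindex_def)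
  show "x \<le> y \<Longrightarrow> y \<le> x \<Longrightarrow> x = y"
    by (cases x; cases y; auto simp: less_eq_pindex_def)
  show "x \<le> y \<or> y \<le> x"
    by (cases x; cases y; auto simp: less_eq_pindex_def)
qed

end

type_synonym 'n mindex = "'n \<Rightarrow> nat"

definition mlen :: "('n::finite) mindex \<Rightarrow> nat" where
  "mlen \<alpha> = (\<Sum>i\<in>UNIV. \<alpha> i)"

definition mfact :: "('n::finite) mindex \<Rightarrow> real" where
  "mfact \<alpha> = (\<Prod>i\<in>UNIV. fact (\<alpha> i))"

definition vartheta :: "real \<Rightarrow> pindex \<Rightarrow> ('n::finite) mindex \<Rightarrow> ennreal" where
  "vartheta r s \<alpha> =
     (case s of
        Num x \<Rightarrow> (if x = 0 then (if real (mlen \<alpha>) \<le> r then 1 else \<infinity>)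
                  else ennreal (exp (r * real (mlen \<alpha>) powr (1 / (2 * x)))))
      | Flat \<sigma> \<Rightarrow> ennreal (r ^ mlen \<alpha> * mfact \<alpha> powr (1 / (2 * \<sigma>))))"


section \<open>Weighted sequence spaces and their limits\<close>

text \<open>
  Topological vector spaces of families \<open>'i \<Rightarrow> complex\<close> are represented by a
  \<open>('i \<Rightarrow> complex) topology\<close>, whose \<open>topspace\<close> is the space. The arithmetic of \<^typ>\<open>ennreal\<close> obeys
  the conventions \<open>\<infinity> * 0 = 0\<close> and \<open>a / \<infinity> = 0\<close> (also for \<open>a = \<infinity>\<close>).
\<close>

definition epowr :: "ennreal \<Rightarrow> real \<Rightarrow> ennreal" where
  "epowr x q = (if x = \<infinity> then \<infinity> else ennreal (enn2real x powr q))"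

definition lp_norm :: "ennreal \<Rightarrow> ('i \<Rightarrow> ennreal) \<Rightarrow> ennreal" where
  "lp_norm p u =
     (if p = \<infinity> then (SUP i. u i)
      else epowr (\<integral>\<^sup>+ i. epowr (u i) (enn2real p) \<partial>count_space UNIV) (1 / enn2real p))"

definition wnorm :: "ennreal \<Rightarrow> ('i \<Rightarrow> ennreal) \<Rightarrow> ('i \<Rightarrow> complex) \<Rightarrow> ennreal" where
  "wnorm p \<omega> c = lp_norm p (\<lambda>i. ennreal (norm (c i)) * \<omega> i)"

text \<open>
  For \<open>p < 1\<close> the balls of the quasi-norm need not be open, so the topology is given by the
  condition that an open set contains a ball around each of its points.
\<close>

definition wlp_carrier :: "ennreal \<Rightarrow> ('i \<Rightarrow> ennreal) \<Rightarrow> ('i \<Rightarrow> complex) set" where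
  "wlp_carrier p \<omega> = {c. wnorm p \<omega> c < \<infinity>}"

definition wlp_open :: "ennreal \<Rightarrow> ('i \<Rightarrow> ennreal) \<Rightarrow> ('i \<Rightarrow> complex) set \<Rightarrow> bool" where
  "wlp_open p \<omega> U \<longleftrightarrow> U \<subseteq> wlp_carrier p \<omega> \<and>
     (\<forall>c\<in>U. \<exists>\<epsilon>>0. \<forall>b\<in>wlp_carrier p \<omega>. wnorm p \<omega> (\<lambda>i. b i - c i) < ennreal \<epsilon> \<longrightarrow> b \<in> U)"

definition wlp :: "ennreal \<Rightarrow> ('i \<Rightarrow> ennreal) \<Rightarrow> ('i \<Rightarrow> complex) topology" where
  "wlp p \<omega> = topology (wlp_open p \<omega>)"

lemma istopology_wlp_open: "istopology (wlp_open p \<omega>)"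
  unfolding istopology_def
proof (intro conjI allI impI)
  fix S T assume S: "wlp_open p \<omega> S" and T: "wlp_open p \<omega> T"
  show "wlp_open p \<omega> (S \<inter> T)"
    unfolding wlp_open_def
  proof (intro conjI ballI)
    show "S \<inter> T \<subseteq> wlp_carrier p \<omega>" using S by (auto simp: wlp_open_def)
  next
    fix c assume c: "c \<in> S \<inter> T"
    obtain d where d: "d > 0" "\<forall>b\<in>wlp_carrier p \<omega>. wnorm p \<omega> (\<lambda>i. b i - c i) < ennreal d \<longrightarrow> b \<in> S"
      using S c unfolding wlp_open_def by blast
    obtain e where e: "e > 0" "\<forall>b\<in>wlp_carrier p \<omega>. wnorm p \<omega> (\<lambda>i. b i - c i) < ennreal e \<longrightarrow> b \<in> T"
      using T c unfolding wlp_open_def by blast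
    have "min d e > 0" using d e by simp
    moreover have "ennreal (min d e) \<le> ennreal d" "ennreal (min d e) \<le> ennreal e"
      by (auto intro: ennreal_leI)
    ultimately show "\<exists>\<epsilon>>0. \<forall>b\<in>wlp_carrier p \<omega>.
        wnorm p \<omega> (\<lambda>i. b i - c i) < ennreal \<epsilon> \<longrightarrow> b \<in> S \<inter> T"
      using d(2) e(2) by (meson IntI order_less_le_trans)
  qed
next
  fix K assume K: "\<forall>S\<in>K. wlp_open p \<omega> S"
  show "wlp_open p \<omega> (\<Union>K)"
    unfolding wlp_open_def
  proof (intro conjI ballI)
    show "\<Union>K \<subseteq> wlp_carrier p \<omega>" using K by (auto simp: wlp_open_def)
  next
    fix c assume "c \<in> \<Union>K"
    then obtain S where S: "S \<in> K" "c \<in> S" by blast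
    then obtain d where "d > 0" "\<forall>b\<in>wlp_carrier p \<omega>. wnorm p \<omega> (\<lambda>i. b i - c i) < ennreal d \<longrightarrow> b \<in> S"
      using K unfolding wlp_open_def by blast
    then show "\<exists>\<epsilon>>0. \<forall>b\<in>wlp_carrier p \<omega>.
        wnorm p \<omega> (\<lambda>i. b i - c i) < ennreal \<epsilon> \<longrightarrow> b \<in> \<Union>K"
      using S(1) by blast
  qed
qed

lemma openin_wlp: "openin (wlp p \<omega>) = wlp_open p \<omega>"
  by (simp add: wlp_def topology_inverse' istopology_wlp_open)

lemma topspace_wlp: "topspace (wlp p \<omega>) = wlp_carrier p \<omega>"
proof -
  have "wlp_open p \<omega> (wlp_carrier p \<omega>)"
    unfolding wlp_open_def using zero_less_one by blast
  then show ?thesis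
    unfolding topspace_def openin_wlp by (metis Sup_upper Sup_least mem_Collect_eq subset_antisym wlp_open_def)
qed

definition proj_lim :: "'r set \<Rightarrow> ('r \<Rightarrow> 'a topology) \<Rightarrow> 'a topology" where
  "proj_lim I X =
     topology_generated_by {U \<inter> (\<Inter>j\<in>I. topspace (X j)) | U i. i \<in> I \<and> openin (X i) U}"

text \<open>
  Inductive limits are taken in the category of locally convex spaces: a base of
  neighbourhoods of \<open>0\<close> is given by the absolutely convex subsets of the union that meet every
  step in a neighbourhood of \<open>0\<close> of that step.
\<close>

definition abs_convex :: "('i \<Rightarrow> complex) set \<Rightarrow> bool" where
  "abs_convex V \<longleftrightarrow>
     (\<forall>u\<in>V. \<forall>v\<in>V. \<forall>x y. norm x + norm y \<le> 1 \<longrightarrow> (\<lambda>i. x * u i + y * v i) \<in> V)"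

definition zero_nhd :: "('i \<Rightarrow> complex) topology \<Rightarrow> ('i \<Rightarrow> complex) set \<Rightarrow> bool" where
  "zero_nhd X V \<longleftrightarrow> (\<exists>U. openin X U \<and> (\<lambda>i. 0) \<in> U \<and> U \<subseteq> V)"

definition ind_base :: "'r set \<Rightarrow> ('r \<Rightarrow> ('i \<Rightarrow> complex) topology) \<Rightarrow> ('i \<Rightarrow> complex) set \<Rightarrow> bool" where
  "ind_base I X V \<longleftrightarrow> V \<subseteq> (\<Union>r\<in>I. topspace (X r)) \<and> abs_convex V \<and> (\<forall>r\<in>I. zero_nhd (X r) V)"

definition ind_open :: "'r set \<Rightarrow> ('r \<Rightarrow> ('i \<Rightarrow> complex) topology) \<Rightarrow> ('i \<Rightarrow> complex) set \<Rightarrow> bool" where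
  "ind_open I X U \<longleftrightarrow> U \<subseteq> (\<Union>r\<in>I. topspace (X r)) \<and>
     (\<forall>c\<in>U. \<exists>V. ind_base I X V \<and> (\<forall>v\<in>V. (\<lambda>i. c i + v i) \<in> U))"

definition ind_lim :: "'r set \<Rightarrow> ('r \<Rightarrow> ('i \<Rightarrow> complex) topology) \<Rightarrow> ('i \<Rightarrow> complex) topology" where
  "ind_lim I X = topology (ind_open I X)"

lemma ind_base_Int:
  assumes "ind_base I X V" "ind_base I X W"
  shows "ind_base I X (V \<inter> W)"
  unfolding ind_base_def
proof (intro conjI ballI)
  show "V \<inter> W \<subseteq> (\<Union>r\<in>I. topspace (X r))" using assms by (auto simp: ind_base_def)
  show "abs_convex (V \<inter> W)" using assms by (auto simp: ind_base_def abs_convex_def)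
next
  fix r assume "r \<in> I"
  then obtain A B where "openin (X r) A" "(\<lambda>i. 0) \<in> A" "A \<subseteq> V"
    and "openin (X r) B" "(\<lambda>i. 0) \<in> B" "B \<subseteq> W"
    using assms unfolding ind_base_def zero_nhd_def by metis
  then show "zero_nhd (X r) (V \<inter> W)"
    unfolding zero_nhd_def by (intro exI[of _ "A \<inter> B"]) auto
qed

lemma istopology_ind_open: "istopology (ind_open I X)"
  unfolding istopology_def
proof (intro conjI allI impI)
  fix S T assume S: "ind_open I X S" and T: "ind_open I X T"
  show "ind_open I X (S \<inter> T)"
    unfolding ind_open_def
  proof (intro conjI ballI)
    show "S \<inter> T \<subseteq> (\<Union>r\<in>I. topspace (X r))" using S by (auto simp: ind_open_def)
  next
    fix c assume c: "c \<in> S \<inter> T"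
    obtain V where V: "ind_base I X V" "\<forall>v\<in>V. (\<lambda>i. c i + v i) \<in> S"
      using S c unfolding ind_open_def by blast
    obtain W where W: "ind_base I X W" "\<forall>v\<in>W. (\<lambda>i. c i + v i) \<in> T"
      using T c unfolding ind_open_def by blast
    show "\<exists>V. ind_base I X V \<and> (\<forall>v\<in>V. (\<lambda>i. c i + v i) \<in> S \<inter> T)"
      using ind_base_Int[OF V(1) W(1)] V(2) W(2) by blast
  qed
next
  fix K assume K: "\<forall>S\<in>K. ind_open I X S"
  show "ind_open I X (\<Union>K)"
    unfolding ind_open_def
  proof (intro conjI ballI)
    show "\<Union>K \<subseteq> (\<Union>r\<in>I. topspace (X r))" using K by (auto simp: ind_open_def)
  next
    fix c assume "c \<in> \<Union>K"
    then obtain S where "S \<in> K" "c \<in> S" by blast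
    then show "\<exists>V. ind_base I X V \<and> (\<forall>v\<in>V. (\<lambda>i. c i + v i) \<in> \<Union>K)"
      using K unfolding ind_open_def by (meson UnionI)
  qed
qed

lemma openin_ind_lim: "openin (ind_lim I X) = ind_open I X"
  by (simp add: ind_lim_def topology_inverse' istopology_ind_open)


section \<open>Pilipovic spaces and symbol spaces\<close>

text \<open>
  A formal Hermite series, or a formal power series in \<open>(z, cnj w)\<close>, is identified with the family
  of its coefficients, so that the spaces below are at the same time the sequence spaces and,
  with the transported topologies, the spaces of formal series. The first argument \<open>p\<close> is the
  Lebesgue exponent in \<open>(0, \<infinity>]\<close>.
\<close>

definition H_sp :: "ennreal \<Rightarrow> pindex \<Rightarrow> (('n::finite) mindex \<Rightarrow> complex) topology" where
  "H_sp p s = ind_lim {0<..} (\<lambda>r. wlp p (vartheta r s))"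

definition H_dual :: "ennreal \<Rightarrow> pindex \<Rightarrow> (('n::finite) mindex \<Rightarrow> complex) topology" where
  "H_dual p s = proj_lim {0<..} (\<lambda>r. wlp p (\<lambda>\<alpha>. 1 / vartheta r s \<alpha>))"

definition H0_sp :: "ennreal \<Rightarrow> pindex \<Rightarrow> (('n::finite) mindex \<Rightarrow> complex) topology" where
  "H0_sp p s = proj_lim {0<..} (\<lambda>r. wlp p (vartheta r s))"

definition H0_dual :: "ennreal \<Rightarrow> pindex \<Rightarrow> (('n::finite) mindex \<Rightarrow> complex) topology" where
  "H0_dual p s = ind_lim {0<..} (\<lambda>r. wlp p (\<lambda>\<alpha>. 1 / vartheta r s \<alpha>))"

type_synonym 'n symb = "'n mindex \<times> 'n mindex \<Rightarrow> complex"

definition omega :: "pindex \<Rightarrow> real \<Rightarrow> real \<Rightarrow> ('n::finite) mindex \<times> 'n mindex \<Rightarrow> ennreal" where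
  "omega s r2 r1 = (\<lambda>(\<alpha>, \<beta>). vartheta r2 s \<alpha> / vartheta r1 s \<beta>)"

definition omega_star :: "pindex \<Rightarrow> real \<Rightarrow> real \<Rightarrow> ('n::finite) mindex \<times> 'n mindex \<Rightarrow> ennreal" where
  "omega_star s r2 r1 = (\<lambda>(\<alpha>, \<beta>). vartheta r1 s \<beta> / vartheta r2 s \<alpha>)"

definition C_sp :: "ennreal \<Rightarrow> pindex \<Rightarrow> ('n::finite) symb topology" where
  "C_sp p s = ind_lim {0<..} (\<lambda>r2. proj_lim {0<..} (\<lambda>r1. wlp p (omega s r2 r1)))"

definition C0_sp :: "ennreal \<Rightarrow> pindex \<Rightarrow> ('n::finite) symb topology" where
  "C0_sp p s = ind_lim {0<..} (\<lambda>r1. proj_lim {0<..} (\<lambda>r2. wlp p (omega s r2 r1)))"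

definition C_star :: "ennreal \<Rightarrow> pindex \<Rightarrow> ('n::finite) symb topology" where
  "C_star p s = ind_lim {0<..} (\<lambda>r1. proj_lim {0<..} (\<lambda>r2. wlp p (omega_star s r2 r1)))"

definition C0_star :: "ennreal \<Rightarrow> pindex \<Rightarrow> ('n::finite) symb topology" where
  "C0_star p s = ind_lim {0<..} (\<lambda>r2. proj_lim {0<..} (\<lambda>r1. wlp p (omega_star s r2 r1)))"

definition fin_families :: "('i \<Rightarrow> complex) set" where
  "fin_families = {c. finite {i. c i \<noteq> 0}}"

abbreviation H_fin :: "(('n::finite) mindex \<Rightarrow> complex) set" where
  "H_fin \<equiv> fin_families"

abbreviation A_fin :: "('n::finite) symb set" where
  "A_fin \<equiv> fin_families"


section \<open>Hermite functions and Toeplitz operators\<close>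

definition partial :: "'n::finite \<Rightarrow> (real^'n \<Rightarrow> real) \<Rightarrow> real^'n \<Rightarrow> real" where
  "partial i f x = deriv (\<lambda>t. f (x + t *\<^sub>R axis i 1)) 0"

text \<open>
  The order in which the partial derivatives are taken is chosen arbitrarily; it is
  immaterial for smooth functions, and \<open>mderiv\<close> is only applied to a Gaussian.
\<close>

definition mderiv :: "('n::finite) mindex \<Rightarrow> (real^'n \<Rightarrow> real) \<Rightarrow> real^'n \<Rightarrow> real" where
  "mderiv \<alpha> f = foldr (\<lambda>i. partial i ^^ \<alpha> i) (SOME is. distinct is \<and> set is = UNIV) f"

definition hermite :: "('n::finite) mindex \<Rightarrow> real^'n \<Rightarrow> real" where
  "hermite \<alpha> x =
     pi powr (- real CARD('n) / 4) * (-1) ^ mlen \<alpha> * (2 ^ mlen \<alpha> * mfact \<alpha>) powr (- 1 / 2) *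
     exp ((norm x)\<^sup>2 / 2) * mderiv \<alpha> (\<lambda>y. exp (- (norm y)\<^sup>2)) x"

definition hermite_sum :: "(('n::finite) mindex \<Rightarrow> complex) \<Rightarrow> real^'n \<Rightarrow> complex" where
  "hermite_sum f x = (\<Sum>\<alpha> | f \<alpha> \<noteq> 0. f \<alpha> * of_real (hermite \<alpha> x))"

definition gauss :: "real^'n::finite \<Rightarrow> complex" where
  "gauss x = of_real (pi powr (- real CARD('n) / 4) * exp (- (norm x)\<^sup>2 / 2))"

definition stft :: "(real^'n \<Rightarrow> complex) \<Rightarrow> real^'n::finite \<Rightarrow> real^'n \<Rightarrow> complex" where
  "stft f x \<xi> = of_real ((2 * pi) powr (- real CARD('n) / 2)) *
     (LINT y|lborel. f y * cnj (gauss (y - x)) * exp (- \<i> * of_real (y \<bullet> \<xi>)))"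

definition e_mono :: "('n::finite) mindex \<Rightarrow> complex^'n \<Rightarrow> complex" where
  "e_mono \<alpha> z = (\<Prod>i\<in>UNIV. (z $ i) ^ \<alpha> i) / of_real (sqrt (mfact \<alpha>))"

definition symb_eval :: "('n::finite) symb \<Rightarrow> complex^'n \<Rightarrow> complex^'n \<Rightarrow> complex" where
  "symb_eval a z w = (\<Sum>(\<alpha>, \<beta>) | a (\<alpha>, \<beta>) \<noteq> 0. a (\<alpha>, \<beta>) * e_mono \<alpha> z * e_mono \<beta> (\<chi> i. cnj (w $ i)))"

text \<open>
  The function \<open>A\<close> on phase space with \<open>A (sqrt 2 * x, - sqrt 2 * \<xi>) = a (z, z)\<close> for
  \<open>z = x + \<i> * \<xi>\<close>, see \<open>toeplitz_symb_scaled\<close>.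
\<close>

definition toeplitz_symb :: "('n::finite) symb \<Rightarrow> real^'n \<Rightarrow> real^'n \<Rightarrow> complex" where
  "toeplitz_symb a x \<xi> =
     (let z = (\<chi> i. Complex (x $ i / sqrt 2) (- \<xi> $ i / sqrt 2)) in symb_eval a z z)"

lemma toeplitz_symb_scaled:
  "toeplitz_symb a (sqrt 2 *\<^sub>R x) (- sqrt 2 *\<^sub>R \<xi>) =
     symb_eval a (\<chi> i. Complex (x $ i) (\<xi> $ i)) (\<chi> i. Complex (x $ i) (\<xi> $ i))"
  by (simp add: toeplitz_symb_def Let_def)

definition L2_pairing :: "(('n::finite) mindex \<Rightarrow> complex) \<Rightarrow> ('n mindex \<Rightarrow> complex) \<Rightarrow> complex" where
  "L2_pairing f g = (\<Sum>\<alpha> | g \<alpha> \<noteq> 0. f \<alpha> * cnj (g \<alpha>))"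

text \<open>
  For \<open>a\<close> and \<open>f\<close> of finite support, the unique formal Hermite series representing the
  conjugate-linear form on the right-hand side.
\<close>

definition Tp :: "('n::finite) symb \<Rightarrow> ('n mindex \<Rightarrow> complex) \<Rightarrow> 'n mindex \<Rightarrow> complex" where
  "Tp a f = (THE u. \<forall>g\<in>H_fin. L2_pairing u g =
     (LINT (x, \<xi>)|lborel. toeplitz_symb a x \<xi> * stft (hermite_sum f) x \<xi> * cnj (stft (hermite_sum g) x \<xi>)))"


section \<open>Continuity of two-variable maps and unique extension\<close>

definition bounded_in :: "('i \<Rightarrow> complex) topology \<Rightarrow> ('i \<Rightarrow> complex) set \<Rightarrow> bool" where
  "bounded_in X B \<longleftrightarrow> B \<subseteq> topspace X \<and>
     (\<forall>U. openin X U \<and> (\<lambda>i. 0) \<in> U \<longrightarrow> (\<exists>t::real>0. \<forall>b\<in>B. (\<lambda>i. b i / of_real t) \<in> U))"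

text \<open>
  The extensions of \<open>(a, f) \<mapsto> Tp a f\<close> cannot be continuous for the product topology: if only the
  coefficients \<open>a (0, \<beta>)\<close> are non-zero, then the coefficient of \<open>Tp a f\<close> at \<open>0\<close> is
  \<open>\<Sum>\<beta>. a (0, \<beta>) * f \<beta>\<close>, so that such a continuity would include that of the pairing of the space
  of \<open>f\<close> with its dual, which fails because the spaces are not normable. Continuity in two
  variables is therefore understood as hypocontinuity, that is, joint continuity as soon as one
  of the variables is restricted to a bounded set. This contains separate continuity, and joint
  continuity along sequences.
\<close>

definition hypocontinuous ::
  "('i \<Rightarrow> complex) topology \<Rightarrow> ('j \<Rightarrow> complex) topology \<Rightarrow> 'c topology \<Rightarrow>
   (('i \<Rightarrow> complex) \<times> ('j \<Rightarrow> complex) \<Rightarrow> 'c) \<Rightarrow> bool" where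
  "hypocontinuous X Y Z T \<longleftrightarrow>
     (\<forall>B. bounded_in X B \<longrightarrow> continuous_map (prod_topology (subtopology X B) Y) Z T) \<and>
     (\<forall>B. bounded_in Y B \<longrightarrow> continuous_map (prod_topology X (subtopology Y B)) Z T)"

definition separately_continuous ::
  "'a topology \<Rightarrow> 'b topology \<Rightarrow> 'c topology \<Rightarrow> ('a \<times> 'b \<Rightarrow> 'c) \<Rightarrow> bool" where
  "separately_continuous X Y Z T \<longleftrightarrow>
     (\<forall>y\<in>topspace Y. continuous_map X Z (\<lambda>x. T (x, y))) \<and>
     (\<forall>x\<in>topspace X. continuous_map Y Z (\<lambda>y. T (x, y)))"

definition extends_on :: "'a set \<Rightarrow> ('a \<Rightarrow> 'b) \<Rightarrow> ('a \<Rightarrow> 'b) \<Rightarrow> bool" where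
  "extends_on D T0 T \<longleftrightarrow> (\<forall>x\<in>D. T x = T0 x)"

text \<open>
  A hypocontinuous extension exists, and it is unique even among the extensions that are
  merely separately continuous.
\<close>

definition uniquely_extendable ::
  "(('i \<Rightarrow> complex) \<times> ('j \<Rightarrow> complex)) set \<Rightarrow> (('i \<Rightarrow> complex) \<times> ('j \<Rightarrow> complex) \<Rightarrow> 'c) \<Rightarrow>
   ('i \<Rightarrow> complex) topology \<Rightarrow> ('j \<Rightarrow> complex) topology \<Rightarrow> 'c topology \<Rightarrow> bool" where
  "uniquely_extendable D T0 X Y Z \<longleftrightarrow>
     D \<subseteq> topspace X \<times> topspace Y \<and>
     (\<exists>T. hypocontinuous X Y Z T \<and> extends_on D T0 T \<and>
        (\<forall>T'. separately_continuous X Y Z T' \<and> extends_on D T0 T' \<longrightarrow>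
           (\<forall>x \<in> topspace X \<times> topspace Y. T' x = T x)))"

end

theory Submission
  imports Defs "HOL-Probability.Characteristic_Functions" "HOL-Real_Asymp.Real_Asymp"
begin

text \<open>
  The Bargmann transform and Gaussian moments give the coefficients
  \<open>(Tp a f)(\<delta>) = \<Sum> (\<alpha> + \<gamma>)! / sqrt (\<alpha>! \<beta>! \<gamma>! \<delta>!) * a (\<alpha>, \<beta>) * f \<gamma>\<close>, the sum extending over
  \<open>\<alpha> + \<gamma> = \<beta> + \<delta>\<close>, and the kernel is at most \<open>2 ^ \<bar>\<alpha> + \<gamma>\<bar>\<close>. All spaces carry a topology given by
  weighted \<open>l1\<close>-seminorms; for an inductive limit of steps with seminorms \<open>v\<^sub>n\<close> these are the
  weights dominated by every step, because the absolutely convex hull of balls \<open>v\<^sub>n < 1\<close> contains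
  the ball of \<open>2 * (INF n. v\<^sub>n)\<close>. With decreasing weights \<open>\<theta>\<^sub>n\<close> (\<open>vartheta\<close> with shrinking
  parameter, or \<open>1 / vartheta\<close> with growing parameter) the four claims reduce to two, and
  continuity follows from
  \<open>2 ^ \<bar>\<alpha> + \<gamma>\<bar> * \<theta>\<^sub>m \<beta> * \<theta>\<^sub>m \<delta> \<le> C * \<theta>\<^sub>n \<alpha> * \<theta>\<^sub>n \<gamma>\<close> for some \<open>m\<close> depending on \<open>n\<close>, where the
  restriction to \<open>s < 1/2\<close> or \<open>s \<le> 1/2\<close> enters. The inductive limits of symbols need not be
  regular, so a bounded set of symbols is not assumed to lie in a step; instead a gliding hump
  shows that a family of weights paired boundedly with all sequences dominated by every \<open>\<theta>\<^sub>n\<close> is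
  dominated by some \<open>1 / \<theta>\<^sub>k\<close>.
\<close>


section \<open>Koethe topologies\<close>

text \<open>Passing to reciprocals reverses the order of a family of weights. This is why the
  functions with index \<open>s2\<close> are a growing case and their duals a decaying one, while
  for \<open>s1\<close> it is the other way round.

  The two bounds on the index differ for the following reason. Put q = 1 / (2 s) and let N be the
  common degree of \<alpha> + \<gamma> and \<beta> + \<delta>. Comparing the exponents N^q across
  the two splittings of N costs a factor 2^(q + 1), which a change of the parameter repairs. There
  remains 2^N from the kernel, that is N ln 2 in the exponent. An arbitrarily small multiple of N^q
  outgrows it only if q > 1, which is the situation for \<open>vartheta\<close>; a large multiple
  does so already for q = 1, which is that of \<open>1 / vartheta\<close>. For flat indices all
  losses are geometric and are absorbed by \<open>r ^ mlen \<alpha>\<close>.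

  Equicontinuity asks that a supremum over a bounded set of symbols be a continuous weight on
  functions. If it must lie below each \<theta>_k, every k is tested separately. If it must lie
  below a single 1 / \<theta>_k, no k is distinguished beforehand; finding one is the task of the
  gliding hump.\<close>

definition wsum :: "('i \<Rightarrow> ennreal) \<Rightarrow> ('i \<Rightarrow> complex) \<Rightarrow> ennreal" where
  "wsum v c = (\<integral>\<^sup>+ i. ennreal (norm (c i)) * v i \<partial>count_space UNIV)"

text \<open>Weights are compared only on the support of \<open>c\<close>, because the domination in
  \<open>LP\<close> is available only at indices that occur in a step.\<close>

lemma wsum_mono:
  assumes "\<And>i. c i \<noteq> 0 \<Longrightarrow> v i \<le> w i" and "\<And>i. norm (c i) \<le> norm (d i)"
  shows "wsum v c \<le> wsum w d"
  unfolding wsum_def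
proof (rule nn_integral_mono)
  fix i
  show "ennreal (norm (c i)) * v i \<le> ennreal (norm (d i)) * w i"
    using assms(1)[of i] assms(2)[of i] by (cases "c i = 0") (auto intro!: mult_mono ennreal_leI)
qed

lemma wsum_0 [simp]: "wsum v (\<lambda>i. 0) = 0"
  by (simp add: wsum_def)

lemma wsum_add_le: "wsum v (\<lambda>i. b i + c i) \<le> wsum v b + wsum v c"
proof -
  have "wsum v (\<lambda>i. b i + c i) \<le>
      (\<integral>\<^sup>+ i. ennreal (norm (b i)) * v i + ennreal (norm (c i)) * v i \<partial>count_space UNIV)"
    unfolding wsum_def
    by (intro nn_integral_mono)
      (metis distrib_right ennreal_leI ennreal_plus mult_right_mono norm_ge_zero norm_triangle_ineq zero_le)
  also have "\<dots> = wsum v b + wsum v c"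
    unfolding wsum_def by (rule nn_integral_add) auto
  finally show ?thesis .
qed

lemma wsum_scale: "wsum v (\<lambda>i. x * c i) = ennreal (norm x) * wsum v c"
  unfolding wsum_def by (subst nn_integral_cmult[symmetric]) (auto simp: norm_mult ennreal_mult mult.assoc)

lemma wsum_cmult: "wsum (\<lambda>i. C * v i) c = C * wsum v c"
  unfolding wsum_def by (subst nn_integral_cmult[symmetric]) (auto simp: ac_simps)

lemma wsum_ge_point: "ennreal (norm (c i)) * v i \<le> wsum v c"
  unfolding wsum_def by (rule nn_integral_ge_point) auto

lemma wsum_finite_support:
  assumes "finite F" "\<And>i. i \<notin> F \<Longrightarrow> c i = 0"
  shows "wsum v c = (\<Sum>i\<in>F. ennreal (norm (c i)) * v i)"
proof -
  have "wsum v c = (\<integral>\<^sup>+ i. ennreal (norm (c i)) * v i \<partial>count_space F)"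
    unfolding wsum_def
    by (rule nn_integral_count_space_eq) (use assms in auto)
  then show ?thesis
    by (simp add: nn_integral_count_space_finite assms)
qed

text \<open>Monotone convergence along the finite sets of indices coded below \<open>n\<close>; a
  partial sum within \<open>\<epsilon>\<close> of the finite total leaves a tail below
  \<open>\<epsilon>\<close>.\<close>

lemma wsum_tail:
  fixes v :: "'i::countable \<Rightarrow> ennreal"
  assumes "wsum v c < \<infinity>" "0 < \<epsilon>"
  obtains F where "finite F" "wsum v (\<lambda>i. if i \<in> F then 0 else c i) < ennreal \<epsilon>"
proof -
  let ?f = "\<lambda>i. ennreal (norm (c i)) * v i"
  let ?F = "\<lambda>n::nat. {i::'i. to_nat i < n}"
  have fin: "finite (?F n)" for n
    by (rule inj_on_finite[of to_nat _ "{..<n}"]) (auto intro: inj_on_subset[OF inj_to_nat])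
  have sup: "(SUP n. ?f i * indicator (?F n) i) = ?f i" for i
  proof (rule antisym)
    show "(SUP n. ?f i * indicator (?F n) i) \<le> ?f i"
      by (rule SUP_least) (auto simp: indicator_def)
    show "?f i \<le> (SUP n. ?f i * indicator (?F n) i)"
      by (rule SUP_upper2[of "Suc (to_nat i)"]) auto
  qed
  have "wsum v c = (\<integral>\<^sup>+ i. (SUP n. ?f i * indicator (?F n) i) \<partial>count_space UNIV)"
    by (simp only: sup wsum_def)
  also have "\<dots> = (SUP n. \<integral>\<^sup>+ i. ?f i * indicator (?F n) i \<partial>count_space UNIV)"
    by (rule nn_integral_monotone_convergence_SUP)
       (auto simp: incseq_def le_fun_def indicator_def)
  finally have eq: "wsum v c = (SUP n. \<integral>\<^sup>+ i. ?f i * indicator (?F n) i \<partial>count_space UNIV)" .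
  have "\<exists>n. wsum v c < (\<integral>\<^sup>+ i. ?f i * indicator (?F n) i \<partial>count_space UNIV) + ennreal \<epsilon>"
  proof (cases "wsum v c = 0")
    case True then show ?thesis using assms(2) by (auto simp: add_pos_nonneg zero_less_iff_neq_zero)
  next
    case False
    then have "wsum v c - ennreal \<epsilon> < wsum v c"
      using assms by (intro ennreal_between) (auto simp: zero_less_iff_neq_zero)
    then obtain n where n: "wsum v c - ennreal \<epsilon> < (\<integral>\<^sup>+ i. ?f i * indicator (?F n) i \<partial>count_space UNIV)"
      unfolding eq less_SUP_iff by auto
    have "wsum v c \<le> ennreal \<epsilon> + (wsum v c - ennreal \<epsilon>)"
      by (metis ennreal_minus_le_iff order_refl ennreal_neq_top)
    also have "\<dots> < ennreal \<epsilon> + (\<integral>\<^sup>+ i. ?f i * indicator (?F n) i \<partial>count_space UNIV)"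
      using n by (subst ennreal_add_left_cancel_less) auto
    finally have "wsum v c < ennreal \<epsilon> + (\<integral>\<^sup>+ i. ?f i * indicator (?F n) i \<partial>count_space UNIV)" .
    then show ?thesis
      by (intro exI[of _ n]) (simp only: add.commute)
  qed
  then obtain n where n: "wsum v c < (\<integral>\<^sup>+ i. ?f i * indicator (?F n) i \<partial>count_space UNIV) + ennreal \<epsilon>" ..
  let ?A = "\<integral>\<^sup>+ i. ?f i * indicator (?F n) i \<partial>count_space UNIV"
  let ?d = "\<lambda>i. if i \<in> ?F n then 0 else c i"
  have "wsum v c = ?A + wsum v ?d"
    unfolding wsum_def
    by (subst nn_integral_add[symmetric]) (auto intro!: nn_integral_cong simp: indicator_def)
  moreover have "?A < \<infinity>" using assms calculation by auto
  ultimately have "wsum v ?d < ennreal \<epsilon>"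
    using n ennreal_add_left_cancel_less[of ?A "wsum v ?d" "ennreal \<epsilon>"] by simp
  then show thesis using that fin by blast
qed

text \<open>One unit ball per point suffices: the weight families used are closed under maxima and
  positive multiples, so finite intersections of balls of any radius contain a unit ball of a single
  weight.\<close>

definition kopen :: "('i \<Rightarrow> complex) set \<Rightarrow> ('i \<Rightarrow> ennreal) set \<Rightarrow> ('i \<Rightarrow> complex) set \<Rightarrow> bool" where
  "kopen E P U \<longleftrightarrow> U \<subseteq> E \<and> (\<forall>c\<in>U. \<exists>v\<in>P. \<forall>b\<in>E. wsum v (\<lambda>i. b i - c i) < 1 \<longrightarrow> b \<in> U)"

definition kothe_top :: "('i \<Rightarrow> complex) set \<Rightarrow> ('i \<Rightarrow> ennreal) set \<Rightarrow> ('i \<Rightarrow> complex) topology" where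
  "kothe_top E P = topology (kopen E P)"

text \<open>\<open>E_solid\<close> keeps truncations inside the space, whence finite families are
  dense. \<open>P_max\<close> and \<open>P_scale\<close> make the unit balls a base of
  neighbourhoods, so that neither radii nor finite sets of weights have to be carried along.\<close>

locale kothe =
  fixes E :: "('i::countable \<Rightarrow> complex) set" and P :: "('i \<Rightarrow> ennreal) set"
  assumes wsum_finite: "c \<in> E \<Longrightarrow> v \<in> P \<Longrightarrow> wsum v c < \<infinity>"
    and E_0: "(\<lambda>i. 0) \<in> E"
    and E_add: "a \<in> E \<Longrightarrow> b \<in> E \<Longrightarrow> (\<lambda>i. a i + b i) \<in> E"
    and E_scale: "a \<in> E \<Longrightarrow> (\<lambda>i. x * a i) \<in> E"
    and E_solid: "b \<in> E \<Longrightarrow> (\<And>i. norm (a i) \<le> norm (b i)) \<Longrightarrow> a \<in> E"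
    and P_ne: "P \<noteq> {}"
    and P_max: "u \<in> P \<Longrightarrow> v \<in> P \<Longrightarrow> (\<lambda>i. max (u i) (v i)) \<in> P"
    and P_scale: "v \<in> P \<Longrightarrow> 0 < C \<Longrightarrow> (\<lambda>i. ennreal C * v i) \<in> P"
begin

lemma E_diff: "a \<in> E \<Longrightarrow> b \<in> E \<Longrightarrow> (\<lambda>i. a i - b i) \<in> E"
  using E_add[of a "\<lambda>i. - 1 * b i"] E_scale[of b "-1"] by simp

lemma istopology_kopen: "istopology (kopen E P)"
  unfolding istopology_def
proof (intro conjI allI impI)
  fix S T assume S: "kopen E P S" and T: "kopen E P T"
  show "kopen E P (S \<inter> T)"
    unfolding kopen_def
  proof (intro conjI ballI)
    show "S \<inter> T \<subseteq> E" using S by (auto simp: kopen_def)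
  next
    fix c assume c: "c \<in> S \<inter> T"
    obtain u where u: "u \<in> P" "\<forall>b\<in>E. wsum u (\<lambda>i. b i - c i) < 1 \<longrightarrow> b \<in> S"
      using S c unfolding kopen_def by blast
    obtain v where v: "v \<in> P" "\<forall>b\<in>E. wsum v (\<lambda>i. b i - c i) < 1 \<longrightarrow> b \<in> T"
      using T c unfolding kopen_def by blast
    have "wsum u d \<le> wsum (\<lambda>i. max (u i) (v i)) d" "wsum v d \<le> wsum (\<lambda>i. max (u i) (v i)) d" for d
      by (auto intro!: wsum_mono)
    then have "\<forall>b\<in>E. wsum (\<lambda>i. max (u i) (v i)) (\<lambda>i. b i - c i) < 1 \<longrightarrow> b \<in> S \<inter> T"
      using u(2) v(2) by (blast intro: order_le_less_trans)
    then show "\<exists>v\<in>P. \<forall>b\<in>E. wsum v (\<lambda>i. b i - c i) < 1 \<longrightarrow> b \<in> S \<inter> T"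
      using P_max[OF u(1) v(1)] by (rule bexI)
  qed
next
  fix K assume "\<forall>S\<in>K. kopen E P S"
  then show "kopen E P (\<Union>K)"
    unfolding kopen_def by (meson Sup_least Union_iff)
qed

lemma openin_kothe: "openin (kothe_top E P) = kopen E P"
  by (simp add: kothe_top_def topology_inverse' istopology_kopen)

lemma topspace_kothe [simp]: "topspace (kothe_top E P) = E"
proof -
  have "kopen E P E" unfolding kopen_def using P_ne by blast
  then show ?thesis
    unfolding topspace_def openin_kothe by (metis Sup_upper Sup_least mem_Collect_eq subset_antisym kopen_def)
qed

text \<open>At a point whose distance \<open>s\<close> from the centre is below
  \<open>\<epsilon>\<close>, the unit ball of the weight multiplied by
  \<open>1 / (\<epsilon> - s)\<close> still fits in, by the triangle inequality.\<close>

lemma openin_ball: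
  assumes "c \<in> E" "v \<in> P" "0 < \<epsilon>"
  shows "openin (kothe_top E P) {b \<in> E. wsum v (\<lambda>i. b i - c i) < ennreal \<epsilon>}"
  unfolding openin_kothe kopen_def
proof (intro conjI ballI)
  fix d assume d: "d \<in> {b \<in> E. wsum v (\<lambda>i. b i - c i) < ennreal \<epsilon>}"
  then obtain s where s': "wsum v (\<lambda>i. d i - c i) = ennreal s" "0 \<le> s"
    by (cases "wsum v (\<lambda>i. d i - c i)") auto
  with d have s: "wsum v (\<lambda>i. d i - c i) = ennreal s" "0 \<le> s" "s < \<epsilon>"
    by (auto simp: ennreal_less_iff)
  let ?w = "\<lambda>i. ennreal (1 / (\<epsilon> - s)) * v i"
  have "b \<in> {b \<in> E. wsum v (\<lambda>i. b i - c i) < ennreal \<epsilon>}"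
    if b: "b \<in> E" "wsum ?w (\<lambda>i. b i - d i) < 1" for b
  proof -
    have "ennreal (\<epsilon> - s) * (ennreal (1 / (\<epsilon> - s)) * wsum v (\<lambda>i. b i - d i)) < ennreal (\<epsilon> - s) * 1"
      using b(2) s by (intro ennreal_mult_strict_left_mono) (auto simp: wsum_cmult)
    then have "wsum v (\<lambda>i. b i - d i) < ennreal (\<epsilon> - s)"
      using s by (simp add: mult.assoc[symmetric] ennreal_mult[symmetric])
    moreover have "wsum v (\<lambda>i. b i - c i) \<le> wsum v (\<lambda>i. b i - d i) + wsum v (\<lambda>i. d i - c i)"
      using wsum_add_le[of v "\<lambda>i. b i - d i" "\<lambda>i. d i - c i"] by simp
    ultimately have "wsum v (\<lambda>i. b i - c i) < ennreal (\<epsilon> - s) + ennreal s"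
      using s ennreal_add_left_cancel_less[of "ennreal s"] by (auto simp: add.commute intro: order_le_less_trans)
    then show ?thesis using s b by (simp add: ennreal_plus[symmetric] del: ennreal_plus)
  qed
  moreover have "?w \<in> P" using s by (intro P_scale assms) auto
  ultimately show "\<exists>w\<in>P. \<forall>b\<in>E. wsum w (\<lambda>i. b i - d i) < 1 \<longrightarrow>
      b \<in> {b \<in> E. wsum v (\<lambda>i. b i - c i) < ennreal \<epsilon>}"
    by blast
qed auto

lemma bounded_inD:
  assumes "bounded_in (kothe_top E P) B" "v \<in> P"
  obtains C where "0 < C" "\<And>b. b \<in> B \<Longrightarrow> wsum v b \<le> ennreal C"
proof -
  let ?U = "{b \<in> E. wsum v (\<lambda>i. b i - 0) < ennreal 1}"
  have "openin (kothe_top E P) ?U" by (rule openin_ball) (use E_0 assms in auto)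
  moreover have "(\<lambda>i. 0) \<in> ?U" using E_0 by simp
  ultimately obtain t :: real where t: "t > 0" "\<forall>b\<in>B. (\<lambda>i. b i / of_real t) \<in> ?U"
    using assms(1) unfolding bounded_in_def by meson
  have "wsum v b \<le> ennreal t" if "b \<in> B" for b
  proof -
    have "wsum v (\<lambda>i. of_real t * (b i / of_real t)) = ennreal t * wsum v (\<lambda>i. b i / of_real t)"
      using t by (subst wsum_scale) auto
    also have "\<dots> \<le> ennreal t * 1"
      using t that by (intro mult_left_mono) auto
    finally show ?thesis using t by simp
  qed
  then show thesis using that t by blast
qed

lemma bounded_in_singleton:
  assumes "c \<in> E" shows "bounded_in (kothe_top E P) {c}"
  unfolding bounded_in_def
proof (intro conjI allI impI)
  fix U assume U: "openin (kothe_top E P) U \<and> (\<lambda>i. 0) \<in> U"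
  then obtain v where v: "v \<in> P" "\<forall>b\<in>E. wsum v (\<lambda>i. b i - 0) < 1 \<longrightarrow> b \<in> U"
    unfolding openin_kothe kopen_def by meson
  obtain s where s: "wsum v c = ennreal s" "0 \<le> s"
    using wsum_finite[OF assms v(1)] by (metis ennreal_cases infinity_ennreal_def less_irrefl)
  \<comment> \<open>Division by \<open>s + 1\<close> instead of \<open>s\<close> makes the value
    strictly less than \<open>1\<close> and allows \<open>s = 0\<close>.\<close>
  have "wsum v (\<lambda>i. (1 / of_real (s + 1)) * c i) = ennreal (1 / (s + 1)) * ennreal s"
    using s by (simp only: wsum_scale norm_divide norm_of_real norm_one) simp
  also have "\<dots> = ennreal (s / (s + 1))" using s by (simp add: ennreal_mult[symmetric])
  also have "\<dots> < 1" using s by (simp add: ennreal_less_one_iff)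
  finally have "(\<lambda>i. c i / of_real (s + 1)) \<in> U"
    using v(2) E_scale[OF assms, of "1 / of_real (s + 1)"] by simp
  then show "\<exists>t::real>0. \<forall>b\<in>{c}. (\<lambda>i. b i / of_real t) \<in> U"
    using s by (intro exI[of _ "s + 1"]) auto
qed (use assms in auto)

text \<open>Cutting off outside a finite set leaves a tail as error, which is small in any one
  continuous weight; solidity keeps the truncation in \<open>E\<close>.\<close>

lemma closure_fin_families:
  assumes "c \<in> E"
  shows "c \<in> kothe_top E P closure_of fin_families"
  unfolding in_closure_of
proof (intro conjI allI impI)
  show "c \<in> topspace (kothe_top E P)" using assms by simp
  fix U assume "c \<in> U \<and> openin (kothe_top E P) U"
  then obtain v where v: "v \<in> P" "\<forall>b\<in>E. wsum v (\<lambda>i. b i - c i) < 1 \<longrightarrow> b \<in> U"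
    unfolding openin_kothe kopen_def by blast
  obtain F where F: "finite F" "wsum v (\<lambda>i. if i \<in> F then 0 else c i) < ennreal 1"
    using wsum_tail[OF wsum_finite[OF assms v(1)], of 1] by auto
  let ?b = "\<lambda>i. if i \<in> F then c i else 0"
  have "?b \<in> E" by (rule E_solid[OF assms]) auto
  moreover have "wsum v (\<lambda>i. ?b i - c i) \<le> wsum v (\<lambda>i. if i \<in> F then 0 else c i)"
    by (rule wsum_mono) auto
  ultimately have "?b \<in> U" using v F by auto
  moreover have "?b \<in> fin_families" using F by (auto simp: fin_families_def)
  ultimately show "\<exists>y. y \<in> fin_families \<and> y \<in> U" by blast
qed

text \<open>Point weights make the coordinates continuous. Distinct families differ at some
  \<open>j\<close>, and balls of half that difference in the \<open>j\<close>-th coordinate are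
  disjoint.\<close>

lemma Hausdorff_kothe:
  assumes "\<And>j. (\<lambda>i. if i = j then 1 else 0) \<in> P"
  shows "Hausdorff_space (kothe_top E P)"
  unfolding Hausdorff_space_def
proof (intro allI impI, goal_cases)
  case (1 x y)
  then obtain j where j: "x j \<noteq> y j" by auto
  define e where "e = norm (x j - y j) / 2"
  have e: "e > 0" using j by (simp add: e_def)
  let ?v = "\<lambda>i. if i = j then 1 else 0 :: ennreal"
  let ?B = "\<lambda>x. {b \<in> E. wsum ?v (\<lambda>i. b i - x i) < ennreal e}"
  have w: "wsum ?v c = ennreal (norm (c j))" for c
    using wsum_ge_point[of c j ?v] unfolding wsum_def
    by (subst nn_integral_count_space_eq[of UNIV "{j}"]) (auto simp: nn_integral_count_space_finite)
  have "disjnt (?B x) (?B y)"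
    unfolding disjnt_iff w
  proof (intro allI notI)
    fix b assume "b \<in> {b \<in> E. ennreal (norm (b j - x j)) < ennreal e} \<and> b \<in> {b \<in> E. ennreal (norm (b j - y j)) < ennreal e}"
    then have "norm (b j - x j) < e" "norm (b j - y j) < e" by (auto simp: ennreal_less_iff)
    then have "norm (x j - y j) < e + e"
      by (metis norm_diff_triangle_less norm_minus_commute)
    then show False by (simp add: e_def)
  qed
  moreover have "x \<in> ?B x" "y \<in> ?B y" using 1 e by auto
  ultimately show ?case
    using openin_ball[OF _ assms e] 1 unfolding topspace_kothe by blast
qed

end

section \<open>Projective and inductive limits\<close>

definition LE :: "(nat \<Rightarrow> nat \<Rightarrow> 'i \<Rightarrow> ennreal) \<Rightarrow> ('i \<Rightarrow> complex) set" where
  "LE a = {c. \<exists>n. \<forall>m. wsum (a n m) c < \<infinity>}"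

text \<open>
  \<open>LE a\<close> and \<open>LP a\<close> belong to the inductive limit over \<open>n\<close> of the projective limits over \<open>m\<close> of the
  weights \<open>a n m\<close>; a projective limit is the case of an \<open>a\<close> not depending on \<open>n\<close>. Since \<open>a n m i\<close>
  can be infinite (for \<open>s = 0\<close>), and \<open>\<infinity> / \<infinity> = 0\<close> makes it vanish for other \<open>m\<close>, domination is
  required only at the indices \<open>i\<close> that occur in the support of elements of the step \<open>n\<close>.
\<close>

definition LP :: "(nat \<Rightarrow> nat \<Rightarrow> 'i \<Rightarrow> ennreal) \<Rightarrow> ('i \<Rightarrow> ennreal) set" where
  "LP a = {v. \<forall>n. \<exists>m. \<exists>C>0. \<forall>i. (\<forall>k. a n k i < \<infinity>) \<longrightarrow> v i \<le> ennreal C * a n m i}"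

lemma LE_step: "LE a = (\<Union>n. LE (\<lambda>_. a n))"
  by (auto simp: LE_def)

lemma LP_step: "LP a = (\<Inter>n. LP (\<lambda>_. a n))"
  by (auto simp: LP_def)

lemma wsum_finite_imp:
  assumes "wsum v c < \<infinity>" "c i \<noteq> 0"
  shows "v i < \<infinity>"
proof -
  have "ennreal (norm (c i)) * v i < top"
    using wsum_ge_point[of c i v] assms(1) by (auto intro: order_le_less_trans)
  then show ?thesis using assms(2) by (auto simp: ennreal_mult_less_top)
qed

text \<open>Finiteness of all seminorms of the step forces finite weights on the support, which is
  where \<open>LP\<close> provides domination. The constants depend on \<open>v\<close> and
  \<open>n\<close> but not on \<open>c\<close>.\<close>

lemma LP_wsum_le:
  assumes "v \<in> LP a"
  obtains m C where "0 < C" "\<And>c. (\<And>k. wsum (a n k) c < \<infinity>) \<Longrightarrow> wsum v c \<le> ennreal C * wsum (a n m) c"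
proof -
  obtain m C where C: "C > 0" "\<And>i. (\<forall>k. a n k i < \<infinity>) \<Longrightarrow> v i \<le> ennreal C * a n m i"
    using assms unfolding LP_def by blast
  have "wsum v c \<le> ennreal C * wsum (a n m) c" if "\<And>k. wsum (a n k) c < \<infinity>" for c
    unfolding wsum_cmult[symmetric]
    by (rule wsum_mono) (use C(2) wsum_finite_imp[OF that] in auto)
  with C(1) show thesis using that by blast
qed

text \<open>As for LF-spaces: \<open>mono\<close> lets a single \<open>m\<close> replace finitely
  many seminorms of a step, and \<open>anti\<close> makes the steps increase with
  \<open>n\<close>.\<close>

locale lf_weights =
  fixes a :: "nat \<Rightarrow> nat \<Rightarrow> 'i::countable \<Rightarrow> ennreal"
  assumes mono: "k \<le> m \<Longrightarrow> a n k i \<le> a n m i"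
    and anti: "n \<le> m \<Longrightarrow> a m k i \<le> a n k i"
begin

sublocale kothe "LE a" "LP a"
proof
  fix c v assume "c \<in> LE a" and v: "v \<in> LP a"
  then obtain n where n: "\<And>m. wsum (a n m) c < \<infinity>" by (auto simp: LE_def)
  obtain m C where "wsum v c \<le> ennreal C * wsum (a n m) c"
    using LP_wsum_le[OF v, of n] n by metis
  also have "\<dots> < \<infinity>" using n[of m] by (auto simp: ennreal_mult_less_top)
  finally show "wsum v c < \<infinity>" .
next
  show "(\<lambda>i. 0) \<in> LE a" by (simp add: LE_def)
next
  fix c d assume "c \<in> LE a" "d \<in> LE a"
  then obtain n1 n2 where n: "\<And>m. wsum (a n1 m) c < \<infinity>" "\<And>m. wsum (a n2 m) d < \<infinity>"
    by (auto simp: LE_def)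
  have "wsum (a (max n1 n2) m) (\<lambda>i. c i + d i) < \<infinity>" for m
  proof -
    have "wsum (a (max n1 n2) m) (\<lambda>i. c i + d i) \<le> wsum (a (max n1 n2) m) c + wsum (a (max n1 n2) m) d"
      by (rule wsum_add_le)
    also have "\<dots> \<le> wsum (a n1 m) c + wsum (a n2 m) d"
      by (intro add_mono wsum_mono anti) auto
    also have "\<dots> < \<infinity>" using n[of m] by auto
    finally show ?thesis .
  qed
  then show "(\<lambda>i. c i + d i) \<in> LE a" by (auto simp: LE_def)
next
  fix c :: "'i \<Rightarrow> complex" and x assume "c \<in> LE a"
  then show "(\<lambda>i. x * c i) \<in> LE a"
    unfolding LE_def by (auto simp: wsum_scale ennreal_mult_less_top)
next
  fix b c :: "'i \<Rightarrow> complex" assume "b \<in> LE a" and le: "\<And>i. norm (c i) \<le> norm (b i)"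
  then obtain n where n: "\<And>m. wsum (a n m) b < \<infinity>" by (auto simp: LE_def)
  have "wsum (a n m) c < \<infinity>" for m
    using wsum_mono[of c "a n m" "a n m" b] le n[of m] by (auto intro: order_le_less_trans)
  then show "c \<in> LE a" by (auto simp: LE_def)
next
  have "(\<lambda>i. 0) \<in> LP a" by (auto simp: LP_def intro!: exI[of _ 1])
  then show "LP a \<noteq> {}" by blast
next
  fix u v assume uv: "u \<in> LP a" "v \<in> LP a"
  show "(\<lambda>i. max (u i) (v i)) \<in> LP a"
    unfolding LP_def
  proof (intro CollectI allI)
    fix n
    obtain m1 C1 where 1: "C1 > 0" "\<And>i. (\<forall>k. a n k i < \<infinity>) \<Longrightarrow> u i \<le> ennreal C1 * a n m1 i"
      using uv(1) unfolding LP_def by blast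
    obtain m2 C2 where 2: "C2 > 0" "\<And>i. (\<forall>k. a n k i < \<infinity>) \<Longrightarrow> v i \<le> ennreal C2 * a n m2 i"
      using uv(2) unfolding LP_def by blast
    have "ennreal C1 * a n m1 i \<le> ennreal (max C1 C2) * a n (max m1 m2) i"
         "ennreal C2 * a n m2 i \<le> ennreal (max C1 C2) * a n (max m1 m2) i" for i
      by (intro mult_mono mono ennreal_leI; simp)+
    then have "\<forall>i. (\<forall>k. a n k i < \<infinity>) \<longrightarrow> max (u i) (v i) \<le> ennreal (max C1 C2) * a n (max m1 m2) i"
      using 1(2) 2(2) by (meson max.boundedI order_trans)
    then show "\<exists>m. \<exists>C>0. \<forall>i. (\<forall>k. a n k i < \<infinity>) \<longrightarrow> max (u i) (v i) \<le> ennreal C * a n m i"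
      using 1(1) by (intro exI[of _ "max m1 m2"] exI[of _ "max C1 C2"]) auto
  qed
next
  fix v and C :: real assume v: "v \<in> LP a" and C: "0 < C"
  show "(\<lambda>i. ennreal C * v i) \<in> LP a"
    unfolding LP_def
  proof (intro CollectI allI)
    fix n
    obtain m D where 1: "D > 0" "\<And>i. (\<forall>k. a n k i < \<infinity>) \<Longrightarrow> v i \<le> ennreal D * a n m i"
      using v unfolding LP_def by blast
    have "ennreal C * v i \<le> ennreal (C * D) * a n m i" if "\<forall>k. a n k i < \<infinity>" for i
      using mult_left_mono[OF 1(2)[OF that], of "ennreal C"] C 1(1) by (simp add: ennreal_mult mult.assoc)
    then show "\<exists>m. \<exists>D>0. \<forall>i. (\<forall>k. a n k i < \<infinity>) \<longrightarrow> ennreal C * v i \<le> ennreal D * a n m i"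
      using C 1(1) by (intro exI[of _ m] exI[of _ "C * D"]) auto
  qed
qed

lemma kothe_LE_LP: "kothe (LE a) (LP a)"
  by unfold_locales

lemma lf_weights_step: "lf_weights (\<lambda>_. a n)"
  by unfold_locales (auto intro: mono)

end

section \<open>Absolutely convex sets and locally convex inductive limits\<close>

lemma abs_convexD:
  "abs_convex V \<Longrightarrow> u \<in> V \<Longrightarrow> v \<in> V \<Longrightarrow> norm x + norm y \<le> 1 \<Longrightarrow> (\<lambda>i. x * u i + y * v i) \<in> V"
  unfolding abs_convex_def by blast

text \<open>The induction carries a stronger claim: the partial sum is its total weight times a
  point of \<open>V\<close>. One more term is then merged by a two-point convex combination, after
  division by the new total.\<close>

lemma abs_convex_sum:
  assumes V: "abs_convex V" "(\<lambda>j. 0) \<in> V" and "finite F"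
    and "\<And>i. i \<in> F \<Longrightarrow> y i \<in> V" "\<And>i. i \<in> F \<Longrightarrow> 0 \<le> t i" "(\<Sum>i\<in>F. t i) \<le> (1::real)"
  shows "(\<lambda>j. \<Sum>i\<in>F. of_real (t i) * y i j) \<in> V"
proof -
  have "\<exists>z\<in>V. (\<lambda>j. \<Sum>i\<in>F. of_real (t i) * y i j) = (\<lambda>j. of_real (\<Sum>i\<in>F. t i) * z j)"
    using assms(3,4,5)
  proof (induction F rule: finite_induct)
    case empty
    then show ?case using V by auto
  next
    case (insert i F)
    define \<tau> where "\<tau> = (\<Sum>i\<in>F. t i)"
    obtain z where z: "z \<in> V" "(\<lambda>j. \<Sum>i\<in>F. of_real (t i) * y i j) = (\<lambda>j. of_real \<tau> * z j)"
      using insert unfolding \<tau>_def by auto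
    have nn: "0 \<le> \<tau>" "0 \<le> t i" using insert by (auto simp: \<tau>_def intro: sum_nonneg)
    have e: "(\<Sum>i\<in>insert i F. of_real (t i) * y i j) = of_real (t i) * y i j + of_real \<tau> * z j" for j
      using insert(1,2) fun_cong[OF z(2), of j] by simp
    have s: "(\<Sum>i\<in>insert i F. t i) = t i + \<tau>" using insert by (simp add: \<tau>_def)
    show ?case
    proof (cases "t i + \<tau> = 0")
      case True
      then have "t i = 0" "\<tau> = 0" using nn by auto
      then show ?thesis unfolding e s using z(1) by (intro bexI[of _ z]) auto
    next
      case False
      let ?z = "\<lambda>j. of_real (t i / (t i + \<tau>)) * y i j + of_real (\<tau> / (t i + \<tau>)) * z j"
      have "norm (complex_of_real (t i / (t i + \<tau>))) + norm (complex_of_real (\<tau> / (t i + \<tau>))) \<le> 1"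
        using nn False unfolding norm_of_real by (simp add: field_simps)
      then have "?z \<in> V" using V(1) z(1) insert(4)[of i] unfolding abs_convex_def by blast
      moreover have "(\<lambda>j. of_real (t i) * y i j + of_real \<tau> * z j) = (\<lambda>j. of_real (t i + \<tau>) * ?z j)"
      proof (rule ext)
        fix j
        have "complex_of_real (t i + \<tau>) * of_real (t i / (t i + \<tau>)) = of_real (t i)"
          "complex_of_real (t i + \<tau>) * of_real (\<tau> / (t i + \<tau>)) = of_real \<tau>"
          using False by (simp_all only: of_real_mult[symmetric]) auto
        then show "of_real (t i) * y i j + of_real \<tau> * z j = of_real (t i + \<tau>) * ?z j"
          by (simp only: distrib_left mult.assoc[symmetric])
      qed
      ultimately show ?thesis unfolding e s by (intro bexI[of _ ?z])
    qed
  qed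
  then obtain z where z: "z \<in> V" "(\<lambda>j. \<Sum>i\<in>F. of_real (t i) * y i j) = (\<lambda>j. of_real (\<Sum>i\<in>F. t i) * z j)"
    by blast
  have "norm (complex_of_real (\<Sum>i\<in>F. t i)) + norm (0::complex) \<le> 1"
    unfolding norm_of_real using assms(5,6) by (simp add: sum_nonneg)
  then have "(\<lambda>j. of_real (\<Sum>i\<in>F. t i) * z j + 0 * z j) \<in> V"
    using V(1) z(1) unfolding abs_convex_def by blast
  then show ?thesis using z(2) by simp
qed

lemma zero_nhd_kothe:
  assumes "kothe E P"
  shows "zero_nhd (kothe_top E P) V \<longleftrightarrow> (\<exists>v\<in>P. {b \<in> E. wsum v b < 1} \<subseteq> V)"
proof -
  interpret kothe E P by fact
  show ?thesis
  proof
    assume "zero_nhd (kothe_top E P) V"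
    then obtain U where "kopen E P U" "(\<lambda>i. 0) \<in> U" "U \<subseteq> V"
      by (auto simp: zero_nhd_def openin_kothe)
    moreover from this(1,2) have "\<exists>v\<in>P. \<forall>b\<in>E. wsum v (\<lambda>i. b i - 0) < 1 \<longrightarrow> b \<in> U"
      unfolding kopen_def by (elim conjE) (drule (1) bspec)
    ultimately show "\<exists>v\<in>P. {b \<in> E. wsum v b < 1} \<subseteq> V"
      by auto
  next
    assume "\<exists>v\<in>P. {b \<in> E. wsum v b < 1} \<subseteq> V"
    then obtain v where v: "v \<in> P" "{b \<in> E. wsum v b < 1} \<subseteq> V" by blast
    show "zero_nhd (kothe_top E P) V"
      unfolding zero_nhd_def
      using openin_ball[OF E_0 v(1), of 1] v(2) E_0 by (intro exI[of _ "{b \<in> E. wsum v b < 1}"]) auto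
  qed
qed

context lf_weights
begin

text \<open>
  With \<open>v = (INF n. 2 * u n)\<close>, half of an element of the \<open>v\<close>-ball is a finite part, which is a convex
  combination of multiples of unit vectors lying in balls of different steps, and half is a tail,
  which is small in a single step.
\<close>

lemma absorbing_hull:
  assumes V: "abs_convex V" and u: "\<And>n. u n \<in> LP (\<lambda>_. a n)"
    and uV: "\<And>n. {b \<in> LE (\<lambda>_. a n). wsum (u n) b < 1} \<subseteq> V"
  shows "\<exists>v\<in>LP a. {b \<in> LE a. wsum v b < 1} \<subseteq> V"
proof -
  \<comment> \<open>Only steps that contain the unit vector at \<open>i\<close> may enter the
    infimum: elsewhere \<open>LP\<close> leaves \<open>u n i\<close> unrestricted and
    \<open>uV\<close> says nothing about that vector.\<close>
  define N where "N i = {n. \<forall>k. a n k i < \<infinity>}" for i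
  define v where "v i = (INF n\<in>N i. 2 * u n i)" for i
  have zero: "(\<lambda>i. 0) \<in> V" using uV[of 0] by (auto simp: LE_def)
  have "v \<in> LP a"
    unfolding LP_def
  proof (intro CollectI allI)
    fix n
    obtain m C where C: "C > 0" "\<And>i. (\<forall>k. a n k i < \<infinity>) \<Longrightarrow> u n i \<le> ennreal C * a n m i"
      using u[of n] unfolding LP_def by blast
    have "v i \<le> ennreal (2 * C) * a n m i" if "\<forall>k. a n k i < \<infinity>" for i
    proof -
      have "v i \<le> 2 * u n i" unfolding v_def by (rule INF_lower) (use that in \<open>simp add: N_def\<close>)
      also have "\<dots> \<le> 2 * (ennreal C * a n m i)" by (intro mult_left_mono C(2) that) simp
      finally show ?thesis using C(1) by (simp add: ennreal_mult mult.assoc)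
    qed
    then show "\<exists>m. \<exists>C>0. \<forall>i. (\<forall>k. a n k i < \<infinity>) \<longrightarrow> v i \<le> ennreal C * a n m i"
      using C(1) by (intro exI[of _ m] exI[of _ "2 * C"]) auto
  qed
  moreover have "b \<in> V" if b: "b \<in> LE a" "wsum v b < 1" for b
  proof -
    obtain n where n: "b \<in> LE (\<lambda>_. a n)" using b(1) by (auto simp: LE_def)
    interpret s: lf_weights "\<lambda>_. a n" by (rule lf_weights_step)
    have nN: "n \<in> N i" if "b i \<noteq> 0" for i
      using n wsum_finite_imp[of _ b i] that by (auto simp: LE_def N_def)
    \<comment> \<open>The tail enters the final average doubled, hence the bound
      \<open>1/2\<close>.\<close>
    obtain F where F: "finite F" "wsum (u n) (\<lambda>i. if i \<in> F then 0 else b i) < ennreal (1/2)"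
      using wsum_tail[OF s.wsum_finite[OF n u], of "1/2"] by auto
    let ?t = "\<lambda>i. if i \<in> F then 0 else b i"
    have "(\<lambda>i. 2 * ?t i) \<in> LE (\<lambda>_. a n)"
      by (intro s.E_scale s.E_solid[OF n]) auto
    moreover have "wsum (u n) (\<lambda>i. 2 * ?t i) < 1"
    proof -
      have "wsum (u n) (\<lambda>i. 2 * ?t i) = ennreal 2 * wsum (u n) ?t" by (simp only: wsum_scale) simp
      also have "\<dots> < ennreal 2 * ennreal (1/2)" using F by (intro ennreal_mult_strict_left_mono) auto
      also have "\<dots> = ennreal (2 * (1/2))" by (rule ennreal_mult[symmetric]) auto
      finally show ?thesis by simp
    qed
    ultimately have tail: "(\<lambda>i. 2 * ?t i) \<in> V" using uV by blast
    define G where "G = {i \<in> F. b i \<noteq> 0}"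
    have G: "finite G" using F by (simp add: G_def)
    have vb: "ennreal (norm (b i)) * v i < top" for i
      by (rule order_le_less_trans[OF wsum_ge_point less_trans[OF b(2) ennreal_one_less_top]])
    define s where "s i = enn2real (ennreal (norm (b i)) * v i)" for i
    have s: "ennreal (norm (b i)) * v i = ennreal (s i)" "0 \<le> s i" for i
      using vb[of i] by (auto simp: s_def)
    have "ennreal (\<Sum>i\<in>G. s i) = (\<Sum>i\<in>G. ennreal (norm (b i)) * v i)"
      by (simp add: s sum_ennreal)
    also have "\<dots> = wsum v (\<lambda>i. if i \<in> G then b i else 0)"
      using G by (subst wsum_finite_support[of G]) auto
    also have "\<dots> \<le> wsum v b" by (rule wsum_mono) auto
    finally have "ennreal (\<Sum>i\<in>G. s i) < 1"
      using b(2) by (rule order_le_less_trans)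
    then have S: "(\<Sum>i\<in>G. s i) < 1" by simp
    \<comment> \<open>The slack \<open>1 - (\<Sum>i\<in>G. s i)\<close> is distributed evenly, so
      that \<open>t i\<close> exceeds \<open>s i\<close> strictly while the total stays at most
      \<open>1\<close>. Strictness is what lets the infimum \<open>v i\<close> be replaced by the
      value at an actual step.\<close>
    define t where "t i = s i + (1 - (\<Sum>i\<in>G. s i)) / card G" for i
    have tpos: "0 < t i" "s i < t i" if "i \<in> G" for i
    proof -
      have "0 < card G" using that G by (auto simp: card_gt_0_iff)
      then have "0 < (1 - (\<Sum>i\<in>G. s i)) / card G" using S by simp
      then show "0 < t i" "s i < t i" using s(2)[of i] unfolding t_def by linarith+
    qed
    have tne: "t i \<noteq> 0" if "i \<in> G" for i using tpos(1)[OF that] by simp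
    have tsum: "(\<Sum>i\<in>G. t i) \<le> 1"
      using S by (cases "G = {}") (auto simp: t_def sum.distrib)
    \<comment> \<open>\<open>t i * y i\<close> gives back \<open>2 * b i\<close> at
      \<open>i\<close>; the factor \<open>2\<close> is undone by the final average with the
      tail.\<close>
    define y where "y i = (\<lambda>j. if j = i then 2 * b i / of_real (t i) else 0)" for i
    have y: "y i \<in> V" if i: "i \<in> G" for i
    proof -
      have bi: "b i \<noteq> 0" using i by (simp add: G_def)
      have "v i < ennreal (t i / norm (b i))"
      proof (rule ccontr)
        assume "\<not> ?thesis"
        then have "ennreal (norm (b i)) * ennreal (t i / norm (b i)) \<le> ennreal (s i)"
          unfolding s(1)[symmetric] by (intro mult_left_mono) auto
        then have "t i \<le> s i" using bi tpos[OF i] s(2)[of i] by (simp add: ennreal_mult[symmetric])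
        then show False using tpos[OF i] by simp
      qed
      then obtain n' where n': "n' \<in> N i" "2 * u n' i < ennreal (t i / norm (b i))"
        unfolding v_def INF_less_iff by blast
      have w: "wsum w (y i) = ennreal (2 * norm (b i) / t i) * w i" for w
        using tpos[OF i] by (subst wsum_finite_support[of "{i}"]) (auto simp: y_def norm_divide norm_mult)
      have "y i \<in> LE (\<lambda>_. a n')"
        using n'(1) unfolding LE_def N_def by (auto simp: w ennreal_mult_less_top)
      moreover have "wsum (u n') (y i) < 1"
      proof -
        have "wsum (u n') (y i) = ennreal (norm (b i) / t i) * (2 * u n' i)"
          unfolding w using tpos[OF i] ennreal_mult[of "norm (b i) / t i" 2] by (simp add: ac_simps)
        also have "\<dots> < ennreal (norm (b i) / t i) * ennreal (t i / norm (b i))"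
          using n'(2) bi tpos[OF i] by (intro ennreal_mult_strict_left_mono) auto
        also have "\<dots> = 1" using bi tpos[OF i] by (simp add: ennreal_mult[symmetric])
        finally show ?thesis .
      qed
      ultimately show ?thesis using uV by blast
    qed
    have "(\<lambda>j. \<Sum>i\<in>G. of_real (t i) * y i j) \<in> V"
      by (rule abs_convex_sum[OF V zero G]) (use y tpos tsum in \<open>auto intro: less_imp_le\<close>)
    moreover have "(\<Sum>i\<in>G. of_real (t i) * y i j) = (if j \<in> F then 2 * b j else 0)" for j
    proof -
      have "(\<Sum>i\<in>G. of_real (t i) * y i j) = (\<Sum>i\<in>G. if j = i then 2 * b j else 0)"
        by (rule sum.cong) (auto simp: y_def tne)
      also have "\<dots> = (if j \<in> G then 2 * b j else 0)" using G by simp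
      also have "\<dots> = (if j \<in> F then 2 * b j else 0)" by (auto simp: G_def)
      finally show ?thesis .
    qed
    ultimately have fin: "(\<lambda>j. if j \<in> F then 2 * b j else 0) \<in> V" by simp
    have "(\<lambda>j. 1/2 * (if j \<in> F then 2 * b j else 0) + 1/2 * (2 * ?t j)) \<in> V"
      by (rule abs_convexD[OF V fin tail]) simp
    moreover have "(\<lambda>j. 1/2 * (if j \<in> F then 2 * b j else 0) + 1/2 * (2 * ?t j)) = b" by auto
    ultimately show ?thesis by simp
  qed
  ultimately show ?thesis by blast
qed

text \<open>Unit balls of weights in \<open>LP a\<close> are absolutely convex and are
  neighbourhoods in every step; conversely \<open>absorbing_hull\<close> puts such a ball inside any
  absolutely convex neighbourhood. Translation carries this from \<open>0\<close> to all
  points.\<close>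

lemma ind_lim_kothe:
  "ind_lim UNIV (\<lambda>n. kothe_top (LE (\<lambda>_. a n)) (LP (\<lambda>_. a n))) = kothe_top (LE a) (LP a)"
    (is "ind_lim UNIV ?X = _")
proof (rule topology_eq[THEN iffD2], intro allI)
  fix U
  have ts: "topspace (?X n) = LE (\<lambda>_. a n)" for n
    by (rule kothe.topspace_kothe) (rule lf_weights_step[THEN lf_weights.kothe_LE_LP])
  have zn: "zero_nhd (?X n) V \<longleftrightarrow> (\<exists>v\<in>LP (\<lambda>_. a n). {b \<in> LE (\<lambda>_. a n). wsum v b < 1} \<subseteq> V)" for n V
    by (rule zero_nhd_kothe) (rule lf_weights_step[THEN lf_weights.kothe_LE_LP])
  have un: "(\<Union>n. topspace (?X n)) = LE a" by (simp add: ts LE_step[of a])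
  have "ind_open UNIV ?X U \<longleftrightarrow> kopen (LE a) (LP a) U"
  proof
    assume U: "ind_open UNIV ?X U"
    show "kopen (LE a) (LP a) U"
      unfolding kopen_def
    proof (intro conjI ballI)
      show "U \<subseteq> LE a" using U unfolding ind_open_def un by blast
      fix c assume c: "c \<in> U"
      then obtain V where V: "ind_base UNIV ?X V" "\<forall>v\<in>V. (\<lambda>i. c i + v i) \<in> U"
        using U unfolding ind_open_def by blast
      have "\<forall>n. \<exists>v\<in>LP (\<lambda>_. a n). {b \<in> LE (\<lambda>_. a n). wsum v b < 1} \<subseteq> V"
        using V(1) unfolding ind_base_def zn by blast
      then obtain u where "\<And>n. u n \<in> LP (\<lambda>_. a n)" "\<And>n. {b \<in> LE (\<lambda>_. a n). wsum (u n) b < 1} \<subseteq> V"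
        by metis
      then obtain v where v: "v \<in> LP a" "{b \<in> LE a. wsum v b < 1} \<subseteq> V"
        using absorbing_hull[of V u] V(1) unfolding ind_base_def by blast
      have "b \<in> U" if "b \<in> LE a" "wsum v (\<lambda>i. b i - c i) < 1" for b
      proof -
        have "(\<lambda>i. b i - c i) \<in> V" using v(2) that c E_diff[of b c] \<open>U \<subseteq> LE a\<close> by blast
        from V(2)[rule_format, OF this] show ?thesis by simp
      qed
      then show "\<exists>v\<in>LP a. \<forall>b\<in>LE a. wsum v (\<lambda>i. b i - c i) < 1 \<longrightarrow> b \<in> U" using v(1) by blast
    qed
  next
    assume U: "kopen (LE a) (LP a) U"
    show "ind_open UNIV ?X U"
      unfolding ind_open_def un
    proof (intro conjI ballI)
      show UE: "U \<subseteq> LE a" using U by (auto simp: kopen_def)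
      fix c assume c: "c \<in> U"
      then obtain v where v: "v \<in> LP a" "\<forall>b\<in>LE a. wsum v (\<lambda>i. b i - c i) < 1 \<longrightarrow> b \<in> U"
        using U unfolding kopen_def by blast
      let ?V = "{b \<in> LE a. wsum v b < 1}"
      have "abs_convex ?V"
        unfolding abs_convex_def
      proof (intro ballI allI impI)
        fix b d x y assume bd: "b \<in> ?V" "d \<in> ?V" "norm (x::complex) + norm (y::complex) \<le> 1"
        have "wsum v (\<lambda>i. x * b i + y * d i) \<le> ennreal (norm x) * wsum v b + ennreal (norm y) * wsum v d"
          using wsum_add_le[of v "\<lambda>i. x * b i" "\<lambda>i. y * d i"] by (simp only: wsum_scale)
        also have "\<dots> \<le> ennreal (norm x) * max (wsum v b) (wsum v d) + ennreal (norm y) * max (wsum v b) (wsum v d)"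
          by (intro add_mono mult_left_mono) auto
        also have "\<dots> = ennreal (norm x + norm y) * max (wsum v b) (wsum v d)"
          by (simp add: distrib_right)
        also have "\<dots> \<le> 1 * max (wsum v b) (wsum v d)"
          using ennreal_leI[OF bd(3)] by (intro mult_right_mono) (auto simp del: ennreal_plus)
        also have "\<dots> < 1" using bd by auto
        finally show "(\<lambda>i. x * b i + y * d i) \<in> ?V"
          using bd by (auto intro!: E_add E_scale)
      qed
      moreover have "zero_nhd (?X n) ?V" for n
        unfolding zn using v(1) unfolding LP_step[of a] LE_step[of a] by blast
      ultimately have "ind_base UNIV ?X ?V" unfolding ind_base_def un by blast
      moreover have "\<forall>b\<in>?V. (\<lambda>i. c i + b i) \<in> U"
      proof
        fix b assume "b \<in> ?V"
        then show "(\<lambda>i. c i + b i) \<in> U"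
          using v(2)[rule_format, of "\<lambda>i. c i + b i"] E_add[of c b] c UE by auto
      qed
      ultimately show "\<exists>V. ind_base UNIV ?X V \<and> (\<forall>v\<in>V. (\<lambda>i. c i + v i) \<in> U)" by blast
    qed
  qed
  then show "openin (ind_lim UNIV ?X) U = openin (kothe_top (LE a) (LP a)) U"
    by (simp only: openin_ind_lim openin_kothe)
qed

end

section \<open>Limits over cofinal parameters\<close>

lemma zero_nhd_continuous_incl:
  assumes "continuous_map T S (\<lambda>x. x)" "zero_nhd S V" "(\<lambda>i. 0) \<in> topspace T"
  shows "zero_nhd T V"
proof -
  obtain U where U: "openin S U" "(\<lambda>i. 0) \<in> U" "U \<subseteq> V" using assms(2) by (auto simp: zero_nhd_def)
  then have "openin T {x \<in> topspace T. x \<in> U}" using assms(1) by (auto simp: continuous_map_def)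
  then show ?thesis
    unfolding zero_nhd_def using U assms(3) by (intro exI[of _ "{x \<in> topspace T. x \<in> U}"]) auto
qed

lemma ind_base_mono:
  assumes 1: "\<And>r. r \<in> I \<Longrightarrow> \<exists>n\<in>J. continuous_map (X r) (Y n) (\<lambda>x. x)"
    and 2: "\<And>n. n \<in> J \<Longrightarrow> \<exists>r\<in>I. continuous_map (Y n) (X r) (\<lambda>x. x)"
    and 0: "\<And>r. r \<in> I \<Longrightarrow> (\<lambda>i. 0) \<in> topspace (X r)"
    and V: "ind_base J Y V"
  shows "ind_base I X V"
proof -
  have "(\<Union>n\<in>J. topspace (Y n)) \<subseteq> (\<Union>r\<in>I. topspace (X r))"
    using 2 unfolding continuous_map_def by fast
  moreover have "zero_nhd (X r) V" if r: "r \<in> I" for r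
  proof -
    obtain n where "n \<in> J" "continuous_map (X r) (Y n) (\<lambda>x. x)" using 1[OF r] by blast
    then show ?thesis using V zero_nhd_continuous_incl 0[OF r] unfolding ind_base_def by blast
  qed
  ultimately show ?thesis
    using V unfolding ind_base_def by blast
qed

text \<open>Two families of steps that embed continuously into one another have the same union and
  the same absolutely convex neighbourhoods of \<open>0\<close>. This replaces the real parameters
  by natural numbers.\<close>

lemma ind_lim_eqI:
  assumes 1: "\<And>r. r \<in> I \<Longrightarrow> \<exists>n\<in>J. continuous_map (X r) (Y n) (\<lambda>x. x)"
    and 2: "\<And>n. n \<in> J \<Longrightarrow> \<exists>r\<in>I. continuous_map (Y n) (X r) (\<lambda>x. x)"
    and 0: "\<And>r. r \<in> I \<Longrightarrow> (\<lambda>i. 0) \<in> topspace (X r)" "\<And>n. n \<in> J \<Longrightarrow> (\<lambda>i. 0) \<in> topspace (Y n)"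
  shows "ind_lim I X = ind_lim J Y"
proof -
  have "(\<Union>r\<in>I. topspace (X r)) = (\<Union>n\<in>J. topspace (Y n))"
    using 1 2 unfolding continuous_map_def by (intro antisym) fast+
  moreover have "ind_base I X V \<longleftrightarrow> ind_base J Y V" for V
    using ind_base_mono[of J I Y X V] ind_base_mono[of I J X Y V] 1 2 0 by blast
  ultimately have "ind_open I X = ind_open J Y"
    unfolding ind_open_def fun_eq_iff by simp
  then show ?thesis by (simp add: ind_lim_def)
qed

lemma topspace_proj_lim:
  assumes "I \<noteq> {}"
  shows "topspace (proj_lim I X) = (\<Inter>j\<in>I. topspace (X j))"
proof -
  obtain i where "i \<in> I" using assms by blast
  then have "(\<Inter>j\<in>I. topspace (X j)) \<in> {U \<inter> (\<Inter>j\<in>I. topspace (X j)) | U i. i \<in> I \<and> openin (X i) U}"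
    by (intro CollectI exI[of _ "topspace (X i)"]) auto
  then show ?thesis unfolding proj_lim_def topology_generated_by_topspace by blast
qed

lemma openin_proj_lim:
  assumes "i \<in> I" "openin (X i) U"
  shows "openin (proj_lim I X) (U \<inter> (\<Inter>j\<in>I. topspace (X j)))"
  unfolding proj_lim_def by (rule topology_generated_by_Basis) (use assms in blast)

text \<open>Turns an inductive limit of single weighted spaces into one of constant projective
  limits, so that functions and symbols are covered by the same result.\<close>

lemma proj_lim_const:
  assumes "I \<noteq> {}"
  shows "proj_lim I (\<lambda>_. X) = X"
proof -
  have "{U \<inter> (\<Inter>j\<in>I. topspace X) | U i. i \<in> I \<and> openin X U} = {U. openin X U}"
  proof -
    have "U \<inter> (\<Inter>j\<in>I. topspace X) = U" if "openin X U" for U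
      using openin_subset[OF that] assms by auto
    then show ?thesis using assms by auto
  qed
  then have "proj_lim I (\<lambda>_. X) = topology_generated_by {U. openin X U}"
    by (simp add: proj_lim_def)
  also have "\<dots> = X"
  proof (rule topology_eq[THEN iffD2], intro allI iffI)
    fix U assume "openin (topology_generated_by {U. openin X U}) U"
    then have "generate_topology_on {U. openin X U} U" by (rule openin_topology_generated_by)
    then show "openin X U" by induction auto
  qed (auto intro: topology_generated_by_Basis)
  finally show ?thesis .
qed

text \<open>
  The geometric factor is what makes the limit spaces independent of \<open>p\<close>: it lets the \<open>l1\<close>-seminorm
  and the \<open>lp\<close>-quasinorm of the two weights bound each other for every \<open>p\<close>.
\<close>

definition strongly_dominated ::
  "('i \<Rightarrow> nat) \<Rightarrow> ('i \<Rightarrow> ennreal) \<Rightarrow> ('i \<Rightarrow> ennreal) \<Rightarrow> bool" where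
  "strongly_dominated h u v \<longleftrightarrow> (\<exists>C>0. \<exists>e. 0 < e \<and> e < 1 \<and> (\<forall>i. u i \<le> ennreal (C * e ^ h i) * v i))"

definition geom_summable :: "('i \<Rightarrow> nat) \<Rightarrow> bool" where
  "geom_summable h \<longleftrightarrow> (\<forall>e::real. 0 < e \<and> e < 1 \<longrightarrow> (\<integral>\<^sup>+i. ennreal (e ^ h i) \<partial>count_space UNIV) < \<infinity>)"

section \<open>Comparison of lp-quasinorms and l1-seminorms\<close>

lemma epowr_mono: "x \<le> y \<Longrightarrow> 0 < q \<Longrightarrow> epowr x q \<le> epowr y q"
  by (cases x; cases y) (auto simp: epowr_def top_unique intro: powr_mono2)

lemma epowr_epowr: "0 < q \<Longrightarrow> epowr (epowr x q) (1 / q) = x"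
  by (cases x) (auto simp: epowr_def powr_powr)

lemma epowr_mult_ennreal: "0 \<le> r \<Longrightarrow> 0 < q \<Longrightarrow> epowr (ennreal k * ennreal r) q = epowr (ennreal k) q * ennreal (r powr q)"
  by (cases "0 \<le> k") (auto simp: epowr_def powr_mult ennreal_mult[symmetric] ennreal_neg)

lemma point_le_wnorm:
  assumes "0 < p"
  shows "ennreal (norm (c i)) * v i \<le> wnorm p v c"
proof (cases "p = \<infinity>")
  case True
  then show ?thesis by (auto simp: wnorm_def lp_norm_def intro: SUP_upper)
next
  case False
  let ?q = "enn2real p"
  have q: "0 < ?q" using assms False by (auto simp: enn2real_positive_iff top.not_eq_extremum)
  let ?u = "\<lambda>i. ennreal (norm (c i)) * v i"
  have "epowr (?u i) ?q \<le> (\<integral>\<^sup>+ i. epowr (?u i) ?q \<partial>count_space UNIV)"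
    by (rule nn_integral_ge_point) simp
  then have "epowr (epowr (?u i) ?q) (1 / ?q) \<le> epowr (\<integral>\<^sup>+ i. epowr (?u i) ?q \<partial>count_space UNIV) (1 / ?q)"
    using q by (intro epowr_mono) auto
  then show ?thesis using False q by (simp add: epowr_epowr wnorm_def lp_norm_def)
qed

text \<open>For finite \<open>p\<close> the \<open>p\<close>-th powers of \<open>e ^ h i\<close> are
  again geometric, with a ratio below \<open>1\<close>. The constant does not depend on
  \<open>c\<close>, \<open>v\<close> or \<open>K\<close>.\<close>

lemma wnorm_geom:
  assumes "geom_summable h" "0 < p" "0 < e" "e < (1::real)"
  obtains D where "0 < D"
    "\<And>c v K. (\<And>i. ennreal (norm (c i)) * v i \<le> K * ennreal (e ^ h i)) \<Longrightarrow> wnorm p v c \<le> K * ennreal D"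
proof (cases "p = \<infinity>")
  case True
  have "wnorm p v c \<le> K * ennreal 1"
    if "\<And>i. ennreal (norm (c i)) * v i \<le> K * ennreal (e ^ h i)" for c v K
  proof -
    have "K * ennreal (e ^ h i) \<le> K * ennreal 1" for i
      using assms by (intro mult_left_mono ennreal_leI) (auto intro: power_le_one)
    then show ?thesis
      using that unfolding wnorm_def lp_norm_def True by (auto intro!: SUP_least intro: order_trans)
  qed
  then show thesis using that zero_less_one by blast
next
  case False
  let ?q = "enn2real p"
  have q: "0 < ?q" using assms False by (auto simp: enn2real_positive_iff top.not_eq_extremum)
  define S where "S = (\<integral>\<^sup>+i. ennreal ((e powr ?q) ^ h i) \<partial>count_space UNIV)"
  have "e powr ?q < 1" using assms q powr_less_mono2[of ?q e 1] by simp
  then have "S < \<infinity>" using assms unfolding geom_summable_def S_def by auto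
  then obtain \<sigma> where \<sigma>: "S = ennreal \<sigma>" "0 \<le> \<sigma>" by (cases S) auto
  \<comment> \<open>\<open>\<sigma> + 1\<close> instead of \<open>\<sigma>\<close> makes
    \<open>D\<close> positive without a lower bound for the series.\<close>
  define D where "D = (\<sigma> + 1) powr (1 / ?q)"
  have D: "0 < D" using \<sigma> by (simp add: D_def)
  have "wnorm p v c \<le> K * ennreal D"
    if le: "\<And>i. ennreal (norm (c i)) * v i \<le> K * ennreal (e ^ h i)" for c v K
  proof (cases K)
    case top
    then show ?thesis using D by (simp add: ennreal_top_mult)
  next
    case (real k)
    have "(\<integral>\<^sup>+ i. epowr (ennreal (norm (c i)) * v i) ?q \<partial>count_space UNIV)
        \<le> (\<integral>\<^sup>+ i. epowr K ?q * ennreal ((e powr ?q) ^ h i) \<partial>count_space UNIV)"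
    proof (rule nn_integral_mono)
      fix i
      have "epowr (ennreal (norm (c i)) * v i) ?q \<le> epowr (K * ennreal (e ^ h i)) ?q"
        by (intro epowr_mono le q)
      also have "\<dots> = epowr K ?q * ennreal ((e ^ h i) powr ?q)"
        unfolding real using assms q by (intro epowr_mult_ennreal) auto
      also have "(e ^ h i) powr ?q = (e powr ?q) ^ h i"
        using assms by (simp add: powr_powr powr_realpow[symmetric] mult.commute)
      finally show "epowr (ennreal (norm (c i)) * v i) ?q \<le> epowr K ?q * ennreal ((e powr ?q) ^ h i)" .
    qed
    also have "\<dots> = epowr K ?q * S" unfolding S_def by (rule nn_integral_cmult) simp
    also have "\<dots> = ennreal (k powr ?q * \<sigma>)" using real \<sigma> by (simp add: epowr_def ennreal_mult)
    also have "\<dots> \<le> ennreal (k powr ?q * (\<sigma> + 1))" by (intro ennreal_leI mult_left_mono) auto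
    finally have "epowr (\<integral>\<^sup>+ i. epowr (ennreal (norm (c i)) * v i) ?q \<partial>count_space UNIV) (1 / ?q)
        \<le> epowr (ennreal (k powr ?q * (\<sigma> + 1))) (1 / ?q)"
      using q by (intro epowr_mono) auto
    also have "\<dots> = ennreal (k * D)"
      using real \<sigma> q by (simp add: epowr_def powr_mult powr_powr D_def)
    finally show ?thesis using False real D by (simp add: wnorm_def lp_norm_def ennreal_mult)
  qed
  then show thesis using that D by blast
qed

text \<open>Every term of the l1-sum is at most the sum; the geometric factor left over turns this
  pointwise bound into one for the quasinorm.\<close>

lemma wnorm_le_wsum:
  assumes "strongly_dominated h u v" "geom_summable h" "0 < p"
  obtains D where "0 < D" "\<And>c. wnorm p u c \<le> ennreal D * wsum v c"
proof -
  obtain C e where C: "C > 0" "0 < e" "e < 1" "\<And>i. u i \<le> ennreal (C * e ^ h i) * v i"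
    using assms(1) unfolding strongly_dominated_def by blast
  obtain D where D: "0 < D"
    "\<And>c v K. (\<And>i. ennreal (norm (c i)) * v i \<le> K * ennreal (e ^ h i)) \<Longrightarrow> wnorm p v c \<le> K * ennreal D"
    using wnorm_geom[OF assms(2,3) C(2,3)] by blast
  have "wnorm p u c \<le> ennreal (C * D) * wsum v c" for c
  proof -
    have "ennreal (norm (c i)) * u i \<le> (ennreal C * wsum v c) * ennreal (e ^ h i)" for i
    proof -
      have "ennreal (norm (c i)) * u i \<le> ennreal (norm (c i)) * (ennreal (C * e ^ h i) * v i)"
        by (intro mult_left_mono C(4)) simp
      also have "\<dots> = (ennreal C * (ennreal (norm (c i)) * v i)) * ennreal (e ^ h i)"
        using C by (simp add: ennreal_mult ac_simps)
      also have "\<dots> \<le> (ennreal C * wsum v c) * ennreal (e ^ h i)"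
        by (intro mult_right_mono mult_left_mono wsum_ge_point) auto
      finally show ?thesis .
    qed
    from D(2)[of c, OF this] show ?thesis using C D by (simp add: ennreal_mult ac_simps)
  qed
  then show thesis using that[of "C * D"] C D by auto
qed

text \<open>Every term is at most the quasinorm, and the geometric factor is summable.\<close>

lemma wsum_le_wnorm:
  assumes "strongly_dominated h u v" "geom_summable h" "0 < p"
  obtains D where "0 < D" "\<And>c. wsum u c \<le> ennreal D * wnorm p v c"
proof -
  obtain C e where C: "C > 0" "0 < e" "e < 1" "\<And>i. u i \<le> ennreal (C * e ^ h i) * v i"
    using assms(1) unfolding strongly_dominated_def by blast
  define S where "S = (\<integral>\<^sup>+i. ennreal (e ^ h i) \<partial>count_space UNIV)"
  have "S < \<infinity>" using assms C unfolding geom_summable_def S_def by auto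
  then obtain \<sigma> where \<sigma>: "S = ennreal \<sigma>" "0 \<le> \<sigma>" by (cases S) auto
  have "wsum u c \<le> ennreal (C * (\<sigma> + 1)) * wnorm p v c" for c
  proof -
    have "wsum u c \<le> (\<integral>\<^sup>+i. (ennreal C * wnorm p v c) * ennreal (e ^ h i) \<partial>count_space UNIV)"
      unfolding wsum_def
    proof (rule nn_integral_mono)
      fix i
      have "ennreal (norm (c i)) * u i \<le> ennreal (norm (c i)) * (ennreal (C * e ^ h i) * v i)"
        by (intro mult_left_mono C(4)) simp
      also have "\<dots> = (ennreal C * (ennreal (norm (c i)) * v i)) * ennreal (e ^ h i)"
        using C by (simp add: ennreal_mult ac_simps)
      also have "\<dots> \<le> (ennreal C * wnorm p v c) * ennreal (e ^ h i)"
        by (intro mult_right_mono mult_left_mono point_le_wnorm assms) auto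
      finally show "ennreal (norm (c i)) * u i \<le> (ennreal C * wnorm p v c) * ennreal (e ^ h i)" .
    qed
    also have "\<dots> = (ennreal C * wnorm p v c) * S"
      unfolding S_def by (rule nn_integral_cmult) simp
    also have "\<dots> \<le> (ennreal C * wnorm p v c) * ennreal (\<sigma> + 1)"
      unfolding \<sigma> by (intro mult_left_mono ennreal_leI) auto
    finally show ?thesis using C \<sigma> by (simp add: ennreal_mult ac_simps)
  qed
  then show thesis using that[of "C * (\<sigma> + 1)"] C \<sigma> by auto
qed

lemma continuous_proj_lim_to_kothe:
  fixes b :: "nat \<Rightarrow> 'i::countable \<Rightarrow> ennreal"
  assumes b: "lf_weights (\<lambda>_. b)" and I: "I \<noteq> {}" and h: "geom_summable h" and p: "0 < p"
    and dom: "\<And>m. \<exists>r\<in>I. strongly_dominated h (b m) (w r)"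
  shows "continuous_map (proj_lim I (\<lambda>r. wlp p (w r))) (kothe_top (LE (\<lambda>_. b)) (LP (\<lambda>_. b))) (\<lambda>x. x)"
proof -
  interpret lf_weights "\<lambda>_. b" by fact
  let ?X = "proj_lim I (\<lambda>r. wlp p (w r))"
  have ts: "topspace ?X = (\<Inter>r\<in>I. wlp_carrier p (w r))"
    by (simp add: topspace_proj_lim[OF I] topspace_wlp)
  have sub: "topspace ?X \<subseteq> LE (\<lambda>_. b)"
  proof
    fix c assume c: "c \<in> topspace ?X"
    have "wsum (b m) c < \<infinity>" for m
    proof -
      obtain r where r: "r \<in> I" "strongly_dominated h (b m) (w r)" using dom by blast
      obtain D where "wsum (b m) c \<le> ennreal D * wnorm p (w r) c" using wsum_le_wnorm[OF r(2) h p] by metis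
      moreover have "wnorm p (w r) c < \<infinity>" using c r(1) by (auto simp: ts wlp_carrier_def)
      ultimately show ?thesis by (auto simp: ennreal_mult_less_top intro: order_le_less_trans)
    qed
    then show "c \<in> LE (\<lambda>_. b)" by (auto simp: LE_def)
  qed
  show ?thesis
    unfolding continuous_map_def topspace_kothe
  proof (intro conjI allI impI)
    show "(\<lambda>x. x) \<in> topspace ?X \<rightarrow> LE (\<lambda>_. b)" using sub by auto
    fix U assume U: "openin (kothe_top (LE (\<lambda>_. b)) (LP (\<lambda>_. b))) U"
    show "openin ?X {x \<in> topspace ?X. x \<in> U}"
    proof (subst openin_subopen, intro ballI)
      fix c assume c: "c \<in> {x \<in> topspace ?X. x \<in> U}"
      then obtain v where v: "v \<in> LP (\<lambda>_. b)" "\<forall>d\<in>LE (\<lambda>_. b). wsum v (\<lambda>i. d i - c i) < 1 \<longrightarrow> d \<in> U"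
        using U unfolding openin_kothe kopen_def by blast
      obtain m C where m: "0 < C" "\<And>c. (\<And>k. wsum (b k) c < \<infinity>) \<Longrightarrow> wsum v c \<le> ennreal C * wsum (b m) c"
        using LP_wsum_le[OF v(1)] by metis
      obtain r where r: "r \<in> I" "strongly_dominated h (b m) (w r)" using dom by blast
      obtain D where D: "D > 0" "\<And>c. wsum (b m) c \<le> ennreal D * wnorm p (w r) c"
        using wsum_le_wnorm[OF r(2) h p] by metis
      \<comment> \<open>A ball of the l1-seminorm rather than of the quasinorm: the former obeys the
        triangle inequality, so it is open also when \<open>p < 1\<close>.\<close>
      let ?B = "{d \<in> wlp_carrier p (w r). wsum (b m) (\<lambda>i. d i - c i) < ennreal (1 / C)}"
      have "wlp_open p (w r) ?B"
        unfolding wlp_open_def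
      proof (intro conjI ballI)
        fix d assume d: "d \<in> ?B"
        then obtain s where s': "wsum (b m) (\<lambda>i. d i - c i) = ennreal s" "0 \<le> s"
          by (cases "wsum (b m) (\<lambda>i. d i - c i)") auto
        with d have s: "s < 1 / C" by (auto simp: ennreal_less_iff)
        \<comment> \<open>\<open>D\<close> is the price of passing from the quasinorm to the
          l1-seminorm with weight \<open>b m\<close>.\<close>
        define \<epsilon> where "\<epsilon> = (1 / C - s) / D"
        have \<epsilon>: "\<epsilon> > 0" using s D by (simp add: \<epsilon>_def)
        have "x \<in> ?B" if x: "x \<in> wlp_carrier p (w r)" "wnorm p (w r) (\<lambda>i. x i - d i) < ennreal \<epsilon>" for x
        proof -
          have "ennreal D * wnorm p (w r) (\<lambda>i. x i - d i) < ennreal D * ennreal \<epsilon>"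
            using x D by (intro ennreal_mult_strict_left_mono) auto
          also have "\<dots> = ennreal (1 / C - s)" using D \<epsilon> by (simp add: ennreal_mult[symmetric] \<epsilon>_def)
          finally have "wsum (b m) (\<lambda>i. x i - d i) < ennreal (1 / C - s)"
            using D(2) by (auto intro: order_le_less_trans)
          moreover have "wsum (b m) (\<lambda>i. x i - c i) \<le> ennreal s + wsum (b m) (\<lambda>i. x i - d i)"
            using wsum_add_le[of "b m" "\<lambda>i. d i - c i" "\<lambda>i. x i - d i"] s' by simp
          ultimately have "wsum (b m) (\<lambda>i. x i - c i) < ennreal s + ennreal (1 / C - s)"
            using ennreal_add_left_cancel_less[of "ennreal s"] by (auto intro: order_le_less_trans)
          then show ?thesis using s s' x by (simp add: ennreal_plus[symmetric] del: ennreal_plus)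
        qed
        then show "\<exists>\<epsilon>>0. \<forall>x\<in>wlp_carrier p (w r). wnorm p (w r) (\<lambda>i. x i - d i) < ennreal \<epsilon> \<longrightarrow> x \<in> ?B"
          using \<epsilon> by blast
      qed auto
      then have "openin ?X (?B \<inter> (\<Inter>j\<in>I. topspace (wlp p (w j))))"
        using r(1) by (intro openin_proj_lim) (auto simp: openin_wlp)
      moreover have "c \<in> ?B \<inter> (\<Inter>j\<in>I. topspace (wlp p (w j)))"
        using c r(1) m(1) by (auto simp: ts topspace_wlp)
      moreover have "?B \<inter> (\<Inter>j\<in>I. topspace (wlp p (w j))) \<subseteq> {x \<in> topspace ?X. x \<in> U}"
      proof
        fix d assume d: "d \<in> ?B \<inter> (\<Inter>j\<in>I. topspace (wlp p (w j)))"
        then have d1: "d \<in> topspace ?X" by (auto simp: ts topspace_wlp)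
        have "(\<lambda>i. d i - c i) \<in> LE (\<lambda>_. b)" using E_diff d1 c sub by blast
        then have "wsum v (\<lambda>i. d i - c i) \<le> ennreal C * wsum (b m) (\<lambda>i. d i - c i)"
          by (intro m) (auto simp: LE_def)
        also have "\<dots> < ennreal C * ennreal (1 / C)" using d m(1) by (intro ennreal_mult_strict_left_mono) auto
        also have "\<dots> = 1" using m(1) by (simp add: ennreal_mult[symmetric])
        finally show "d \<in> {x \<in> topspace ?X. x \<in> U}" using v(2) d1 sub by blast
      qed
      ultimately show "\<exists>T. openin ?X T \<and> c \<in> T \<and> T \<subseteq> {x \<in> topspace ?X. x \<in> U}" by blast
    qed
  qed
qed

lemma continuous_kothe_to_proj_lim:
  fixes b :: "nat \<Rightarrow> 'i::countable \<Rightarrow> ennreal"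
  assumes b: "lf_weights (\<lambda>_. b)" and I: "I \<noteq> {}" and h: "geom_summable h" and p: "0 < p"
    and dom: "\<And>r. r \<in> I \<Longrightarrow> \<exists>m. strongly_dominated h (w r) (b m)"
  shows "continuous_map (kothe_top (LE (\<lambda>_. b)) (LP (\<lambda>_. b))) (proj_lim I (\<lambda>r. wlp p (w r))) (\<lambda>x. x)"
proof -
  interpret lf_weights "\<lambda>_. b" by fact
  have sub: "c \<in> wlp_carrier p (w r)" if c: "c \<in> LE (\<lambda>_. b)" and r: "r \<in> I" for c r
  proof -
    obtain m where m: "strongly_dominated h (w r) (b m)" using dom r by blast
    obtain D where "wnorm p (w r) c \<le> ennreal D * wsum (b m) c" using wnorm_le_wsum[OF m h p] by metis
    moreover have "wsum (b m) c < \<infinity>" using c by (auto simp: LE_def)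
    ultimately show ?thesis by (auto simp: wlp_carrier_def ennreal_mult_less_top intro: order_le_less_trans)
  qed
  show ?thesis
    unfolding proj_lim_def
  proof (rule continuous_on_generated_topo)
    obtain i where i: "i \<in> I" using I by blast
    have "openin (wlp p (w i)) (wlp_carrier p (w i))" using openin_topspace[of "wlp p (w i)"] by (simp add: topspace_wlp)
    moreover have "LE (\<lambda>_. b) \<subseteq> wlp_carrier p (w i) \<inter> (\<Inter>j\<in>I. topspace (wlp p (w j)))"
      using sub i by (auto simp: topspace_wlp)
    ultimately show "(\<lambda>x. x) ` topspace (kothe_top (LE (\<lambda>_. b)) (LP (\<lambda>_. b))) \<subseteq>
        \<Union> {U \<inter> (\<Inter>j\<in>I. topspace (wlp p (w j))) |U i. i \<in> I \<and> openin (wlp p (w i)) U}"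
      using i unfolding topspace_kothe image_ident by blast
    fix V assume "V \<in> {U \<inter> (\<Inter>j\<in>I. topspace (wlp p (w j))) |U i. i \<in> I \<and> openin (wlp p (w i)) U}"
    then obtain U r where V: "V = U \<inter> (\<Inter>j\<in>I. topspace (wlp p (w j)))" and r: "r \<in> I"
      and U: "wlp_open p (w r) U" by (auto simp: openin_wlp)
    obtain m where m: "strongly_dominated h (w r) (b m)" using dom r by blast
    obtain D where D: "D > 0" "\<And>c. wnorm p (w r) c \<le> ennreal D * wsum (b m) c"
      using wnorm_le_wsum[OF m h p] by metis
    show "openin (kothe_top (LE (\<lambda>_. b)) (LP (\<lambda>_. b)))
       ((\<lambda>x. x) -` V \<inter> topspace (kothe_top (LE (\<lambda>_. b)) (LP (\<lambda>_. b))))"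
      unfolding topspace_kothe openin_kothe kopen_def
    proof (intro conjI ballI)
      fix c assume c: "c \<in> (\<lambda>x. x) -` V \<inter> LE (\<lambda>_. b)"
      then obtain \<epsilon> where \<epsilon>: "\<epsilon> > 0"
        "\<forall>d\<in>wlp_carrier p (w r). wnorm p (w r) (\<lambda>i. d i - c i) < ennreal \<epsilon> \<longrightarrow> d \<in> U"
        using U V unfolding wlp_open_def by blast
      \<comment> \<open>The factor \<open>D / \<epsilon>\<close> makes the l1-unit ball fit into the
        quasinorm ball of radius \<open>\<epsilon>\<close>.\<close>
      let ?v = "\<lambda>i. ennreal (D / \<epsilon>) * b m i"
      have "?v \<in> LP (\<lambda>_. b)"
        using D \<epsilon> unfolding LP_def by (auto intro!: exI[of _ m] exI[of _ "D / \<epsilon>"])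
      moreover have "d \<in> (\<lambda>x. x) -` V \<inter> LE (\<lambda>_. b)"
        if d: "d \<in> LE (\<lambda>_. b)" "wsum ?v (\<lambda>i. d i - c i) < 1" for d
      proof -
        have "wnorm p (w r) (\<lambda>i. d i - c i) \<le> ennreal \<epsilon> * (ennreal (D / \<epsilon>) * wsum (b m) (\<lambda>i. d i - c i))"
          using D(2)[of "\<lambda>i. d i - c i"] D(1) \<epsilon>(1) by (simp add: mult.assoc[symmetric] ennreal_mult[symmetric])
        also have "\<dots> < ennreal \<epsilon> * 1"
          using d(2) \<epsilon>(1) unfolding wsum_cmult by (intro ennreal_mult_strict_left_mono) auto
        finally have "d \<in> U" using \<epsilon>(2) sub[OF d(1) r] by simp
        then show ?thesis using d sub by (auto simp: V topspace_wlp)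
      qed
      ultimately show "\<exists>v\<in>LP (\<lambda>_. b). \<forall>d\<in>LE (\<lambda>_. b).
          wsum v (\<lambda>i. d i - c i) < 1 \<longrightarrow> d \<in> (\<lambda>x. x) -` V \<inter> LE (\<lambda>_. b)"
        by blast
    qed auto
  qed
qed

theorem proj_lim_wlp_eq_kothe:
  fixes b :: "nat \<Rightarrow> 'i::countable \<Rightarrow> ennreal"
  assumes "lf_weights (\<lambda>_. b)" "I \<noteq> {}" "geom_summable h" "0 < p"
    and "\<And>m. \<exists>r\<in>I. strongly_dominated h (b m) (w r)"
    and "\<And>r. r \<in> I \<Longrightarrow> \<exists>m. strongly_dominated h (w r) (b m)"
  shows "proj_lim I (\<lambda>r. wlp p (w r)) = kothe_top (LE (\<lambda>_. b)) (LP (\<lambda>_. b))"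
proof -
  have "X = Y" if "continuous_map X Y (\<lambda>x. x)" "continuous_map Y X (\<lambda>x. x)" for X Y :: "'b topology"
  proof -
    have ts: "topspace X = topspace Y"
      using that unfolding continuous_map_def by auto
    have "openin X U \<longleftrightarrow> openin Y U" for U
    proof -
      have "U \<subseteq> topspace X \<Longrightarrow> {x \<in> topspace X. x \<in> U} = U" by auto
      then show ?thesis using that ts unfolding continuous_map_def by (metis openin_subset)
    qed
    then show ?thesis by (simp add: topology_eq)
  qed
  then show ?thesis
    using continuous_proj_lim_to_kothe continuous_kothe_to_proj_lim assms by metis
qed

text \<open>Hypotheses \<open>1\<close> and \<open>2\<close> express cofinality of whole steps: the
  outer parameter is matched before the inner one is given, since an inclusion of steps has to be
  continuous for all their seminorms at once.\<close>

theorem ind_proj_wlp_eq_kothe: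
  fixes a :: "nat \<Rightarrow> nat \<Rightarrow> 'i::countable \<Rightarrow> ennreal"
  assumes a: "lf_weights a" and J: "J \<noteq> {}" and h: "geom_summable h" and p: "0 < p"
    and 1: "\<And>r. r \<in> I \<Longrightarrow> \<exists>n. \<forall>m. \<exists>r'\<in>J. strongly_dominated h (a n m) (w r r')"
    and 2: "\<And>n. \<exists>r\<in>I. \<forall>r'\<in>J. \<exists>m. strongly_dominated h (w r r') (a n m)"
  shows "ind_lim I (\<lambda>r. proj_lim J (\<lambda>r'. wlp p (w r r'))) = kothe_top (LE a) (LP a)"
proof -
  interpret lf_weights a by fact
  have step: "lf_weights (\<lambda>_. a n)" for n by (rule lf_weights_step)
  have "ind_lim I (\<lambda>r. proj_lim J (\<lambda>r'. wlp p (w r r'))) =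
      ind_lim UNIV (\<lambda>n. kothe_top (LE (\<lambda>_. a n)) (LP (\<lambda>_. a n)))"
  proof (rule ind_lim_eqI)
    fix r assume "r \<in> I"
    then obtain n where "\<forall>m. \<exists>r'\<in>J. strongly_dominated h (a n m) (w r r')" using 1 by blast
    then have "continuous_map (proj_lim J (\<lambda>r'. wlp p (w r r'))) (kothe_top (LE (\<lambda>_. a n)) (LP (\<lambda>_. a n))) (\<lambda>x. x)"
      by (intro continuous_proj_lim_to_kothe[OF step J h p]) auto
    then show "\<exists>n\<in>UNIV. continuous_map (proj_lim J (\<lambda>r'. wlp p (w r r')))
        (kothe_top (LE (\<lambda>_. a n)) (LP (\<lambda>_. a n))) (\<lambda>x. x)" by blast
    have "wnorm p v (\<lambda>i. 0) = 0" for v :: "'i \<Rightarrow> ennreal"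
      by (simp add: wnorm_def lp_norm_def epowr_def)
    then show "(\<lambda>i. 0) \<in> topspace (proj_lim J (\<lambda>r'. wlp p (w r r')))"
      by (simp add: topspace_proj_lim[OF J] topspace_wlp wlp_carrier_def)
  next
    fix n :: nat
    obtain r where r: "r \<in> I" "\<forall>r'\<in>J. \<exists>m. strongly_dominated h (w r r') (a n m)" using 2 by blast
    then have "continuous_map (kothe_top (LE (\<lambda>_. a n)) (LP (\<lambda>_. a n))) (proj_lim J (\<lambda>r'. wlp p (w r r'))) (\<lambda>x. x)"
      by (intro continuous_kothe_to_proj_lim[OF step J h p]) auto
    then show "\<exists>r\<in>I. continuous_map (kothe_top (LE (\<lambda>_. a n)) (LP (\<lambda>_. a n)))
        (proj_lim J (\<lambda>r'. wlp p (w r r'))) (\<lambda>x. x)" using r(1) by blast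
    interpret s: lf_weights "\<lambda>_. a n" by (rule step)
    show "(\<lambda>i. 0) \<in> topspace (kothe_top (LE (\<lambda>_. a n)) (LP (\<lambda>_. a n)))"
      using s.E_0 by simp
  qed
  also have "\<dots> = kothe_top (LE a) (LP a)" by (rule ind_lim_kothe)
  finally show ?thesis .
qed

section \<open>Kernel operators\<close>

lemma ennreal_less_half:
  fixes x :: ennreal
  assumes "ennreal 2 * x < 1" shows "x < ennreal (1/2)"
proof (cases x)
  case (real r)
  then have "ennreal (2 * r) < 1" using assms by (simp add: ennreal_mult del: ennreal_numeral)
  then have "r < 1/2" by simp
  then show ?thesis using real(1) by (simp only: real(2) ennreal_less_iff)
next
  case top
  then show ?thesis using assms by (simp add: ennreal_mult_top)
qed

text \<open>Split \<open>T x y - T x0 y0\<close> as \<open>T (x - x0) y0 + T x (y - y0)\<close>. The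
  first term involves only the fixed \<open>y0\<close>, which is \<open>e2\<close>; the second needs
  a bound uniform in \<open>x\<close>, which \<open>e1\<close> provides on \<open>A\<close>.\<close>

lemma continuous_map_bilinear:
  assumes X: "kothe E P" and Y: "kothe F Q" and Z: "kothe G R"
    and A: "A \<subseteq> E"
    and mem: "\<And>x y. x \<in> E \<Longrightarrow> y \<in> F \<Longrightarrow> T x y \<in> G"
    and diff1: "\<And>x x' y. x \<in> E \<Longrightarrow> x' \<in> E \<Longrightarrow> y \<in> F \<Longrightarrow> T (\<lambda>i. x i - x' i) y = (\<lambda>i. T x y i - T x' y i)"
    and diff2: "\<And>x y y'. x \<in> E \<Longrightarrow> y \<in> F \<Longrightarrow> y' \<in> F \<Longrightarrow> T x (\<lambda>i. y i - y' i) = (\<lambda>i. T x y i - T x y' i)"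
    and e1: "\<And>w. w \<in> R \<Longrightarrow> \<exists>v\<in>Q. \<forall>x\<in>A. \<forall>y\<in>F. wsum w (T x y) \<le> wsum v y"
    and e2: "\<And>w y. w \<in> R \<Longrightarrow> y \<in> F \<Longrightarrow> \<exists>v\<in>P. \<forall>x\<in>E. wsum w (T x y) \<le> wsum v x"
  shows "continuous_map (prod_topology (subtopology (kothe_top E P) A) (kothe_top F Q)) (kothe_top G R) (\<lambda>(x, y). T x y)"
proof -
  interpret X: kothe E P by fact
  interpret Y: kothe F Q by fact
  interpret Z: kothe G R by fact
  let ?XY = "prod_topology (subtopology (kothe_top E P) A) (kothe_top F Q)"
  have ts: "topspace ?XY = A \<times> F" using A by auto
  show ?thesis
    unfolding continuous_map_def Z.topspace_kothe ts
  proof (intro conjI allI impI)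
    show "(\<lambda>(x, y). T x y) \<in> A \<times> F \<rightarrow> G" using mem A by auto
    fix W assume W: "openin (kothe_top G R) W"
    show "openin ?XY {z \<in> A \<times> F. (case z of (x, y) \<Rightarrow> T x y) \<in> W}"
      unfolding openin_prod_topology_alt
    proof (intro allI impI)
      fix x0 y0 assume "(x0, y0) \<in> {z \<in> A \<times> F. (case z of (x, y) \<Rightarrow> T x y) \<in> W}"
      then have xy0: "x0 \<in> A" "x0 \<in> E" "y0 \<in> F" "T x0 y0 \<in> W" using A by auto
      then obtain w where w: "w \<in> R" "\<forall>b\<in>G. wsum w (\<lambda>i. b i - T x0 y0 i) < 1 \<longrightarrow> b \<in> W"
        using W unfolding Z.openin_kothe kopen_def by blast
      \<comment> \<open>Doubled weights make each of the two terms of the splitting smaller than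
        \<open>1/2\<close>.\<close>
      have w2: "(\<lambda>i. ennreal 2 * w i) \<in> R" using Z.P_scale[OF w(1), of 2] by simp
      obtain v where v: "v \<in> Q" "\<forall>x\<in>A. \<forall>y\<in>F. wsum (\<lambda>i. ennreal 2 * w i) (T x y) \<le> wsum v y"
        using e1[OF w2] by blast
      obtain u where u: "u \<in> P" "\<forall>x\<in>E. wsum (\<lambda>i. ennreal 2 * w i) (T x y0) \<le> wsum u x"
        using e2[OF w2 xy0(3)] by blast
      let ?U = "{x \<in> E. wsum u (\<lambda>i. x i - x0 i) < ennreal 1} \<inter> A"
      let ?V = "{y \<in> F. wsum v (\<lambda>i. y i - y0 i) < ennreal 1}"
      have "openin (subtopology (kothe_top E P) A) ?U"
        by (rule openin_subtopology_Int) (rule X.openin_ball[OF xy0(2) u(1)], simp)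
      moreover have "openin (kothe_top F Q) ?V"
        by (rule Y.openin_ball[OF xy0(3) v(1)]) simp
      moreover have "x0 \<in> ?U" "y0 \<in> ?V" using xy0 by auto
      moreover have "?U \<times> ?V \<subseteq> {z \<in> A \<times> F. (case z of (x, y) \<Rightarrow> T x y) \<in> W}"
      proof safe
        fix x y assume x: "x \<in> E" "wsum u (\<lambda>i. x i - x0 i) < ennreal 1" "x \<in> A"
          and y: "y \<in> F" "wsum v (\<lambda>i. y i - y0 i) < ennreal 1"
        let ?d1 = "T (\<lambda>i. x i - x0 i) y0" and ?d2 = "T x (\<lambda>i. y i - y0 i)"
        have "wsum (\<lambda>i. ennreal 2 * w i) ?d1 < 1"
          using u(2) X.E_diff[OF x(1) xy0(2)] x(2) by (auto intro: order_le_less_trans)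
        then have 1: "wsum w ?d1 < ennreal (1/2)" unfolding wsum_cmult by (rule ennreal_less_half)
        have "wsum (\<lambda>i. ennreal 2 * w i) ?d2 < 1"
          using v(2) x(3) Y.E_diff[OF y(1) xy0(3)] y(2) by (auto intro: order_le_less_trans)
        then have 2: "wsum w ?d2 < ennreal (1/2)" unfolding wsum_cmult by (rule ennreal_less_half)
        have "(\<lambda>i. T x y i - T x0 y0 i) = (\<lambda>i. ?d1 i + ?d2 i)"
          by (simp add: diff1[OF x(1) xy0(2,3)] diff2[OF x(1) y(1) xy0(3)])
        then have "wsum w (\<lambda>i. T x y i - T x0 y0 i) \<le> wsum w ?d1 + wsum w ?d2"
          by (simp only: wsum_add_le)
        also have "\<dots> < ennreal (1/2) + ennreal (1/2)" by (rule add_strict_mono[OF 1 2])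
        also have "\<dots> = ennreal (1/2 + 1/2)" by (rule ennreal_plus[symmetric]) auto
        finally have "wsum w (\<lambda>i. T x y i - T x0 y0 i) < 1" by simp
        then show "T x y \<in> W" using w(2) mem[OF x(1) y(1)] by blast
      qed
      ultimately show "\<exists>U V. openin (subtopology (kothe_top E P) A) U \<and> openin (kothe_top F Q) V \<and>
          x0 \<in> U \<and> y0 \<in> V \<and> U \<times> V \<subseteq> {z \<in> A \<times> F. (case z of (x, y) \<Rightarrow> T x y) \<in> W}"
        by blast
    qed
  qed
qed

text \<open>The double series is a Bochner integral and therefore \<open>0\<close> where it fails to
  converge absolutely. This default lets \<open>wsum_kop_le\<close> hold for arbitrary
  families.\<close>

definition kop :: "('d \<Rightarrow> 'i \<Rightarrow> 'g \<Rightarrow> real) \<Rightarrow> ('i \<Rightarrow> complex) \<Rightarrow> ('g \<Rightarrow> complex) \<Rightarrow> 'd \<Rightarrow> complex" where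
  "kop k a f \<delta> = (LINT x|count_space UNIV. of_real (k \<delta> (fst x) (snd x)) * a (fst x) * f (snd x))"

text \<open>For nonnegative entries this is the seminorm with weight \<open>w\<close> of the image
  of two unit vectors, that is the pull-back of \<open>w\<close> along the kernel.\<close>

definition kmass :: "('d \<Rightarrow> 'i \<Rightarrow> 'g \<Rightarrow> real) \<Rightarrow> ('d \<Rightarrow> ennreal) \<Rightarrow> 'i \<Rightarrow> 'g \<Rightarrow> ennreal" where
  "kmass k w i \<gamma> = (\<integral>\<^sup>+\<delta>. w \<delta> * ennreal (k \<delta> i \<gamma>) \<partial>count_space UNIV)"

lemma norm_integral_le_nn_integral:
  fixes f :: "'a \<Rightarrow> 'b::{banach, second_countable_topology}"
  shows "ennreal (norm (integral\<^sup>L M f)) \<le> (\<integral>\<^sup>+x. ennreal (norm (f x)) \<partial>M)"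
  by (cases "integrable M f") (auto simp: integral_norm_bound_ennreal not_integrable_integral_eq)

lemma wsum_wsum_eq:
  "wsum (\<lambda>\<gamma>. wsum (\<lambda>i. m i \<gamma>) a) f =
    (\<integral>\<^sup>+x. ennreal (norm (a (fst x))) * ennreal (norm (f (snd x))) * m (fst x) (snd x) \<partial>count_space UNIV)"
proof -
  have "wsum (\<lambda>\<gamma>. wsum (\<lambda>i. m i \<gamma>) a) f =
      (\<integral>\<^sup>+\<gamma>. \<integral>\<^sup>+i. ennreal (norm (a i)) * ennreal (norm (f \<gamma>)) * m i \<gamma> \<partial>count_space UNIV \<partial>count_space UNIV)"
    unfolding wsum_def
    by (intro nn_integral_cong) (subst nn_integral_cmult[symmetric], auto simp: ac_simps intro!: nn_integral_cong)
  also have "\<dots> = (\<integral>\<^sup>+x. ennreal (norm (a (fst x))) * ennreal (norm (f (snd x))) * m (fst x) (snd x) \<partial>count_space UNIV)"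
    using nn_integral_snd_count_space[of "\<lambda>x. ennreal (norm (a (fst x))) * ennreal (norm (f (snd x))) * m (fst x) (snd x)"]
    by simp
  finally show ?thesis .
qed

lemma wsum_wsum_swap:
  "wsum (\<lambda>\<gamma>. wsum (\<lambda>i. m i \<gamma>) a) f = wsum (\<lambda>i. wsum (\<lambda>\<gamma>. m i \<gamma>) f) a"
proof -
  let ?F = "\<lambda>x. ennreal (norm (a (fst x))) * ennreal (norm (f (snd x))) * m (fst x) (snd x)"
  have "wsum (\<lambda>i. wsum (\<lambda>\<gamma>. m i \<gamma>) f) a =
      (\<integral>\<^sup>+i. \<integral>\<^sup>+\<gamma>. ennreal (norm (a i)) * ennreal (norm (f \<gamma>)) * m i \<gamma> \<partial>count_space UNIV \<partial>count_space UNIV)"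
    unfolding wsum_def
    by (intro nn_integral_cong) (subst nn_integral_cmult[symmetric], auto simp: ac_simps intro!: nn_integral_cong)
  also have "\<dots> = (\<integral>\<^sup>+x. ?F x \<partial>count_space UNIV)"
    using nn_integral_fst_count_space[of ?F] by simp
  finally show ?thesis by (simp add: wsum_wsum_eq)
qed

lemma nn_integral_norm_kop:
  fixes a :: "'i \<Rightarrow> complex" and f :: "'g \<Rightarrow> complex"
  assumes "\<And>\<delta> i \<gamma>. 0 \<le> k \<delta> i \<gamma>"
  shows "(\<integral>\<^sup>+x. ennreal (norm (of_real (k \<delta> (fst x) (snd x)) * a (fst x) * f (snd x))) \<partial>count_space UNIV)
    = (\<integral>\<^sup>+x. ennreal (norm (a (fst x))) * ennreal (norm (f (snd x))) * ennreal (k \<delta> (fst x) (snd x)) \<partial>count_space UNIV)"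
  using assms by (intro nn_integral_cong) (simp add: norm_mult ennreal_mult[symmetric] ac_simps)

text \<open>Triangle inequality under the sum, then Tonelli. Questions of continuity thereby become
  bounds for \<open>kmass\<close>, in which neither \<open>a\<close> nor \<open>f\<close>
  occurs.\<close>

lemma wsum_kop_le:
  assumes k: "\<And>\<delta> i \<gamma>. 0 \<le> k \<delta> i \<gamma>"
  shows "wsum w (kop k a f) \<le> wsum (\<lambda>\<gamma>. wsum (\<lambda>i. kmass k w i \<gamma>) a) f"
proof -
  let ?F = "\<lambda>z. ennreal (norm (a (fst (snd z)))) * ennreal (norm (f (snd (snd z)))) *
    (w (fst z) * ennreal (k (fst z) (fst (snd z)) (snd (snd z))))"
  have "wsum w (kop k a f) \<le> (\<integral>\<^sup>+\<delta>. \<integral>\<^sup>+x. ?F (\<delta>, x) \<partial>count_space UNIV \<partial>count_space UNIV)"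
    unfolding wsum_def
  proof (rule nn_integral_mono)
    fix \<delta>
    have "ennreal (norm (kop k a f \<delta>)) \<le> (\<integral>\<^sup>+x. ennreal (norm (a (fst x))) * ennreal (norm (f (snd x))) * ennreal (k \<delta> (fst x) (snd x)) \<partial>count_space UNIV)"
      unfolding kop_def nn_integral_norm_kop[of k \<delta> a f, OF k, symmetric] by (rule norm_integral_le_nn_integral)
    then have "ennreal (norm (kop k a f \<delta>)) * w \<delta> \<le> (\<integral>\<^sup>+x. ennreal (norm (a (fst x))) * ennreal (norm (f (snd x))) * ennreal (k \<delta> (fst x) (snd x)) \<partial>count_space UNIV) * w \<delta>"
      by (rule mult_right_mono) simp
    also have "\<dots> = (\<integral>\<^sup>+x. ?F (\<delta>, x) \<partial>count_space UNIV)"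
      by (subst nn_integral_multc[symmetric]) (auto simp: ac_simps)
    finally show "ennreal (norm (kop k a f \<delta>)) * w \<delta> \<le> (\<integral>\<^sup>+x. ?F (\<delta>, x) \<partial>count_space UNIV)" .
  qed
  also have "\<dots> = (\<integral>\<^sup>+x. \<integral>\<^sup>+\<delta>. ?F (\<delta>, x) \<partial>count_space UNIV \<partial>count_space UNIV)"
    by (rule trans[OF nn_integral_fst_count_space[of ?F] nn_integral_snd_count_space[of ?F, symmetric]])
  also have "\<dots> = (\<integral>\<^sup>+x. ennreal (norm (a (fst x))) * ennreal (norm (f (snd x))) * kmass k w (fst x) (snd x) \<partial>count_space UNIV)"
    unfolding kmass_def by (intro nn_integral_cong) (subst nn_integral_cmult[symmetric], auto)
  also have "\<dots> = wsum (\<lambda>\<gamma>. wsum (\<lambda>i. kmass k w i \<gamma>) a) f"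
    by (rule wsum_wsum_eq[symmetric])
  finally show ?thesis .
qed

lemma kmass_point: "kmass k (\<lambda>j. if j = \<delta> then 1 else 0) i \<gamma> = ennreal (k \<delta> i \<gamma>)"
  unfolding kmass_def
  by (subst nn_integral_count_space_eq[of UNIV "{\<delta>}"]) (auto simp: nn_integral_count_space_finite)

text \<open>\<open>equi1\<close> and \<open>equi2\<close> reduce hypocontinuity to membership of a
  weight: the supremum over a bounded set of one variable must be a continuous weight in the other.
  Singletons are bounded, so separate continuity and convergence of the series are included.\<close>

locale kernel_operator = X: kothe E P + Y: kothe F Q + Z: kothe G R
  for E :: "('i::countable \<Rightarrow> complex) set" and P and F :: "('g::countable \<Rightarrow> complex) set" and Q
    and G :: "('d::countable \<Rightarrow> complex) set" and R +
  fixes k :: "'d \<Rightarrow> 'i \<Rightarrow> 'g \<Rightarrow> real"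
  assumes k_nonneg: "0 \<le> k \<delta> i \<gamma>"
    and equi1: "bounded_in (kothe_top E P) B \<Longrightarrow> w \<in> R \<Longrightarrow>
        (\<lambda>\<gamma>. SUP b\<in>B. wsum (\<lambda>i. kmass k w i \<gamma>) b) \<in> Q"
    and equi2: "bounded_in (kothe_top F Q) B' \<Longrightarrow> w \<in> R \<Longrightarrow>
        (\<lambda>i. SUP f\<in>B'. wsum (\<lambda>\<gamma>. kmass k w i \<gamma>) f) \<in> P"
    and kop_in: "a \<in> E \<Longrightarrow> f \<in> F \<Longrightarrow> kop k a f \<in> G"
    and point_in: "(\<lambda>j. if j = \<delta> then 1 else 0) \<in> R"
    and fin_E: "fin_families \<subseteq> E" and fin_F: "fin_families \<subseteq> F"
begin

lemma bound1:
  assumes "bounded_in (kothe_top E P) B" "w \<in> R"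
  shows "\<exists>v\<in>Q. \<forall>a\<in>B. \<forall>f\<in>F. wsum w (kop k a f) \<le> wsum v f"
proof (rule bexI[OF _ equi1[OF assms]], intro ballI)
  fix a f assume "a \<in> B"
  have "wsum w (kop k a f) \<le> wsum (\<lambda>\<gamma>. wsum (\<lambda>i. kmass k w i \<gamma>) a) f"
    by (rule wsum_kop_le[OF k_nonneg])
  also have "\<dots> \<le> wsum (\<lambda>\<gamma>. SUP b\<in>B. wsum (\<lambda>i. kmass k w i \<gamma>) b) f"
    by (rule wsum_mono) (auto intro: SUP_upper \<open>a \<in> B\<close>)
  finally show "wsum w (kop k a f) \<le> wsum (\<lambda>\<gamma>. SUP b\<in>B. wsum (\<lambda>i. kmass k w i \<gamma>) b) f" .
qed

lemma bound2:
  assumes "bounded_in (kothe_top F Q) B" "w \<in> R"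
  shows "\<exists>v\<in>P. \<forall>f\<in>B. \<forall>a\<in>E. wsum w (kop k a f) \<le> wsum v a"
proof (rule bexI[OF _ equi2[OF assms]], intro ballI)
  fix a f assume "f \<in> B"
  have "wsum w (kop k a f) \<le> wsum (\<lambda>\<gamma>. wsum (\<lambda>i. kmass k w i \<gamma>) a) f"
    by (rule wsum_kop_le[OF k_nonneg])
  also have "\<dots> = wsum (\<lambda>i. wsum (\<lambda>\<gamma>. kmass k w i \<gamma>) f) a" by (rule wsum_wsum_swap)
  also have "\<dots> \<le> wsum (\<lambda>i. SUP f\<in>B. wsum (\<lambda>\<gamma>. kmass k w i \<gamma>) f) a"
    by (rule wsum_mono) (auto intro: SUP_upper \<open>f \<in> B\<close>)
  finally show "wsum w (kop k a f) \<le> wsum (\<lambda>i. SUP f\<in>B. wsum (\<lambda>\<gamma>. kmass k w i \<gamma>) f) a" .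
qed

text \<open>\<open>equi1\<close> for the singleton of \<open>a\<close> and the point weight at
  \<open>\<delta>\<close> yields a weight in \<open>Q\<close> whose finite value at \<open>f\<close>
  is the sum of the absolute values.\<close>

lemma kop_integrable:
  assumes a: "a \<in> E" and f: "f \<in> F"
  shows "integrable (count_space UNIV) (\<lambda>x. of_real (k \<delta> (fst x) (snd x)) * a (fst x) * f (snd x))"
proof (rule integrableI_bounded)
  let ?w = "\<lambda>j. if j = \<delta> then 1 else 0 :: ennreal"
  have "(\<lambda>\<gamma>. SUP b\<in>{a}. wsum (\<lambda>i. kmass k ?w i \<gamma>) b) \<in> Q"
    by (rule equi1[OF X.bounded_in_singleton[OF a] point_in])
  then have "wsum (\<lambda>\<gamma>. wsum (\<lambda>i. kmass k ?w i \<gamma>) a) f < \<infinity>"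
    using Y.wsum_finite[OF f] by simp
  then show "(\<integral>\<^sup>+x. ennreal (norm (of_real (k \<delta> (fst x) (snd x)) * a (fst x) * f (snd x))) \<partial>count_space UNIV) < \<infinity>"
    unfolding nn_integral_norm_kop[of k \<delta> a f, OF k_nonneg] kmass_point wsum_wsum_eq .
qed simp

lemma kop_diff1:
  assumes "a \<in> E" "a' \<in> E" "f \<in> F"
  shows "kop k (\<lambda>i. a i - a' i) f = (\<lambda>\<delta>. kop k a f \<delta> - kop k a' f \<delta>)"
proof
  fix \<delta>
  let ?g = "\<lambda>a f x. complex_of_real (k \<delta> (fst x) (snd x)) * a (fst x) * f (snd x)"
  have "integral\<^sup>L (count_space UNIV) (?g (\<lambda>i. a i - a' i) f) = (LINT x|count_space UNIV. ?g a f x - ?g a' f x)"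
    by (rule Bochner_Integration.integral_cong) (auto simp: algebra_simps)
  also have "\<dots> = integral\<^sup>L (count_space UNIV) (?g a f) - integral\<^sup>L (count_space UNIV) (?g a' f)"
    by (rule Bochner_Integration.integral_diff) (rule kop_integrable; fact)+
  finally show "kop k (\<lambda>i. a i - a' i) f \<delta> = kop k a f \<delta> - kop k a' f \<delta>"
    by (simp only: kop_def)
qed

lemma kop_diff2:
  assumes "a \<in> E" "f \<in> F" "f' \<in> F"
  shows "kop k a (\<lambda>i. f i - f' i) = (\<lambda>\<delta>. kop k a f \<delta> - kop k a f' \<delta>)"
proof
  fix \<delta>
  let ?g = "\<lambda>a f x. complex_of_real (k \<delta> (fst x) (snd x)) * a (fst x) * f (snd x)"
  have "integral\<^sup>L (count_space UNIV) (?g a (\<lambda>i. f i - f' i)) = (LINT x|count_space UNIV. ?g a f x - ?g a f' x)"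
    by (rule Bochner_Integration.integral_cong) (auto simp: algebra_simps)
  also have "\<dots> = integral\<^sup>L (count_space UNIV) (?g a f) - integral\<^sup>L (count_space UNIV) (?g a f')"
    by (rule Bochner_Integration.integral_diff) (rule kop_integrable; fact)+
  finally show "kop k a (\<lambda>i. f i - f' i) \<delta> = kop k a f \<delta> - kop k a f' \<delta>"
    by (simp only: kop_def)
qed

lemma hypocontinuous_kop:
  "hypocontinuous (kothe_top E P) (kothe_top F Q) (kothe_top G R) (\<lambda>(a, f). kop k a f)"
  unfolding hypocontinuous_def
proof (intro conjI allI impI)
  fix B assume B: "bounded_in (kothe_top E P) B"
  show "continuous_map (prod_topology (subtopology (kothe_top E P) B) (kothe_top F Q)) (kothe_top G R) (\<lambda>(a, f). kop k a f)"
  proof (rule continuous_map_bilinear[OF X.kothe_axioms Y.kothe_axioms Z.kothe_axioms])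
    show "B \<subseteq> E" using B by (simp add: bounded_in_def)
    fix w y assume "w \<in> R" "y \<in> F"
    then show "\<exists>v\<in>P. \<forall>x\<in>E. wsum w (kop k x y) \<le> wsum v x"
      using bound2[OF Y.bounded_in_singleton, of y w] by simp
  qed (use kop_in kop_diff1 kop_diff2 bound1[OF B] in auto)
next
  fix B assume B: "bounded_in (kothe_top F Q) B"
  \<comment> \<open>\<open>continuous_map_bilinear\<close> restricts its first variable; the second
    half of hypocontinuity is obtained for the flipped map and then composed with the swap.\<close>
  have "continuous_map (prod_topology (subtopology (kothe_top F Q) B) (kothe_top E P)) (kothe_top G R) (\<lambda>(f, a). kop k a f)"
  proof (rule continuous_map_bilinear[OF Y.kothe_axioms X.kothe_axioms Z.kothe_axioms])
    show "B \<subseteq> F" using B by (simp add: bounded_in_def)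
    fix w x assume "w \<in> R" "x \<in> E"
    then show "\<exists>v\<in>Q. \<forall>y\<in>F. wsum w (kop k x y) \<le> wsum v y"
      using bound1[OF X.bounded_in_singleton, of x w] by simp
  qed (use kop_in kop_diff1 kop_diff2 bound2[OF B] in auto)
  moreover have "continuous_map (prod_topology (kothe_top E P) (subtopology (kothe_top F Q) B))
      (prod_topology (subtopology (kothe_top F Q) B) (kothe_top E P)) (\<lambda>(a, f). (f, a))"
    using homeomorphic_map_swap homeomorphic_imp_continuous_map by blast
  ultimately have "continuous_map (prod_topology (kothe_top E P) (subtopology (kothe_top F Q) B)) (kothe_top G R)
      ((\<lambda>(f, a). kop k a f) \<circ> (\<lambda>(a, f). (f, a)))"
    by (rule continuous_map_compose[rotated])
  then show "continuous_map (prod_topology (kothe_top E P) (subtopology (kothe_top F Q) B)) (kothe_top G R) (\<lambda>(a, f). kop k a f)"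
    by (simp add: comp_def case_prod_unfold)
qed

text \<open>A singleton is bounded, so hypocontinuity restricted to it is continuity in the other
  variable.\<close>

lemma separately_continuous_kop:
  "f \<in> F \<Longrightarrow> continuous_map (kothe_top E P) (kothe_top G R) (\<lambda>a. kop k a f)"
  "a \<in> E \<Longrightarrow> continuous_map (kothe_top F Q) (kothe_top G R) (\<lambda>f. kop k a f)"
proof -
  assume f: "f \<in> F"
  have "continuous_map (prod_topology (kothe_top E P) (subtopology (kothe_top F Q) {f})) (kothe_top G R) (\<lambda>(a, f). kop k a f)"
    using hypocontinuous_kop Y.bounded_in_singleton[OF f] unfolding hypocontinuous_def by blast
  moreover have "continuous_map (kothe_top E P) (prod_topology (kothe_top E P) (subtopology (kothe_top F Q) {f})) (\<lambda>a. (a, f))"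
    using f by (simp add: continuous_map_paired continuous_map_in_subtopology)
  ultimately show "continuous_map (kothe_top E P) (kothe_top G R) (\<lambda>a. kop k a f)"
    by (rule continuous_map_compose[unfolded comp_def, rotated, THEN continuous_map_eq]) simp
next
  assume a: "a \<in> E"
  have "continuous_map (prod_topology (subtopology (kothe_top E P) {a}) (kothe_top F Q)) (kothe_top G R) (\<lambda>(a, f). kop k a f)"
    using hypocontinuous_kop X.bounded_in_singleton[OF a] unfolding hypocontinuous_def by blast
  moreover have "continuous_map (kothe_top F Q) (prod_topology (subtopology (kothe_top E P) {a}) (kothe_top F Q)) (\<lambda>f. (a, f))"
    using a by (simp add: continuous_map_paired continuous_map_in_subtopology)
  ultimately show "continuous_map (kothe_top F Q) (kothe_top G R) (\<lambda>f. kop k a f)"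
    by (rule continuous_map_compose[unfolded comp_def, rotated, THEN continuous_map_eq]) simp
qed

theorem uniquely_extendable_kop:
  assumes T0: "\<And>a f. a \<in> fin_families \<Longrightarrow> f \<in> fin_families \<Longrightarrow> T0 (a, f) = kop k a f"
  shows "uniquely_extendable (fin_families \<times> fin_families) T0 (kothe_top E P) (kothe_top F Q) (kothe_top G R)"
  unfolding uniquely_extendable_def
proof (intro conjI exI[of _ "\<lambda>(a, f). kop k a f"] allI impI ballI hypocontinuous_kop)
  show "fin_families \<times> fin_families \<subseteq> topspace (kothe_top E P) \<times> topspace (kothe_top F Q)"
    using fin_E fin_F by auto
  show "extends_on (fin_families \<times> fin_families) T0 (\<lambda>(a, f). kop k a f)"
    unfolding extends_on_def using T0 by auto
  fix T' x
  assume T': "separately_continuous (kothe_top E P) (kothe_top F Q) (kothe_top G R) T' \<and>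
      extends_on (fin_families \<times> fin_families) T0 T'"
    and "x \<in> topspace (kothe_top E P) \<times> topspace (kothe_top F Q)"
  then obtain a f where x: "x = (a, f)" "a \<in> E" "f \<in> F" by auto
  have H: "Hausdorff_space (kothe_top G R)" by (rule Z.Hausdorff_kothe[OF point_in])
  \<comment> \<open>A competitor is only separately continuous, so density is used twice: in
    \<open>f\<close> while the symbol is finite, then in the symbol for arbitrary
    \<open>f\<close>.\<close>
  have 1: "T' (b, f) = kop k b f" if b: "b \<in> fin_families" for b
  proof (rule forall_in_closure_of_eq[OF Y.closure_fin_families[OF x(3)] H])
    show "continuous_map (kothe_top F Q) (kothe_top G R) (\<lambda>f. T' (b, f))"
      using T' b fin_E unfolding separately_continuous_def by auto
    show "continuous_map (kothe_top F Q) (kothe_top G R) (\<lambda>f. kop k b f)"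
      using separately_continuous_kop(2) b fin_E by blast
    show "T' (b, g) = kop k b g" if "g \<in> fin_families" for g
      using T' T0 b that unfolding extends_on_def by auto
  qed
  have "T' (a, f) = kop k a f"
  proof (rule forall_in_closure_of_eq[OF X.closure_fin_families[OF x(2)] H])
    show "continuous_map (kothe_top E P) (kothe_top G R) (\<lambda>a. T' (a, f))"
      using T' x unfolding separately_continuous_def by auto
    show "continuous_map (kothe_top E P) (kothe_top G R) (\<lambda>a. kop k a f)"
      using separately_continuous_kop(1) x by blast
  qed (rule 1)
  then show "T' x = (case x of (a, f) \<Rightarrow> kop k a f)" using x by simp
qed

end

lemma (in kothe) fin_families_subset:
  assumes "\<And>j. (\<lambda>i. if i = j then 1 else 0) \<in> E"
  shows "fin_families \<subseteq> E"
proof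
  fix c :: "'i \<Rightarrow> complex" assume "c \<in> fin_families"
  then have "finite {i. c i \<noteq> 0}" by (simp add: fin_families_def)
  moreover have "(\<lambda>i. if i \<in> S then c i else 0) \<in> E" if "finite S" for S
    using that
  proof (induction S rule: finite_induct)
    case empty
    then show ?case using E_0 by simp
  next
    case (insert j S)
    have "(\<lambda>i. (if i \<in> S then c i else 0) + c j * (if i = j then 1 else 0)) \<in> E"
      by (intro E_add insert E_scale assms)
    moreover have "(\<lambda>i. (if i \<in> S then c i else 0) + c j * (if i = j then 1 else 0)) =
        (\<lambda>i. if i \<in> insert j S then c i else 0)" using insert by auto
    ultimately show ?case by simp
  qed
  ultimately have "(\<lambda>i. if i \<in> {i. c i \<noteq> 0} then c i else 0) \<in> E" by blast
  moreover have "(\<lambda>i. if i \<in> {i. c i \<noteq> 0} then c i else 0) = c" by auto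
  ultimately show "c \<in> E" by simp
qed

section \<open>Toeplitz kernels on weighted spaces\<close>

lemma ennreal_inverse_antimono: "(b::ennreal) \<le> c \<Longrightarrow> inverse c \<le> inverse b"
  unfolding less_eq_ennreal.rep_eq inverse_ennreal.rep_eq by (rule ereal_inverse_antimono) auto

lemma ennreal_divide_finite: "a < top \<Longrightarrow> 0 < b \<Longrightarrow> a / b < (top::ennreal)"
  by (cases a; cases b) (auto simp: divide_ennreal)

lemma ennreal_divide_mono: "a \<le> a' \<Longrightarrow> b' \<le> (b::ennreal) \<Longrightarrow> a / b \<le> a' / b'"
  unfolding divide_ennreal_def by (intro mult_mono ennreal_inverse_antimono) auto

text \<open>If no \<open>n\<close> works, choose for each \<open>n\<close> an index
  \<open>g n\<close> and a height \<open>t n\<close> below \<open>\<theta> n\<close> there such that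
  \<open>M\<close> times this height exceeds \<open>n\<close>. The family \<open>y\<close> of these
  humps is dominated by every \<open>\<theta> k\<close>: humps with \<open>n \<ge> k\<close> lie
  below \<open>\<theta> k\<close> by monotonicity, and the finitely many others cost a constant. But
  \<open>M * y\<close> is unbounded.\<close>

lemma bounded_of_dual_bounded:
  fixes \<theta> :: "nat \<Rightarrow> 'g \<Rightarrow> ennreal" and M :: "'g \<Rightarrow> ennreal"
  assumes anti: "\<And>n m \<gamma>. n \<le> m \<Longrightarrow> \<theta> m \<gamma> \<le> \<theta> n \<gamma>"
    and pos: "\<And>n \<gamma>. 0 < \<theta> n \<gamma>"
    and bd: "\<And>y. (\<And>n. \<exists>C>0. \<forall>\<gamma>. y \<gamma> \<le> ennreal C * \<theta> n \<gamma>) \<Longrightarrow> \<exists>C::real. \<forall>\<gamma>. M \<gamma> * y \<gamma> \<le> ennreal C"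
  shows "\<exists>n. \<exists>C>0. \<forall>\<gamma>. M \<gamma> * \<theta> n \<gamma> \<le> ennreal C"
proof (rule ccontr)
  assume neg: "\<not> ?thesis"
  \<comment> \<open>The height is a finite number even where \<open>\<theta> n\<close> or
    \<open>M\<close> is infinite; otherwise the hump could not be dominated by a finite
    \<open>\<theta> k\<close>.\<close>
  have "\<exists>\<gamma> t. 0 \<le> t \<and> ennreal t \<le> \<theta> n \<gamma> \<and> ennreal (real n) < M \<gamma> * ennreal t" for n
  proof -
    have "\<not> (\<forall>\<gamma>. M \<gamma> * \<theta> n \<gamma> \<le> ennreal (real n + 1))"
      using neg by (metis add_nonneg_pos of_nat_0_le_iff zero_less_one)
    then obtain \<gamma> where g: "ennreal (real n + 1) < M \<gamma> * \<theta> n \<gamma>" by (auto simp: not_le)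
    have "ennreal (real n) < ennreal (real n + 1)" by (simp add: ennreal_less_iff)
    with g have g': "ennreal (real n) < M \<gamma> * \<theta> n \<gamma>" by (rule less_trans[rotated])
    show ?thesis
    proof (cases "\<theta> n \<gamma>")
      case (real t)
      then show ?thesis using g' by (intro exI[of _ \<gamma>] exI[of _ t]) auto
    next
      case top
      show ?thesis
      proof (cases "M \<gamma>")
        case (real m)
        then have "m > 0" using g' by (cases "m = 0") auto
        then show ?thesis using real top
          by (intro exI[of _ \<gamma>] exI[of _ "(real n + 1) / m"])
             (auto simp: ennreal_mult[symmetric] ennreal_less_iff)
      next
        case top
        then show ?thesis using \<open>\<theta> n \<gamma> = top\<close>
          by (intro exI[of _ \<gamma>] exI[of _ 1]) (auto simp: ennreal_less_top)
      qed
    qed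
  qed
  then obtain g t where gt: "\<And>n. 0 \<le> t n" "\<And>n. ennreal (t n) \<le> \<theta> n (g n)"
      "\<And>n. ennreal (real n) < M (g n) * ennreal (t n)"
    by metis
  \<comment> \<open>Several \<open>n\<close> may select the same index, hence the supremum; at
    indices never selected it is \<open>0\<close>.\<close>
  define y where "y \<gamma> = (SUP n\<in>{n. g n = \<gamma>}. ennreal (t n))" for \<gamma>
  have "\<exists>C>0. \<forall>\<gamma>. y \<gamma> \<le> ennreal C * \<theta> k \<gamma>" for k
  proof -
    have "\<exists>c. 0 \<le> c \<and> ennreal (t n) \<le> ennreal c * \<theta> k (g n)" for n
    proof (cases "\<theta> k (g n)")
      case (real r)
      then have "r > 0" using pos[of k "g n"] by simp
      then show ?thesis using real gt(1)[of n]
        by (intro exI[of _ "t n / r"]) (auto simp: ennreal_mult[symmetric])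
    next
      case top
      then show ?thesis by (intro exI[of _ 1]) auto
    qed
    then obtain c where c: "\<And>n. 0 \<le> c n" "\<And>n. ennreal (t n) \<le> ennreal (c n) * \<theta> k (g n)"
      by metis
    define C where "C = 1 + (\<Sum>n<k. c n)"
    have C: "1 \<le> C" using c(1) by (simp add: C_def sum_nonneg)
    have "ennreal (t n) \<le> ennreal C * \<theta> k (g n)" for n
    proof (cases "k \<le> n")
      case True
      have "ennreal (t n) \<le> 1 * \<theta> k (g n)" using gt(2)[of n] anti[OF True, of "g n"] by simp
      also have "\<dots> \<le> ennreal C * \<theta> k (g n)" using ennreal_leI[OF C] by (intro mult_right_mono) auto
      finally show ?thesis .
    next
      case False
      then have "c n \<le> (\<Sum>n<k. c n)" using c(1) by (intro member_le_sum) auto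
      then have "c n \<le> C" by (simp add: C_def)
      then have "ennreal (c n) * \<theta> k (g n) \<le> ennreal C * \<theta> k (g n)" by (intro mult_right_mono ennreal_leI) auto
      then show ?thesis using c(2)[of n] by (rule order_trans[rotated])
    qed
    then have "\<forall>\<gamma>. y \<gamma> \<le> ennreal C * \<theta> k \<gamma>" unfolding y_def by (auto intro!: SUP_least)
    then show ?thesis using C by (intro exI[of _ C]) auto
  qed
  then obtain C :: real where C: "\<And>\<gamma>. M \<gamma> * y \<gamma> \<le> ennreal C" using bd[of y] by blast
  obtain n :: nat where n: "C < real n" using reals_Archimedean2 by blast
  have "ennreal (real n) < M (g n) * ennreal (t n)" by (rule gt(3))
  also have "\<dots> \<le> M (g n) * y (g n)" unfolding y_def by (intro mult_left_mono SUP_upper) auto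
  also have "\<dots> \<le> ennreal C" by (rule C)
  finally have "real n < C" by (simp add: ennreal_less_iff)
  then show False using n by simp
qed

text \<open>With \<open>i = (\<alpha>, \<beta>)\<close> this is the entry from
  \<open>\<gamma>\<close> to \<open>\<delta>\<close> for the symbol
  \<open>e_mono \<alpha> z * e_mono \<beta> (cnj w)\<close>, see \<open>moment_integral\<close>: a
  normalised complex Gaussian moment of z^(\<alpha> + \<gamma>) (cnj z)^(\<beta> + \<delta>), which
  vanishes unless the exponents agree.\<close>

definition toep :: "('n::finite) mindex \<Rightarrow> 'n mindex \<times> 'n mindex \<Rightarrow> 'n mindex \<Rightarrow> real" where
  "toep \<delta> i \<gamma> = (if \<forall>j. fst i j + \<gamma> j = snd i j + \<delta> j
     then mfact (\<lambda>j. fst i j + \<gamma> j) / sqrt (mfact (fst i) * mfact (snd i) * mfact \<gamma> * mfact \<delta>) else 0)"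

lemma mfact_pos: "0 < mfact \<alpha>"
  unfolding mfact_def by (rule prod_pos) simp

lemma toep_nonneg: "0 \<le> toep \<delta> i \<gamma>"
  by (auto simp: toep_def intro!: divide_nonneg_nonneg real_sqrt_ge_zero mult_nonneg_nonneg less_imp_le[OF mfact_pos])

lemma mlen_add: "mlen (\<lambda>j. \<alpha> j + \<gamma> j) = mlen \<alpha> + mlen \<gamma>"
  by (simp add: mlen_def sum.distrib)

lemma mfact_add_le: "mfact (\<lambda>j. \<alpha> j + \<gamma> j) \<le> 2 ^ (mlen \<alpha> + mlen \<gamma>) * (mfact \<alpha> * mfact \<gamma>)"
proof -
  have "fact (a + c) \<le> (2 ^ (a + c) * (fact a * fact c) :: real)" for a c :: nat
  proof -
    have "fact (a + c) = (fact a * fact c) * real ((a + c) choose a)"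
      by (simp add: binomial_fact)
    also have "\<dots> \<le> (fact a * fact c) * 2 ^ (a + c)"
      using binomial_le_pow2[of "a + c" a]
      by (intro mult_left_mono) (metis of_nat_le_iff of_nat_numeral of_nat_power, simp)
    finally show ?thesis by (simp add: ac_simps)
  qed
  then have "mfact (\<lambda>j. \<alpha> j + \<gamma> j) \<le> (\<Prod>j\<in>UNIV. 2 ^ (\<alpha> j + \<gamma> j) * (fact (\<alpha> j) * fact (\<gamma> j)))"
    unfolding mfact_def by (intro prod_mono) auto
  also have "\<dots> = 2 ^ (mlen \<alpha> + mlen \<gamma>) * (mfact \<alpha> * mfact \<gamma>)"
    by (simp add: prod.distrib mfact_def mlen_def power_sum[symmetric] sum.distrib power_add)
  finally show ?thesis .
qed

lemma mfact_mult_le: "mfact \<alpha> * mfact \<gamma> \<le> mfact (\<lambda>j. \<alpha> j + \<gamma> j)"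
  unfolding mfact_def prod.distrib[symmetric]
proof (rule prod_mono)
  fix j
  have "fact (\<alpha> j) * fact (\<gamma> j) \<le> (fact (\<alpha> j + \<gamma> j) :: nat)"
    using fact_fact_dvd_fact[of "\<alpha> j" "\<gamma> j"] by (rule dvd_imp_le) simp
  then have "real (fact (\<alpha> j) * fact (\<gamma> j)) \<le> real (fact (\<alpha> j + \<gamma> j))" by (rule of_nat_mono)
  then show "0 \<le> (fact (\<alpha> j) * fact (\<gamma> j) :: real) \<and> fact (\<alpha> j) * fact (\<gamma> j) \<le> (fact (\<alpha> j + \<gamma> j) :: real)"
    by (auto intro!: mult_nonneg_nonneg)
qed

text \<open>Since \<open>\<alpha> + \<gamma>\<close> equals \<open>\<beta> + \<delta>\<close>, the
  factorial in the numerator can be estimated through either pair. The product of the two estimates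
  contains all four factorials of the denominator, and its square root retains the binomial loss
  \<open>2 ^ (mlen \<alpha> + mlen \<gamma>)\<close> once.\<close>

lemma toep_le: "toep \<delta> (\<alpha>, \<beta>) \<gamma> \<le> 2 ^ (mlen \<alpha> + mlen \<gamma>)"
proof (cases "\<forall>j. \<alpha> j + \<gamma> j = \<beta> j + \<delta> j")
  case True
  let ?N = "mfact (\<lambda>j. \<alpha> j + \<gamma> j)" and ?e = "2 ^ (mlen \<alpha> + mlen \<gamma>) :: real"
  let ?P = "mfact \<alpha> * mfact \<beta> * mfact \<gamma> * mfact \<delta>"
  have eq: "(\<lambda>j. \<alpha> j + \<gamma> j) = (\<lambda>j. \<beta> j + \<delta> j)" using True by auto
  have len: "mlen \<alpha> + mlen \<gamma> = mlen \<beta> + mlen \<delta>" using eq by (simp only: mlen_add[symmetric])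
  have P: "0 < ?P" by (intro mult_pos_pos mfact_pos)
  have "?N * ?N \<le> (?e * (mfact \<alpha> * mfact \<gamma>)) * (?e * (mfact \<beta> * mfact \<delta>))"
    using mfact_add_le[of \<alpha> \<gamma>] mfact_add_le[of \<beta> \<delta>] eq len less_imp_le[OF mfact_pos]
    by (intro mult_mono mult_nonneg_nonneg) auto
  also have "\<dots> = (?e * sqrt ?P) * (?e * sqrt ?P)" using P by (simp add: algebra_simps)
  finally have "?N\<^sup>2 \<le> (?e * sqrt ?P)\<^sup>2" by (simp only: power2_eq_square)
  then have "?N \<le> ?e * sqrt ?P" by (rule power2_le_imp_le) (use P in simp)
  then have "?N / sqrt ?P \<le> ?e" using P by (simp add: divide_le_eq)
  then show ?thesis using True by (simp add: toep_def)
next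
  case False
  then have "toep \<delta> (\<alpha>, \<beta>) \<gamma> = 0" unfolding toep_def fst_conv snd_conv by (rule if_not_P)
  then show ?thesis by simp
qed

lemma kmass_toep_le:
  assumes "\<And>\<delta>. (\<And>j. \<alpha> j + \<gamma> j = \<beta> j + \<delta> j) \<Longrightarrow> ennreal (2 ^ (mlen \<alpha> + mlen \<gamma>)) * w \<delta> \<le> M"
  shows "kmass toep w (\<alpha>, \<beta>) \<gamma> \<le> M"
proof -
  \<comment> \<open>Subtraction is truncated. If \<open>\<beta>\<close> exceeds
    \<open>\<alpha> + \<gamma>\<close> in some coordinate, the kernel vanishes also at this index,
    which is the second case below.\<close>
  let ?d = "\<lambda>j. \<alpha> j + \<gamma> j - \<beta> j"
  have z: "toep \<delta> (\<alpha>, \<beta>) \<gamma> = 0" if "\<delta> \<noteq> ?d" for \<delta>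
    using that by (auto simp: toep_def fun_eq_iff)
  have "kmass toep w (\<alpha>, \<beta>) \<gamma> = w ?d * ennreal (toep ?d (\<alpha>, \<beta>) \<gamma>)"
    unfolding kmass_def
    by (subst nn_integral_count_space_eq[of UNIV "{?d}"]) (auto simp: z nn_integral_count_space_finite)
  also have "\<dots> \<le> M"
  proof (cases "\<forall>j. \<alpha> j + \<gamma> j = \<beta> j + ?d j")
    case True
    have "w ?d * ennreal (toep ?d (\<alpha>, \<beta>) \<gamma>) \<le> ennreal (2 ^ (mlen \<alpha> + mlen \<gamma>)) * w ?d"
      by (subst mult.commute) (intro mult_right_mono ennreal_leI toep_le, simp)
    also have "\<dots> \<le> M" using assms[of ?d] True by blast
    finally show ?thesis .
  next
    case False
    then have "toep ?d (\<alpha>, \<beta>) \<gamma> = 0" unfolding toep_def fst_conv snd_conv by (rule if_not_P)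
    then show ?thesis by simp
  qed
  finally show ?thesis .
qed

text \<open>\<open>ev_finite\<close> accommodates the infinite values for \<open>s = 0\<close> and
  puts unit vectors into the limit. \<open>strongly\<close> is a nuclearity condition that makes
  pointwise bounds summable. \<open>convolution\<close> alone refers to the kernel, through its
  bound and its support.\<close>

locale weight_system =
  fixes \<theta> :: "nat \<Rightarrow> ('n::finite) mindex \<Rightarrow> ennreal"
  assumes pos: "0 < \<theta> n \<alpha>"
    and anti: "n \<le> m \<Longrightarrow> \<theta> m \<alpha> \<le> \<theta> n \<alpha>"
    and ev_finite: "\<exists>n. \<theta> n \<alpha> < \<infinity>"
    and strongly: "\<exists>m. strongly_dominated mlen (\<theta> m) (\<theta> n)"
    and convolution: "\<exists>m. \<exists>C>0. \<forall>\<alpha> \<beta> \<gamma> \<delta>. (\<forall>j. \<alpha> j + \<gamma> j = \<beta> j + \<delta> j) \<longrightarrow>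
        ennreal (2 ^ (mlen \<alpha> + mlen \<gamma>)) * (\<theta> m \<beta> * \<theta> m \<delta>) \<le> ennreal C * (\<theta> n \<alpha> * \<theta> n \<gamma>)"
begin

lemma realE:
  assumes "\<theta> n \<alpha> < \<infinity>"
  obtains r where "0 < r" "\<theta> n \<alpha> = ennreal r"
  using assms pos[of n \<alpha>] by (cases "\<theta> n \<alpha>") auto

text \<open>This is \<open>convolution\<close> divided by \<open>\<theta> m \<beta>\<close>. Its
  finite right-hand side forces \<open>\<theta> m \<beta>\<close> and
  \<open>\<theta> m \<delta>\<close> to be finite, so the division takes place among positive reals.
  That \<open>m\<close> precedes \<open>w\<close> and \<open>D\<close> matters: it selects the
  domination of \<open>w\<close> used afterwards.\<close>

lemma kmass_decaying:
  "\<exists>m. \<exists>C>0. \<forall>\<alpha> \<beta> \<gamma> w D. \<theta> n \<alpha> < \<infinity> \<longrightarrow> \<theta> n \<gamma> < \<infinity> \<longrightarrow> (\<forall>\<delta>. w \<delta> \<le> D * \<theta> m \<delta>) \<longrightarrow>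
        kmass toep w (\<alpha>, \<beta>) \<gamma> \<le> D * ennreal C * (\<theta> n \<alpha> / \<theta> m \<beta>) * \<theta> n \<gamma>"
proof -
  obtain m C where C: "C > 0" and conv: "\<And>\<alpha> \<beta> \<gamma> \<delta>. (\<forall>j. \<alpha> j + \<gamma> j = \<beta> j + \<delta> j) \<Longrightarrow>
        ennreal (2 ^ (mlen \<alpha> + mlen \<gamma>)) * (\<theta> m \<beta> * \<theta> m \<delta>) \<le> ennreal C * (\<theta> n \<alpha> * \<theta> n \<gamma>)"
    using convolution[of n] by blast
  have "kmass toep w (\<alpha>, \<beta>) \<gamma> \<le> D * ennreal C * (\<theta> n \<alpha> / \<theta> m \<beta>) * \<theta> n \<gamma>"
    if fin: "\<theta> n \<alpha> < \<infinity>" "\<theta> n \<gamma> < \<infinity>" and w: "\<And>\<delta>. w \<delta> \<le> D * \<theta> m \<delta>" for \<alpha> \<beta> \<gamma> w D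
  proof (rule kmass_toep_le)
    fix \<delta> assume eq: "\<And>j. \<alpha> j + \<gamma> j = \<beta> j + \<delta> j"
    let ?e = "2 ^ (mlen \<alpha> + mlen \<gamma>) :: real"
    obtain a where a: "0 < a" "\<theta> n \<alpha> = ennreal a" using realE fin(1) by blast
    obtain c where c: "0 < c" "\<theta> n \<gamma> = ennreal c" using realE fin(2) by blast
    have le: "ennreal ?e * (\<theta> m \<beta> * \<theta> m \<delta>) \<le> ennreal (C * (a * c))"
      using conv[of \<alpha> \<gamma> \<beta> \<delta>] eq a c C by (simp add: ennreal_mult)
    have "ennreal ?e * (\<theta> m \<beta> * \<theta> m \<delta>) < top" by (rule order_le_less_trans[OF le]) simp
    then have "\<theta> m \<beta> < \<infinity>" "\<theta> m \<delta> < \<infinity>"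
      using pos[of m \<beta>] pos[of m \<delta>] by (auto simp: ennreal_mult_less_top)
    then obtain b d where b: "0 < b" "\<theta> m \<beta> = ennreal b" and d: "0 < d" "\<theta> m \<delta> = ennreal d"
      using realE by metis
    have "ennreal (?e * (b * d)) \<le> ennreal (C * (a * c))"
      using le b d by (simp add: ennreal_mult)
    then have "?e * (b * d) \<le> C * (a * c)" using a c C by (simp add: ennreal_le_iff)
    then have "?e * d \<le> C * (a / b) * c" using b by (simp add: field_simps)
    then have "ennreal (?e * d) \<le> ennreal (C * (a / b) * c)" by (rule ennreal_leI)
    moreover have "ennreal (C * (a / b) * c) = ennreal C * (ennreal a / ennreal b) * ennreal c"
      using a b c C by (simp add: ennreal_mult divide_ennreal del: times_divide_eq_right times_divide_eq_left)
    moreover have "ennreal (?e * d) = ennreal ?e * ennreal d" using d by (simp add: ennreal_mult)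
    ultimately have *: "ennreal ?e * \<theta> m \<delta> \<le> ennreal C * (\<theta> n \<alpha> / \<theta> m \<beta>) * \<theta> n \<gamma>"
      using a b c d by simp
    have "ennreal ?e * w \<delta> \<le> ennreal ?e * (D * \<theta> m \<delta>)" by (intro mult_left_mono w) simp
    also have "\<dots> = D * (ennreal ?e * \<theta> m \<delta>)" by (simp add: ac_simps)
    also have "\<dots> \<le> D * (ennreal C * (\<theta> n \<alpha> / \<theta> m \<beta>) * \<theta> n \<gamma>)" by (intro mult_left_mono *) simp
    finally show "ennreal ?e * w \<delta> \<le> D * ennreal C * (\<theta> n \<alpha> / \<theta> m \<beta>) * \<theta> n \<gamma>" by (simp add: mult.assoc)
  qed
  then show ?thesis using C by blast
qed

text \<open>\<open>convolution\<close> is applied with the two pairs exchanged, so that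
  \<open>\<beta>\<close> and \<open>\<delta>\<close> are on the larger side, and divided by all
  weights except \<open>\<theta> n \<beta>\<close>.\<close>

lemma kmass_growing:
  "\<exists>m. \<exists>C>0. \<forall>\<alpha> \<beta> \<gamma> w D. \<theta> n \<beta> < \<infinity> \<longrightarrow> (\<forall>\<delta>. w \<delta> \<le> D * (1 / \<theta> n \<delta>)) \<longrightarrow>
        kmass toep w (\<alpha>, \<beta>) \<gamma> \<le> D * ennreal C * (\<theta> n \<beta> / \<theta> m \<alpha>) * (1 / \<theta> m \<gamma>)"
proof -
  obtain m C where C: "C > 0" and conv: "\<And>\<alpha> \<beta> \<gamma> \<delta>. (\<forall>j. \<alpha> j + \<gamma> j = \<beta> j + \<delta> j) \<Longrightarrow>
        ennreal (2 ^ (mlen \<alpha> + mlen \<gamma>)) * (\<theta> m \<beta> * \<theta> m \<delta>) \<le> ennreal C * (\<theta> n \<alpha> * \<theta> n \<gamma>)"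
    using convolution[of n] by blast
  have "kmass toep w (\<alpha>, \<beta>) \<gamma> \<le> D * ennreal C * (\<theta> n \<beta> / \<theta> m \<alpha>) * (1 / \<theta> m \<gamma>)"
    if fin: "\<theta> n \<beta> < \<infinity>" and w: "\<And>\<delta>. w \<delta> \<le> D * (1 / \<theta> n \<delta>)" for \<alpha> \<beta> \<gamma> w D
  proof (rule kmass_toep_le)
    fix \<delta> assume eq: "\<And>j. \<alpha> j + \<gamma> j = \<beta> j + \<delta> j"
    let ?e = "2 ^ (mlen \<alpha> + mlen \<gamma>) :: real"
    have len: "mlen \<beta> + mlen \<delta> = mlen \<alpha> + mlen \<gamma>" using eq by (simp add: mlen_add[symmetric])
    have *: "ennreal ?e * (1 / \<theta> n \<delta>) \<le> ennreal C * (\<theta> n \<beta> / \<theta> m \<alpha>) * (1 / \<theta> m \<gamma>)"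
    proof (cases "\<theta> n \<delta> = top")
      case True
      then show ?thesis by simp
    next
      case False
      then have "\<theta> n \<delta> < \<infinity>" by (simp add: top.not_eq_extremum)
      then obtain d where d: "0 < d" "\<theta> n \<delta> = ennreal d" using realE by blast
      obtain b where b: "0 < b" "\<theta> n \<beta> = ennreal b" using realE fin by blast
      have le: "ennreal ?e * (\<theta> m \<alpha> * \<theta> m \<gamma>) \<le> ennreal (C * (b * d))"
        using conv[of \<beta> \<delta> \<alpha> \<gamma>] eq b d C len by (simp add: ennreal_mult)
      have "ennreal ?e * (\<theta> m \<alpha> * \<theta> m \<gamma>) < top" by (rule order_le_less_trans[OF le]) simp
      then have "\<theta> m \<alpha> < \<infinity>" "\<theta> m \<gamma> < \<infinity>"
        using pos[of m \<alpha>] pos[of m \<gamma>] by (auto simp: ennreal_mult_less_top)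
      then obtain a c where a: "0 < a" "\<theta> m \<alpha> = ennreal a" and c: "0 < c" "\<theta> m \<gamma> = ennreal c"
        using realE by metis
      have "ennreal (?e * (a * c)) \<le> ennreal (C * (b * d))"
        using le a c by (simp add: ennreal_mult)
      then have "?e * (a * c) \<le> C * (b * d)" using b d C by (simp add: ennreal_le_iff)
      then have "?e * (1 / d) \<le> C * (b / a) * (1 / c)" using a c d by (simp add: field_simps)
      then have "ennreal (?e * (1 / d)) \<le> ennreal (C * (b / a) * (1 / c))" by (rule ennreal_leI)
      moreover have "ennreal (1 / x) = 1 / ennreal x" if "0 < x" for x
        using divide_ennreal[of 1 x] that by simp
      ultimately show ?thesis
        using a b c d C divide_ennreal[of b a] by (simp add: ennreal_mult del: times_divide_eq_right mult_1_right)
    qed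
    have "ennreal ?e * w \<delta> \<le> ennreal ?e * (D * (1 / \<theta> n \<delta>))" by (intro mult_left_mono w) simp
    also have "\<dots> = D * (ennreal ?e * (1 / \<theta> n \<delta>))" by (simp only: ac_simps)
    also have "\<dots> \<le> D * (ennreal C * (\<theta> n \<beta> / \<theta> m \<alpha>) * (1 / \<theta> m \<gamma>))" by (intro mult_left_mono *) simp
    finally show "ennreal ?e * w \<delta> \<le> D * ennreal C * (\<theta> n \<beta> / \<theta> m \<alpha>) * (1 / \<theta> m \<gamma>)" by (simp only: mult.assoc)
  qed
  then show ?thesis using C by blast
qed

text \<open>
  For \<open>\<theta>\<close> cofinal to \<open>vartheta\<close> these weights describe \<open>C_sp\<close> and \<open>C_star\<close>; for \<open>\<theta>\<close> cofinal to
  \<open>1 / vartheta\<close> they describe \<open>C0_star\<close> and \<open>C0_sp\<close>, in this order.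
\<close>

definition decay_symb :: "nat \<Rightarrow> nat \<Rightarrow> 'n mindex \<times> 'n mindex \<Rightarrow> ennreal" where
  "decay_symb n m = (\<lambda>(\<alpha>, \<beta>). \<theta> n \<alpha> / \<theta> m \<beta>)"

definition growth_symb :: "nat \<Rightarrow> nat \<Rightarrow> 'n mindex \<times> 'n mindex \<Rightarrow> ennreal" where
  "growth_symb n m = (\<lambda>(\<alpha>, \<beta>). \<theta> n \<beta> / \<theta> m \<alpha>)"

lemma lf_weights_decay_symb: "lf_weights decay_symb"
  by unfold_locales (auto simp: decay_symb_def intro!: ennreal_divide_mono anti)

lemma lf_weights_growth_symb: "lf_weights growth_symb"
  by unfold_locales (auto simp: growth_symb_def intro!: ennreal_divide_mono anti)

lemma lf_weights_decay: "lf_weights (\<lambda>n m. \<theta> n)"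
  by unfold_locales (auto intro!: anti)

lemma lf_weights_growth: "lf_weights (\<lambda>n m \<alpha>. 1 / \<theta> m \<alpha>)"
  by unfold_locales (auto intro!: ennreal_divide_mono anti)

text \<open>Because \<open>\<infinity> / \<infinity> = 0\<close>, a single quotient may hide an
  infinite numerator; some \<open>m\<close> with \<open>\<theta> m \<beta>\<close> finite reveals
  it.\<close>

lemma decay_symb_finite_iff: "(\<forall>m. decay_symb n m (\<alpha>, \<beta>) < \<infinity>) \<longleftrightarrow> \<theta> n \<alpha> < \<infinity>"
proof
  obtain m where "\<theta> m \<beta> < \<infinity>" using ev_finite by blast
  moreover assume "\<forall>m. decay_symb n m (\<alpha>, \<beta>) < \<infinity>"
  then have "\<theta> n \<alpha> / \<theta> m \<beta> < top" by (simp add: decay_symb_def)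
  ultimately show "\<theta> n \<alpha> < \<infinity>"
    using ennreal_divide_eq_top_iff[of "\<theta> n \<alpha>" "\<theta> m \<beta>"] by (auto simp: top.not_eq_extremum less_top)
next
  assume "\<theta> n \<alpha> < \<infinity>"
  then show "\<forall>m. decay_symb n m (\<alpha>, \<beta>) < \<infinity>"
    using pos by (auto simp: decay_symb_def intro: ennreal_divide_finite)
qed

lemma growth_symb_finite_iff: "(\<forall>m. growth_symb n m (\<alpha>, \<beta>) < \<infinity>) \<longleftrightarrow> \<theta> n \<beta> < \<infinity>"
  using decay_symb_finite_iff[of n \<beta> \<alpha>] by (simp add: growth_symb_def decay_symb_def)

text \<open>Where \<open>\<theta> n\<close> is infinite the bound is automatic because
  \<open>D\<close> is positive, so the restriction on indices in \<open>LP\<close>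
  disappears.\<close>

lemma LP_decayD:
  assumes "w \<in> LP (\<lambda>n m. \<theta> n)"
  obtains D where "0 < D" "\<And>\<delta>. w \<delta> \<le> ennreal D * \<theta> n \<delta>"
proof -
  obtain D where D: "D > 0" "\<And>\<delta>. \<theta> n \<delta> < \<infinity> \<Longrightarrow> w \<delta> \<le> ennreal D * \<theta> n \<delta>"
    using assms unfolding LP_def by auto
  have "w \<delta> \<le> ennreal D * \<theta> n \<delta>" for \<delta>
    using D by (cases "\<theta> n \<delta> = top") (auto simp: top.not_eq_extremum ennreal_mult_top)
  then show thesis using that D(1) by blast
qed

lemma growth_finite: "1 / \<theta> m \<delta> < \<infinity>"
  using pos[of m \<delta>] by (auto intro: ennreal_divide_finite)

lemma LP_growthD:
  assumes "w \<in> LP (\<lambda>n m \<alpha>. 1 / \<theta> m \<alpha>)"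
  obtains l D where "0 < D" "\<And>\<delta>. w \<delta> \<le> ennreal D * (1 / \<theta> l \<delta>)"
  using assms growth_finite unfolding LP_def by blast

end

text \<open>The power factors over the coordinates and counting measure on multi-indices is a
  product of counting measures, so the sum is a product of geometric series.\<close>

lemma geom_summable_mlen: "geom_summable (mlen :: ('n::finite) mindex \<Rightarrow> nat)"
  unfolding geom_summable_def
proof (intro allI impI)
  fix e :: real assume e: "0 < e \<and> e < 1"
  interpret product_sigma_finite "\<lambda>_::'n. count_space (UNIV :: nat set)"
    by (simp add: product_sigma_finite_def sigma_finite_measure_count_space)
  have "(\<integral>\<^sup>+k. ennreal (e ^ k) \<partial>count_space (UNIV :: nat set)) = (\<Sum>k. ennreal (e ^ k))"
    by (rule nn_integral_count_space_nat)
  also have "\<dots> = ennreal (\<Sum>k. e ^ k)"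
    using e by (intro suminf_ennreal2) auto
  finally have g: "(\<integral>\<^sup>+k. ennreal (e ^ k) \<partial>count_space (UNIV :: nat set)) = ennreal (\<Sum>k. e ^ k)" .
  have "(\<integral>\<^sup>+\<alpha>. ennreal (e ^ mlen \<alpha>) \<partial>count_space (UNIV :: 'n mindex set))
      = (\<integral>\<^sup>+\<alpha>. (\<Prod>j\<in>UNIV. ennreal (e ^ \<alpha> j)) \<partial>count_space (UNIV :: 'n mindex set))"
    using e by (intro nn_integral_cong) (simp add: mlen_def power_sum prod_ennreal)
  also have "\<dots> = (\<integral>\<^sup>+\<alpha>. (\<Prod>j\<in>UNIV. ennreal (e ^ \<alpha> j)) \<partial>PiM (UNIV :: 'n set) (\<lambda>_. count_space UNIV))"
    by (subst count_space_PiM_finite) auto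
  also have "\<dots> = (\<Prod>j\<in>(UNIV :: 'n set). \<integral>\<^sup>+k. ennreal (e ^ k) \<partial>count_space (UNIV :: nat set))"
    by (rule product_nn_integral_prod) auto
  also have "\<dots> < \<infinity>" unfolding g by (simp add: power_less_top_ennreal)
  finally show "(\<integral>\<^sup>+\<alpha>. ennreal (e ^ mlen \<alpha>) \<partial>count_space (UNIV :: 'n mindex set)) < \<infinity>" .
qed

section \<open>Equicontinuity of the Toeplitz kernel\<close>

lemma wsum_point: "wsum v (\<lambda>i. if i = j then 1 else 0) = v j"
  by (subst wsum_finite_support[of "{j}"]) auto

context weight_system
begin

text \<open>The gliding hump, applied to the coordinatewise supremum \<open>M\<close>, bounds
  \<open>B\<close> in the sup-norm of one step; \<open>strongly\<close> turns this into an l1-bound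
  in another. Thus the inductive limit of functions is regular.\<close>

lemma bounded_in_decay_imp:
  assumes "bounded_in (kothe_top (LE (\<lambda>n m. \<theta> n)) (LP (\<lambda>n m. \<theta> n))) B"
  obtains n K where "0 < K" "\<And>f. f \<in> B \<Longrightarrow> wsum (\<theta> n) f \<le> ennreal K"
proof -
  interpret D: lf_weights "\<lambda>n m. \<theta> n" by (rule lf_weights_decay)
  define M where "M \<gamma> = (SUP f\<in>B. ennreal (norm (f \<gamma>)))" for \<gamma>
  have "\<exists>n. \<exists>C>0. \<forall>\<gamma>. M \<gamma> * \<theta> n \<gamma> \<le> ennreal C"
  proof (rule bounded_of_dual_bounded)
    fix y assume "\<And>n. \<exists>C>0. \<forall>\<gamma>. y \<gamma> \<le> ennreal C * \<theta> n \<gamma>"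
    then have "y \<in> LP (\<lambda>n m. \<theta> n)" unfolding LP_def by blast
    then obtain C where C: "\<And>f. f \<in> B \<Longrightarrow> wsum y f \<le> ennreal C"
      using D.bounded_inD[OF assms] by metis
    have "M \<gamma> * y \<gamma> \<le> ennreal C" for \<gamma>
      unfolding M_def SUP_mult_right_ennreal
      by (intro SUP_least order_trans[OF wsum_ge_point C])
    then show "\<exists>C::real. \<forall>\<gamma>. M \<gamma> * y \<gamma> \<le> ennreal C" by blast
  qed (auto intro: anti pos)
  then obtain n C where C: "C > 0" "\<And>\<gamma>. M \<gamma> * \<theta> n \<gamma> \<le> ennreal C" by blast
  obtain m where "strongly_dominated mlen (\<theta> m) (\<theta> n)" using strongly by blast
  then obtain c e where c: "c > 0" "0 < e" "e < 1" "\<And>i. \<theta> m i \<le> ennreal (c * e ^ mlen i) * \<theta> n i"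
    unfolding strongly_dominated_def by blast
  define S where "S = (\<integral>\<^sup>+i. ennreal (e ^ mlen i) \<partial>count_space (UNIV :: 'n mindex set))"
  have "S < \<infinity>" using geom_summable_mlen c unfolding geom_summable_def S_def by auto
  then obtain \<sigma> where \<sigma>: "S = ennreal \<sigma>" "0 \<le> \<sigma>" by (cases S) auto
  have "wsum (\<theta> m) f \<le> ennreal (c * C * (\<sigma> + 1))" if f: "f \<in> B" for f
  proof -
    have "wsum (\<theta> m) f \<le> (\<integral>\<^sup>+i. ennreal (c * C) * ennreal (e ^ mlen i) \<partial>count_space (UNIV :: 'n mindex set))"
      unfolding wsum_def
    proof (rule nn_integral_mono)
      fix i
      have "ennreal (norm (f i)) * \<theta> m i \<le> ennreal (norm (f i)) * (ennreal (c * e ^ mlen i) * \<theta> n i)"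
        by (intro mult_left_mono c(4)) simp
      also have "\<dots> \<le> M i * (ennreal (c * e ^ mlen i) * \<theta> n i)"
        unfolding M_def by (intro mult_right_mono SUP_upper f) simp
      also have "\<dots> = ennreal (c * e ^ mlen i) * (M i * \<theta> n i)" by (simp add: ac_simps)
      also have "\<dots> \<le> ennreal (c * e ^ mlen i) * ennreal C" by (intro mult_left_mono C(2)) simp
      also have "\<dots> = ennreal (c * C) * ennreal (e ^ mlen i)" using c C by (simp add: ennreal_mult ac_simps)
      finally show "ennreal (norm (f i)) * \<theta> m i \<le> ennreal (c * C) * ennreal (e ^ mlen i)" .
    qed
    also have "\<dots> = ennreal (c * C) * S" unfolding S_def by (rule nn_integral_cmult) simp
    also have "\<dots> \<le> ennreal (c * C) * ennreal (\<sigma> + 1)"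
      unfolding \<sigma> by (intro mult_left_mono ennreal_leI) auto
    finally show ?thesis using c C \<sigma> by (simp add: ennreal_mult)
  qed
  then show thesis using that[of "c * C * (\<sigma> + 1)"] c C \<sigma> by auto
qed

lemma anti_max: "\<theta> (max n k) \<alpha> \<le> \<theta> n \<alpha>" "\<theta> (max n k) \<alpha> \<le> \<theta> k \<alpha>"
  by (auto intro: anti)

lemma kernel_operator_decay:
  "kernel_operator (LE decay_symb) (LP decay_symb) (LE (\<lambda>n m. \<theta> n)) (LP (\<lambda>n m. \<theta> n))
    (LE (\<lambda>n m. \<theta> n)) (LP (\<lambda>n m. \<theta> n)) toep"
proof -
  interpret X: lf_weights decay_symb by (rule lf_weights_decay_symb)
  interpret Y: lf_weights "\<lambda>n m. \<theta> n" by (rule lf_weights_decay)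
  have le: "\<exists>m. \<exists>C>0. \<forall>\<alpha> \<beta> \<gamma> w D. \<theta> n \<alpha> < \<infinity> \<longrightarrow> \<theta> k \<gamma> < \<infinity> \<longrightarrow> (\<forall>\<delta>. w \<delta> \<le> D * \<theta> m \<delta>) \<longrightarrow>
        kmass toep w (\<alpha>, \<beta>) \<gamma> \<le> D * ennreal C * decay_symb n m (\<alpha>, \<beta>) * \<theta> k \<gamma>" for n k
  proof -
    \<comment> \<open>Symbol and function may lie in different steps; the estimate is taken in the
      common step and relaxed by monotonicity.\<close>
    let ?N = "max n k"
    obtain m C where C: "0 < C"
      "\<forall>\<alpha> \<beta> \<gamma> w D. \<theta> ?N \<alpha> < \<infinity> \<longrightarrow> \<theta> ?N \<gamma> < \<infinity> \<longrightarrow> (\<forall>\<delta>. w \<delta> \<le> D * \<theta> m \<delta>) \<longrightarrow>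
        kmass toep w (\<alpha>, \<beta>) \<gamma> \<le> D * ennreal C * (\<theta> ?N \<alpha> / \<theta> m \<beta>) * \<theta> ?N \<gamma>"
      using kmass_decaying[of ?N] by blast
    have "kmass toep w (\<alpha>, \<beta>) \<gamma> \<le> D * ennreal C * decay_symb n m (\<alpha>, \<beta>) * \<theta> k \<gamma>"
      if "\<theta> n \<alpha> < \<infinity>" "\<theta> k \<gamma> < \<infinity>" "\<forall>\<delta>. w \<delta> \<le> D * \<theta> m \<delta>" for \<alpha> \<beta> \<gamma> w D
    proof -
      have "kmass toep w (\<alpha>, \<beta>) \<gamma> \<le> D * ennreal C * (\<theta> ?N \<alpha> / \<theta> m \<beta>) * \<theta> ?N \<gamma>"
        using that anti_max[of n k] by (intro C(2)[rule_format]) (auto intro: order_le_less_trans)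
      also have "\<dots> \<le> D * ennreal C * (\<theta> n \<alpha> / \<theta> m \<beta>) * \<theta> k \<gamma>"
        by (intro mult_mono mult_left_mono ennreal_divide_mono anti_max) auto
      finally show ?thesis by (simp add: decay_symb_def)
    qed
    then show ?thesis using C(1) by blast
  qed
  show ?thesis
  proof (unfold_locales)
    fix \<delta> :: "'n mindex" and i \<gamma> show "0 \<le> toep \<delta> i \<gamma>" by (rule toep_nonneg)
  next
    fix B w
    assume B: "bounded_in (kothe_top (LE decay_symb) (LP decay_symb)) B" and w: "w \<in> LP (\<lambda>n m. \<theta> n)"
    let ?v = "\<lambda>\<gamma>. SUP b\<in>B. wsum (\<lambda>i. kmass toep w i \<gamma>) b"
    have "\<exists>K>0. \<forall>\<gamma>. \<theta> k \<gamma> < \<infinity> \<longrightarrow> ?v \<gamma> \<le> ennreal K * \<theta> k \<gamma>" for k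
    proof -
      \<comment> \<open>For fixed \<open>k\<close> all \<open>\<gamma>\<close> are treated at once:
        this supremum is itself a continuous weight on symbols, hence bounded on \<open>B\<close>,
        and the bound does not depend on \<open>\<gamma>\<close>.\<close>
      define U where "U i = (SUP \<gamma>\<in>{\<gamma>. \<theta> k \<gamma> < \<infinity>}. kmass toep w i \<gamma> / \<theta> k \<gamma>)" for i
      have "U \<in> LP decay_symb"
        unfolding LP_def
      proof (intro CollectI allI)
        fix n
        obtain m C where C: "0 < C" "\<forall>\<alpha> \<beta> \<gamma> w D. \<theta> n \<alpha> < \<infinity> \<longrightarrow> \<theta> k \<gamma> < \<infinity> \<longrightarrow> (\<forall>\<delta>. w \<delta> \<le> D * \<theta> m \<delta>) \<longrightarrow>
            kmass toep w (\<alpha>, \<beta>) \<gamma> \<le> D * ennreal C * decay_symb n m (\<alpha>, \<beta>) * \<theta> k \<gamma>"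
          using le[of n k] by blast
        obtain D where D: "0 < D" "\<And>\<delta>. w \<delta> \<le> ennreal D * \<theta> m \<delta>" using LP_decayD[OF w] by blast
        have "U i \<le> ennreal (D * C) * decay_symb n m i" if i: "\<forall>l. decay_symb n l i < \<infinity>" for i
          unfolding U_def
        proof (rule SUP_least)
          fix \<gamma> assume "\<gamma> \<in> {\<gamma>. \<theta> k \<gamma> < \<infinity>}"
          then have g: "\<theta> k \<gamma> < \<infinity>" by simp
          obtain \<alpha> \<beta> where ab: "i = (\<alpha>, \<beta>)" by (cases i)
          have "kmass toep w i \<gamma> \<le> ennreal D * ennreal C * decay_symb n m i * \<theta> k \<gamma>"
            using i g D(2) decay_symb_finite_iff[of n \<alpha> \<beta>] unfolding ab by (intro C(2)[rule_format]) auto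
          then have "kmass toep w i \<gamma> / \<theta> k \<gamma> \<le> (ennreal D * ennreal C * decay_symb n m i * \<theta> k \<gamma>) / \<theta> k \<gamma>"
            by (rule divide_right_mono_ennreal)
          also have "\<dots> = ennreal D * ennreal C * decay_symb n m i"
            using g pos[of k \<gamma>] by (intro ennreal_mult_divide_eq) auto
          finally show "kmass toep w i \<gamma> / \<theta> k \<gamma> \<le> ennreal (D * C) * decay_symb n m i"
            using D C by (simp add: ennreal_mult)
        qed
        then show "\<exists>m. \<exists>C>0. \<forall>i. (\<forall>l. decay_symb n l i < \<infinity>) \<longrightarrow> U i \<le> ennreal C * decay_symb n m i"
          using C D by (intro exI[of _ m] exI[of _ "D * C"]) auto
      qed
      then obtain K where K: "K > 0" "\<And>b. b \<in> B \<Longrightarrow> wsum U b \<le> ennreal K"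
        using X.bounded_inD[OF B] by blast
      have "?v \<gamma> \<le> ennreal K * \<theta> k \<gamma>" if g: "\<theta> k \<gamma> < \<infinity>" for \<gamma>
      proof (rule SUP_least)
        fix b assume b: "b \<in> B"
        have "kmass toep w i \<gamma> \<le> \<theta> k \<gamma> * U i" for i
        proof -
          have "kmass toep w i \<gamma> = \<theta> k \<gamma> * (kmass toep w i \<gamma> / \<theta> k \<gamma>)"
            using g pos[of k \<gamma>]
            by (subst ennreal_times_divide, subst mult.commute, subst ennreal_mult_divide_eq) auto
          also have "\<dots> \<le> \<theta> k \<gamma> * U i" unfolding U_def using g by (intro mult_left_mono SUP_upper) auto
          finally show ?thesis .
        qed
        then have "wsum (\<lambda>i. kmass toep w i \<gamma>) b \<le> wsum (\<lambda>i. \<theta> k \<gamma> * U i) b" by (intro wsum_mono) auto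
        also have "\<dots> = \<theta> k \<gamma> * wsum U b" by (rule wsum_cmult)
        also have "\<dots> \<le> \<theta> k \<gamma> * ennreal K" by (intro mult_left_mono K(2) b) simp
        finally show "wsum (\<lambda>i. kmass toep w i \<gamma>) b \<le> ennreal K * \<theta> k \<gamma>" by (simp add: mult.commute)
      qed
      then show ?thesis using K(1) by blast
    qed
    then show "?v \<in> LP (\<lambda>n m. \<theta> n)" unfolding LP_def by auto
  next
    fix B w
    assume B: "bounded_in (kothe_top (LE (\<lambda>n m. \<theta> n)) (LP (\<lambda>n m. \<theta> n))) B" and w: "w \<in> LP (\<lambda>n m. \<theta> n)"
    \<comment> \<open>By regularity of the function space one step \<open>k\<close> serves for all
      of \<open>B\<close>.\<close>
    obtain k K where K: "0 < K" "\<And>f. f \<in> B \<Longrightarrow> wsum (\<theta> k) f \<le> ennreal K"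
      using bounded_in_decay_imp[OF B] by blast
    let ?v = "\<lambda>i. SUP f\<in>B. wsum (\<lambda>\<gamma>. kmass toep w i \<gamma>) f"
    show "?v \<in> LP decay_symb"
      unfolding LP_def
    proof (intro CollectI allI)
      fix n
      obtain m C where C: "0 < C" "\<forall>\<alpha> \<beta> \<gamma> w D. \<theta> n \<alpha> < \<infinity> \<longrightarrow> \<theta> k \<gamma> < \<infinity> \<longrightarrow> (\<forall>\<delta>. w \<delta> \<le> D * \<theta> m \<delta>) \<longrightarrow>
          kmass toep w (\<alpha>, \<beta>) \<gamma> \<le> D * ennreal C * decay_symb n m (\<alpha>, \<beta>) * \<theta> k \<gamma>"
        using le[of n k] by blast
      obtain D where D: "0 < D" "\<And>\<delta>. w \<delta> \<le> ennreal D * \<theta> m \<delta>" using LP_decayD[OF w] by blast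
      have "?v i \<le> ennreal (D * C * K) * decay_symb n m i" if i: "\<forall>l. decay_symb n l i < \<infinity>" for i
      proof (rule SUP_least)
        fix f assume f: "f \<in> B"
        obtain \<alpha> \<beta> where ab: "i = (\<alpha>, \<beta>)" by (cases i)
        have fin: "wsum (\<theta> k) f < \<infinity>" using K(2)[OF f] by (auto intro: order_le_less_trans)
        have "wsum (\<lambda>\<gamma>. kmass toep w i \<gamma>) f \<le> wsum (\<lambda>\<gamma>. (ennreal D * ennreal C * decay_symb n m i) * \<theta> k \<gamma>) f"
        proof (rule wsum_mono)
          fix \<gamma> assume "f \<gamma> \<noteq> 0"
          then have g: "\<theta> k \<gamma> < \<infinity>" using wsum_finite_imp[OF fin] by simp
          show "kmass toep w i \<gamma> \<le> (ennreal D * ennreal C * decay_symb n m i) * \<theta> k \<gamma>"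
            using i g D(2) decay_symb_finite_iff[of n \<alpha> \<beta>] unfolding ab by (intro C(2)[rule_format]) auto
        qed simp
        also have "\<dots> = (ennreal D * ennreal C * decay_symb n m i) * wsum (\<theta> k) f" by (rule wsum_cmult)
        also have "\<dots> \<le> (ennreal D * ennreal C * decay_symb n m i) * ennreal K"
          by (intro mult_left_mono K(2) f) simp
        finally show "wsum (\<lambda>\<gamma>. kmass toep w i \<gamma>) f \<le> ennreal (D * C * K) * decay_symb n m i"
          using D C K by (simp add: ennreal_mult ac_simps)
      qed
      then show "\<exists>m. \<exists>C>0. \<forall>i. (\<forall>l. decay_symb n l i < \<infinity>) \<longrightarrow> ?v i \<le> ennreal C * decay_symb n m i"
        using C D K by (intro exI[of _ m] exI[of _ "D * C * K"]) auto
    qed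
  next
    fix a f assume a: "a \<in> LE decay_symb" and f: "f \<in> LE (\<lambda>n m. \<theta> n)"
    obtain n where n: "\<And>m. wsum (decay_symb n m) a < \<infinity>" using a by (auto simp: LE_def)
    obtain k where k: "wsum (\<theta> k) f < \<infinity>" using f by (auto simp: LE_def)
    obtain m C where C: "0 < C" "\<forall>\<alpha> \<beta> \<gamma> w D. \<theta> n \<alpha> < \<infinity> \<longrightarrow> \<theta> k \<gamma> < \<infinity> \<longrightarrow> (\<forall>\<delta>. w \<delta> \<le> D * \<theta> m \<delta>) \<longrightarrow>
        kmass toep w (\<alpha>, \<beta>) \<gamma> \<le> D * ennreal C * decay_symb n m (\<alpha>, \<beta>) * \<theta> k \<gamma>"
      using le[of n k] by blast
    \<comment> \<open>The output lies in the step \<open>m\<close> that \<open>convolution\<close>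
      assigns to the steps of \<open>a\<close> and \<open>f\<close>; here
      \<open>w = \<theta> m\<close> and \<open>D = 1\<close>.\<close>
    have "wsum (\<theta> m) (kop toep a f) \<le> wsum (\<lambda>\<gamma>. wsum (\<lambda>i. kmass toep (\<theta> m) i \<gamma>) a) f"
      by (rule wsum_kop_le[OF toep_nonneg])
    also have "\<dots> \<le> wsum (\<lambda>\<gamma>. wsum (\<lambda>i. (ennreal C * \<theta> k \<gamma>) * decay_symb n m i) a) f"
    proof (intro wsum_mono)
      fix \<gamma> i assume "f \<gamma> \<noteq> 0" "a i \<noteq> 0"
      then have g: "\<theta> k \<gamma> < \<infinity>" and i: "\<forall>l. decay_symb n l i < \<infinity>"
        using wsum_finite_imp[OF k] wsum_finite_imp[OF n] by auto
      obtain \<alpha> \<beta> where ab: "i = (\<alpha>, \<beta>)" by (cases i)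
      have "kmass toep (\<theta> m) i \<gamma> \<le> 1 * ennreal C * decay_symb n m i * \<theta> k \<gamma>"
        using i g decay_symb_finite_iff[of n \<alpha> \<beta>] unfolding ab by (intro C(2)[rule_format]) auto
      then show "kmass toep (\<theta> m) i \<gamma> \<le> (ennreal C * \<theta> k \<gamma>) * decay_symb n m i" by (simp add: ac_simps)
    qed auto
    also have "\<dots> = wsum (\<lambda>\<gamma>. (ennreal C * wsum (decay_symb n m) a) * \<theta> k \<gamma>) f"
      by (simp only: wsum_cmult ac_simps)
    also have "\<dots> = (ennreal C * wsum (decay_symb n m) a) * wsum (\<theta> k) f" by (rule wsum_cmult)
    also have "\<dots> < \<infinity>" using n[of m] k by (auto simp: ennreal_mult_less_top)
    finally show "kop toep a f \<in> LE (\<lambda>n m. \<theta> n)" by (auto simp: LE_def)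
  next
    fix \<delta> :: "'n mindex"
    have "\<exists>C>0. \<forall>\<gamma>. \<theta> n \<gamma> < \<infinity> \<longrightarrow> (if \<gamma> = \<delta> then 1 else 0) \<le> ennreal C * \<theta> n \<gamma>" for n
    proof (cases "\<theta> n \<delta> < \<infinity>")
      case True
      then obtain r where "0 < r" "\<theta> n \<delta> = ennreal r" using realE by blast
      then show ?thesis by (intro exI[of _ "1 / r"]) (auto simp: ennreal_mult[symmetric])
    next
      case False
      then show ?thesis by (intro exI[of _ 1]) auto
    qed
    then show "(\<lambda>j. if j = \<delta> then 1 else 0) \<in> LP (\<lambda>n m. \<theta> n)" unfolding LP_def by auto
  next
    show "fin_families \<subseteq> LE decay_symb"
    proof (rule X.fin_families_subset)
      fix j :: "'n mindex \<times> 'n mindex"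
      obtain \<alpha> \<beta> where ab: "j = (\<alpha>, \<beta>)" by (cases j)
      obtain n where "\<theta> n \<alpha> < \<infinity>" using ev_finite by blast
      then show "(\<lambda>i. if i = j then 1 else 0) \<in> LE decay_symb"
        using decay_symb_finite_iff[of n \<alpha> \<beta>] by (auto simp: LE_def wsum_point ab)
    qed
    show "fin_families \<subseteq> LE (\<lambda>n m. \<theta> n)"
      by (rule Y.fin_families_subset) (use ev_finite in \<open>auto simp: LE_def wsum_point\<close>)
  qed
qed

lemma kernel_operator_growth:
  "kernel_operator (LE growth_symb) (LP growth_symb) (LE (\<lambda>n m \<alpha>. 1 / \<theta> m \<alpha>)) (LP (\<lambda>n m \<alpha>. 1 / \<theta> m \<alpha>))
    (LE (\<lambda>n m \<alpha>. 1 / \<theta> m \<alpha>)) (LP (\<lambda>n m \<alpha>. 1 / \<theta> m \<alpha>)) toep"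
proof -
  interpret X: lf_weights growth_symb by (rule lf_weights_growth_symb)
  interpret Y: lf_weights "\<lambda>n m \<alpha>. 1 / \<theta> m \<alpha>" by (rule lf_weights_growth)
  have le: "\<exists>m. \<exists>C>0. \<forall>\<alpha> \<beta> \<gamma> w D. \<theta> n \<beta> < \<infinity> \<longrightarrow> (\<forall>\<delta>. w \<delta> \<le> D * (1 / \<theta> l \<delta>)) \<longrightarrow>
        kmass toep w (\<alpha>, \<beta>) \<gamma> \<le> D * ennreal C * growth_symb n m (\<alpha>, \<beta>) * (1 / \<theta> m \<gamma>)" for n l
  proof -
    \<comment> \<open>The step \<open>n\<close> of the symbol and the parameter \<open>l\<close> of
      the output weight are merged; since \<open>1 / \<theta>\<close> grows with its index, the
      bound on \<open>w\<close> persists.\<close>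
    let ?N = "max n l"
    obtain m C where C: "0 < C"
      "\<forall>\<alpha> \<beta> \<gamma> w D. \<theta> ?N \<beta> < \<infinity> \<longrightarrow> (\<forall>\<delta>. w \<delta> \<le> D * (1 / \<theta> ?N \<delta>)) \<longrightarrow>
        kmass toep w (\<alpha>, \<beta>) \<gamma> \<le> D * ennreal C * (\<theta> ?N \<beta> / \<theta> m \<alpha>) * (1 / \<theta> m \<gamma>)"
      using kmass_growing[of ?N] by blast
    have "kmass toep w (\<alpha>, \<beta>) \<gamma> \<le> D * ennreal C * growth_symb n m (\<alpha>, \<beta>) * (1 / \<theta> m \<gamma>)"
      if b: "\<theta> n \<beta> < \<infinity>" and w: "\<forall>\<delta>. w \<delta> \<le> D * (1 / \<theta> l \<delta>)" for \<alpha> \<beta> \<gamma> w D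
    proof -
      have "w \<delta> \<le> D * (1 / \<theta> ?N \<delta>)" for \<delta>
      proof -
        have "D * (1 / \<theta> l \<delta>) \<le> D * (1 / \<theta> ?N \<delta>)"
          by (intro mult_left_mono ennreal_divide_mono anti_max) auto
        then show ?thesis using w by (meson order_trans)
      qed
      moreover have "\<theta> ?N \<beta> < \<infinity>" using b anti_max(1)[of n l \<beta>] by (rule order_le_less_trans[rotated])
      ultimately have "kmass toep w (\<alpha>, \<beta>) \<gamma> \<le> D * ennreal C * (\<theta> ?N \<beta> / \<theta> m \<alpha>) * (1 / \<theta> m \<gamma>)"
        by (intro C(2)[rule_format])
      also have "\<dots> \<le> D * ennreal C * (\<theta> n \<beta> / \<theta> m \<alpha>) * (1 / \<theta> m \<gamma>)"
        by (intro mult_right_mono mult_left_mono ennreal_divide_mono anti_max) auto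
      finally show ?thesis by (simp add: growth_symb_def)
    qed
    then show ?thesis using C(1) by blast
  qed
  show ?thesis
  proof (unfold_locales)
    fix \<delta> :: "'n mindex" and i \<gamma> show "0 \<le> toep \<delta> i \<gamma>" by (rule toep_nonneg)
  next
    fix B w
    assume B: "bounded_in (kothe_top (LE growth_symb) (LP growth_symb)) B" and w: "w \<in> LP (\<lambda>n m \<alpha>. 1 / \<theta> m \<alpha>)"
    obtain l D where D: "0 < D" "\<And>\<delta>. w \<delta> \<le> ennreal D * (1 / \<theta> l \<delta>)" using LP_growthD[OF w] by blast
    \<comment> \<open>A single \<open>k\<close> with \<open>M\<close> at most a multiple of
      \<open>1 / \<theta> k\<close> is wanted. By the gliding hump it is enough to bound
      \<open>M * y\<close> for each \<open>y\<close> dominated by all \<open>\<theta> n\<close>, and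
      for given \<open>y\<close> this is controlled by one continuous weight \<open>U\<close> on
      symbols.\<close>
    define M where "M \<gamma> = (SUP b\<in>B. wsum (\<lambda>i. kmass toep w i \<gamma>) b)" for \<gamma>
    have "\<exists>k. \<exists>C>0. \<forall>\<gamma>. M \<gamma> * \<theta> k \<gamma> \<le> ennreal C"
    proof (rule bounded_of_dual_bounded)
      fix y assume y: "\<And>n. \<exists>C>0. \<forall>\<gamma>. y \<gamma> \<le> ennreal C * \<theta> n \<gamma>"
      define U where "U i = (SUP \<gamma>. kmass toep w i \<gamma> * y \<gamma>)" for i
      have "U \<in> LP growth_symb"
        unfolding LP_def
      proof (intro CollectI allI)
        fix n
        obtain m C where C: "0 < C" "\<forall>\<alpha> \<beta> \<gamma> w D. \<theta> n \<beta> < \<infinity> \<longrightarrow> (\<forall>\<delta>. w \<delta> \<le> D * (1 / \<theta> l \<delta>)) \<longrightarrow>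
            kmass toep w (\<alpha>, \<beta>) \<gamma> \<le> D * ennreal C * growth_symb n m (\<alpha>, \<beta>) * (1 / \<theta> m \<gamma>)"
          using le[of n l] by blast
        obtain c where c: "0 < c" "\<And>\<gamma>. y \<gamma> \<le> ennreal c * \<theta> m \<gamma>" using y[of m] by blast
        have "U i \<le> ennreal (D * C * c) * growth_symb n m i" if i: "\<forall>k. growth_symb n k i < \<infinity>" for i
          unfolding U_def
        proof (rule SUP_least)
          fix \<gamma>
          obtain \<alpha> \<beta> where ab: "i = (\<alpha>, \<beta>)" by (cases i)
          have k: "kmass toep w i \<gamma> \<le> ennreal D * ennreal C * growth_symb n m i * (1 / \<theta> m \<gamma>)"
            using i D(2) growth_symb_finite_iff[of n \<alpha> \<beta>] unfolding ab by (intro C(2)[rule_format]) auto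
          \<comment> \<open>Only an inequality: the product is \<open>0\<close> where
            \<open>\<theta> m \<gamma>\<close> is infinite.\<close>
          have one: "(1 / \<theta> m \<gamma>) * \<theta> m \<gamma> \<le> 1"
            by (cases "\<theta> m \<gamma> = top") (use pos[of m \<gamma>] in \<open>auto simp: ennreal_divide_times less_top\<close>)
          have "kmass toep w i \<gamma> * y \<gamma> \<le>
              (ennreal D * ennreal C * growth_symb n m i * (1 / \<theta> m \<gamma>)) * (ennreal c * \<theta> m \<gamma>)"
            by (intro mult_mono k c(2)) auto
          also have "\<dots> = (ennreal D * ennreal C * ennreal c * growth_symb n m i) * ((1 / \<theta> m \<gamma>) * \<theta> m \<gamma>)"
            by (simp only: ac_simps)
          also have "\<dots> \<le> (ennreal D * ennreal C * ennreal c * growth_symb n m i) * 1"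
            by (intro mult_left_mono one) simp
          finally show "kmass toep w i \<gamma> * y \<gamma> \<le> ennreal (D * C * c) * growth_symb n m i"
            using D C c by (simp add: ennreal_mult)
        qed
        then show "\<exists>m. \<exists>C>0. \<forall>i. (\<forall>k. growth_symb n k i < \<infinity>) \<longrightarrow> U i \<le> ennreal C * growth_symb n m i"
          using C D c by (intro exI[of _ m] exI[of _ "D * C * c"]) auto
      qed
      then obtain K where K: "\<And>b. b \<in> B \<Longrightarrow> wsum U b \<le> ennreal K"
        using X.bounded_inD[OF B] by blast
      have "M \<gamma> * y \<gamma> \<le> ennreal K" for \<gamma>
        unfolding M_def SUP_mult_right_ennreal
      proof (rule SUP_least)
        fix b assume b: "b \<in> B"
        have "wsum (\<lambda>i. kmass toep w i \<gamma>) b * y \<gamma> = wsum (\<lambda>i. y \<gamma> * kmass toep w i \<gamma>) b"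
          by (simp only: wsum_cmult ac_simps)
        also have "\<dots> \<le> wsum U b"
          unfolding U_def by (intro wsum_mono SUP_upper2[of \<gamma>]) (auto simp: mult.commute)
        also have "\<dots> \<le> ennreal K" by (rule K[OF b])
        finally show "wsum (\<lambda>i. kmass toep w i \<gamma>) b * y \<gamma> \<le> ennreal K" .
      qed
      then show "\<exists>C::real. \<forall>\<gamma>. M \<gamma> * y \<gamma> \<le> ennreal C" by blast
    qed (auto intro: anti pos)
    then obtain k C where C: "C > 0" "\<And>\<gamma>. M \<gamma> * \<theta> k \<gamma> \<le> ennreal C" by blast
    have "M \<gamma> \<le> ennreal C * (1 / \<theta> k \<gamma>)" for \<gamma>
    proof (cases "\<theta> k \<gamma> = top")
      case True
      then have "M \<gamma> = 0" using C(2)[of \<gamma>] by (cases "M \<gamma> = 0") (auto simp: ennreal_mult_top top_unique)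
      then show ?thesis by simp
    next
      case False
      have "M \<gamma> = M \<gamma> * \<theta> k \<gamma> / \<theta> k \<gamma>"
        using False pos[of k \<gamma>] by (subst ennreal_mult_divide_eq) auto
      also have "\<dots> \<le> ennreal C / \<theta> k \<gamma>" by (rule divide_right_mono_ennreal[OF C(2)])
      finally show ?thesis by (simp add: ennreal_times_divide)
    qed
    then show "(\<lambda>\<gamma>. SUP b\<in>B. wsum (\<lambda>i. kmass toep w i \<gamma>) b) \<in> LP (\<lambda>n m \<alpha>. 1 / \<theta> m \<alpha>)"
      unfolding LP_def M_def[symmetric] using C(1) by blast
  next
    fix B w
    assume B: "bounded_in (kothe_top (LE (\<lambda>n m \<alpha>. 1 / \<theta> m \<alpha>)) (LP (\<lambda>n m \<alpha>. 1 / \<theta> m \<alpha>))) B"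
      and w: "w \<in> LP (\<lambda>n m \<alpha>. 1 / \<theta> m \<alpha>)"
    obtain l D where D: "0 < D" "\<And>\<delta>. w \<delta> \<le> ennreal D * (1 / \<theta> l \<delta>)" using LP_growthD[OF w] by blast
    let ?v = "\<lambda>i. SUP f\<in>B. wsum (\<lambda>\<gamma>. kmass toep w i \<gamma>) f"
    show "?v \<in> LP growth_symb"
      unfolding LP_def
    proof (intro CollectI allI)
      fix n
      obtain m C where C: "0 < C" "\<forall>\<alpha> \<beta> \<gamma> w D. \<theta> n \<beta> < \<infinity> \<longrightarrow> (\<forall>\<delta>. w \<delta> \<le> D * (1 / \<theta> l \<delta>)) \<longrightarrow>
          kmass toep w (\<alpha>, \<beta>) \<gamma> \<le> D * ennreal C * growth_symb n m (\<alpha>, \<beta>) * (1 / \<theta> m \<gamma>)"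
        using le[of n l] by blast
      \<comment> \<open>\<open>1 / \<theta> m\<close> is one of the defining seminorms of the
        projective limit, so it is bounded on \<open>B\<close>.\<close>
      have "(\<lambda>\<alpha>. 1 / \<theta> m \<alpha>) \<in> LP (\<lambda>n m \<alpha>. 1 / \<theta> m \<alpha>)"
        unfolding LP_def by (intro CollectI allI exI[of _ m] exI[of _ "1::real"]) auto
      then obtain K where K: "0 < K" "\<And>f. f \<in> B \<Longrightarrow> wsum (\<lambda>\<alpha>. 1 / \<theta> m \<alpha>) f \<le> ennreal K"
        using Y.bounded_inD[OF B] by blast
      have "?v i \<le> ennreal (D * C * K) * growth_symb n m i" if i: "\<forall>k. growth_symb n k i < \<infinity>" for i
      proof (rule SUP_least)
        fix f assume f: "f \<in> B"
        obtain \<alpha> \<beta> where ab: "i = (\<alpha>, \<beta>)" by (cases i)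
        have "kmass toep w i \<gamma> \<le> (ennreal D * ennreal C * growth_symb n m i) * (1 / \<theta> m \<gamma>)" for \<gamma>
          using i D(2) growth_symb_finite_iff[of n \<alpha> \<beta>] unfolding ab by (intro C(2)[rule_format]) auto
        then have "wsum (\<lambda>\<gamma>. kmass toep w i \<gamma>) f \<le> wsum (\<lambda>\<gamma>. (ennreal D * ennreal C * growth_symb n m i) * (1 / \<theta> m \<gamma>)) f"
          by (intro wsum_mono) auto
        also have "\<dots> = (ennreal D * ennreal C * growth_symb n m i) * wsum (\<lambda>\<gamma>. 1 / \<theta> m \<gamma>) f" by (rule wsum_cmult)
        also have "\<dots> \<le> (ennreal D * ennreal C * growth_symb n m i) * ennreal K"
          by (intro mult_left_mono K(2) f) simp
        finally show "wsum (\<lambda>\<gamma>. kmass toep w i \<gamma>) f \<le> ennreal (D * C * K) * growth_symb n m i"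
          using D C K by (simp add: ennreal_mult ac_simps)
      qed
      then show "\<exists>m. \<exists>C>0. \<forall>i. (\<forall>k. growth_symb n k i < \<infinity>) \<longrightarrow> ?v i \<le> ennreal C * growth_symb n m i"
        using C D K by (intro exI[of _ m] exI[of _ "D * C * K"]) auto
    qed
  next
    fix a f assume a: "a \<in> LE growth_symb" and f: "f \<in> LE (\<lambda>n m \<alpha>. 1 / \<theta> m \<alpha>)"
    obtain n where n: "\<And>m. wsum (growth_symb n m) a < \<infinity>" using a by (auto simp: LE_def)
    have "wsum (\<lambda>\<alpha>. 1 / \<theta> l \<alpha>) (kop toep a f) < \<infinity>" for l
    proof -
      obtain m C where C: "0 < C" "\<forall>\<alpha> \<beta> \<gamma> w D. \<theta> n \<beta> < \<infinity> \<longrightarrow> (\<forall>\<delta>. w \<delta> \<le> D * (1 / \<theta> l \<delta>)) \<longrightarrow>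
          kmass toep w (\<alpha>, \<beta>) \<gamma> \<le> D * ennreal C * growth_symb n m (\<alpha>, \<beta>) * (1 / \<theta> m \<gamma>)"
        using le[of n l] by blast
      have m: "wsum (\<lambda>\<alpha>. 1 / \<theta> m \<alpha>) f < \<infinity>" using f by (auto simp: LE_def)
      let ?w = "\<lambda>\<alpha>. 1 / \<theta> l \<alpha>"
      have "wsum ?w (kop toep a f) \<le> wsum (\<lambda>\<gamma>. wsum (\<lambda>i. kmass toep ?w i \<gamma>) a) f"
        by (rule wsum_kop_le[OF toep_nonneg])
      also have "\<dots> \<le> wsum (\<lambda>\<gamma>. wsum (\<lambda>i. (ennreal C * (1 / \<theta> m \<gamma>)) * growth_symb n m i) a) f"
      proof (intro wsum_mono)
        fix \<gamma> i assume "a i \<noteq> 0"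
        then have i: "\<forall>k. growth_symb n k i < \<infinity>" using wsum_finite_imp[OF n] by auto
        obtain \<alpha> \<beta> where ab: "i = (\<alpha>, \<beta>)" by (cases i)
        have "kmass toep ?w i \<gamma> \<le> 1 * ennreal C * growth_symb n m i * (1 / \<theta> m \<gamma>)"
          using i growth_symb_finite_iff[of n \<alpha> \<beta>] unfolding ab by (intro C(2)[rule_format]) auto
        then show "kmass toep ?w i \<gamma> \<le> (ennreal C * (1 / \<theta> m \<gamma>)) * growth_symb n m i"
          by (simp only: ac_simps mult_1_left)
      qed auto
      also have "\<dots> = wsum (\<lambda>\<gamma>. (ennreal C * wsum (growth_symb n m) a) * (1 / \<theta> m \<gamma>)) f"
        by (intro arg_cong[where f = "\<lambda>v. wsum v f"] ext) (subst wsum_cmult, simp only: ac_simps)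
      also have "\<dots> = (ennreal C * wsum (growth_symb n m) a) * wsum (\<lambda>\<gamma>. 1 / \<theta> m \<gamma>) f" by (rule wsum_cmult)
      also have "\<dots> < \<infinity>" using n[of m] m by (auto simp: ennreal_mult_less_top)
      finally show ?thesis .
    qed
    then show "kop toep a f \<in> LE (\<lambda>n m \<alpha>. 1 / \<theta> m \<alpha>)" by (auto simp: LE_def)
  next
    fix \<delta> :: "'n mindex"
    obtain m where "\<theta> m \<delta> < \<infinity>" using ev_finite by blast
    then obtain r where r: "0 < r" "\<theta> m \<delta> = ennreal r" using realE by blast
    have "ennreal r * (1 / ennreal r) = 1"
      using r by (simp add: ennreal_times_divide)
    then have "(if \<gamma> = \<delta> then 1 else 0) \<le> ennreal r * (1 / \<theta> m \<gamma>)" for \<gamma> using r by auto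
    then show "(\<lambda>j. if j = \<delta> then 1 else 0) \<in> LP (\<lambda>n m \<alpha>. 1 / \<theta> m \<alpha>)" unfolding LP_def using r(1) by blast
  next
    show "fin_families \<subseteq> LE growth_symb"
    proof (rule X.fin_families_subset)
      fix j :: "'n mindex \<times> 'n mindex"
      obtain \<alpha> \<beta> where ab: "j = (\<alpha>, \<beta>)" by (cases j)
      obtain n where "\<theta> n \<beta> < \<infinity>" using ev_finite by blast
      then show "(\<lambda>i. if i = j then 1 else 0) \<in> LE growth_symb"
        using growth_symb_finite_iff[of n \<alpha> \<beta>] by (auto simp: LE_def wsum_point ab)
    qed
    show "fin_families \<subseteq> LE (\<lambda>n m \<alpha>. 1 / \<theta> m \<alpha>)"
      by (rule Y.fin_families_subset) (use growth_finite in \<open>auto simp: LE_def wsum_point\<close>)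
  qed
qed

end

section \<open>Weights on pairs of multi-indices and cofinal parameters\<close>

definition plen :: "('n::finite) mindex \<times> 'n mindex \<Rightarrow> nat" where
  "plen i = mlen (fst i) + mlen (snd i)"

lemma geom_summable_plen: "geom_summable (plen :: ('n::finite) mindex \<times> 'n mindex \<Rightarrow> nat)"
  unfolding geom_summable_def
proof (intro allI impI)
  fix e :: real assume e: "0 < e \<and> e < 1"
  define S where "S = (\<integral>\<^sup>+\<alpha>. ennreal (e ^ mlen \<alpha>) \<partial>count_space (UNIV :: 'n mindex set))"
  have "(\<integral>\<^sup>+i. ennreal (e ^ plen i) \<partial>count_space (UNIV :: ('n mindex \<times> 'n mindex) set)) =
      (\<integral>\<^sup>+\<alpha>. \<integral>\<^sup>+\<beta>. ennreal (e ^ plen (\<alpha>, \<beta>)) \<partial>count_space (UNIV :: 'n mindex set) \<partial>count_space (UNIV :: 'n mindex set))"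
    by (rule nn_integral_fst_count_space[symmetric])
  also have "\<dots> = (\<integral>\<^sup>+\<alpha>. ennreal (e ^ mlen \<alpha>) * S \<partial>count_space (UNIV :: 'n mindex set))"
    unfolding S_def using e
    by (intro nn_integral_cong) (subst nn_integral_cmult[symmetric], auto simp: plen_def power_add ennreal_mult)
  also have "\<dots> = S * S" unfolding S_def by (rule nn_integral_multc) simp
  also have "\<dots> < \<infinity>"
    using geom_summable_mlen e unfolding geom_summable_def S_def by (auto simp: ennreal_mult_less_top)
  finally show "(\<integral>\<^sup>+i. ennreal (e ^ plen i) \<partial>count_space (UNIV :: ('n mindex \<times> 'n mindex) set)) < \<infinity>" .
qed

lemma ennreal_inverse_le:
  assumes "u \<le> ennreal c * v" "0 < c"
  shows "inverse v \<le> ennreal c * inverse u"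
proof (cases "v = 0 \<or> v = top")
  case True
  then show ?thesis using assms by (auto simp: ennreal_mult_top)
next
  case False
  then obtain s where s: "v = ennreal s" "0 < s" by (cases v) auto
  have "ennreal c * inverse (ennreal c * v) \<le> ennreal c * inverse u"
    by (intro mult_left_mono ennreal_inverse_antimono assms) simp
  moreover have "ennreal c * inverse (ennreal c * v) = inverse v"
    using s assms(2) by (simp add: ennreal_mult[symmetric] inverse_ennreal)
  ultimately show ?thesis by simp
qed

lemma strongly_dominated_inverse:
  assumes "strongly_dominated h u v"
  shows "strongly_dominated h (\<lambda>i. 1 / v i) (\<lambda>i. 1 / u i)"
proof -
  obtain C e where "C > 0" "0 < e" "e < 1" "\<And>i. u i \<le> ennreal (C * e ^ h i) * v i"
    using assms unfolding strongly_dominated_def by blast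
  then show ?thesis
    unfolding strongly_dominated_def divide_ennreal_def
    by (intro exI[of _ C] exI[of _ e] conjI allI) (auto intro: ennreal_inverse_le)
qed

lemma strongly_dominated_divide:
  assumes "strongly_dominated mlen u v" "strongly_dominated mlen u' v'"
  shows "strongly_dominated plen (\<lambda>(\<alpha>, \<beta>). u \<alpha> / v' \<beta>) (\<lambda>(\<alpha>, \<beta>). v \<alpha> / u' \<beta>)"
    and "strongly_dominated plen (\<lambda>(\<alpha>, \<beta>). u \<beta> / v' \<alpha>) (\<lambda>(\<alpha>, \<beta>). v \<beta> / u' \<alpha>)"
proof -
  obtain C e where C: "C > 0" "0 < e" "e < 1" "\<And>i. u i \<le> ennreal (C * e ^ mlen i) * v i"
    using assms(1) unfolding strongly_dominated_def by blast
  obtain D d where D: "D > 0" "0 < d" "d < 1" "\<And>i. u' i \<le> ennreal (D * d ^ mlen i) * v' i"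
    using assms(2) unfolding strongly_dominated_def by blast
  \<comment> \<open>The larger ratio gives one geometric factor in the total degree of the
    pair.\<close>
  let ?m = "max e d"
  have *: "u \<alpha> / v' \<beta> \<le> ennreal (C * D * ?m ^ (mlen \<alpha> + mlen \<beta>)) * (v \<alpha> / u' \<beta>)" for \<alpha> \<beta>
  proof -
    have "u \<alpha> / v' \<beta> \<le> (ennreal (C * e ^ mlen \<alpha>) * v \<alpha>) * (ennreal (D * d ^ mlen \<beta>) * inverse (u' \<beta>))"
      unfolding divide_ennreal_def using D by (intro mult_mono C(4) ennreal_inverse_le) auto
    also have "\<dots> = ennreal (C * D * (e ^ mlen \<alpha> * d ^ mlen \<beta>)) * (v \<alpha> / u' \<beta>)"
      using C D by (simp add: ennreal_mult divide_ennreal_def ac_simps)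
    also have "\<dots> \<le> ennreal (C * D * ?m ^ (mlen \<alpha> + mlen \<beta>)) * (v \<alpha> / u' \<beta>)"
      unfolding power_add using C D by (intro mult_right_mono ennreal_leI mult_left_mono mult_mono power_mono) auto
    finally show ?thesis .
  qed
  have **: "u \<beta> / v' \<alpha> \<le> ennreal (C * D * ?m ^ (mlen \<alpha> + mlen \<beta>)) * (v \<beta> / u' \<alpha>)" for \<alpha> \<beta>
    using *[of \<beta> \<alpha>] by (simp only: add.commute)
  have CD: "0 < C * D" "0 < ?m" "?m < 1" using C D by auto
  show "strongly_dominated plen (\<lambda>(\<alpha>, \<beta>). u \<alpha> / v' \<beta>) (\<lambda>(\<alpha>, \<beta>). v \<alpha> / u' \<beta>)"
    unfolding strongly_dominated_def using * CD
    by (intro exI[of _ "C * D"] exI[of _ ?m]) (auto simp: plen_def)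
  show "strongly_dominated plen (\<lambda>(\<alpha>, \<beta>). u \<beta> / v' \<alpha>) (\<lambda>(\<alpha>, \<beta>). v \<beta> / u' \<alpha>)"
    unfolding strongly_dominated_def using ** CD
    by (intro exI[of _ "C * D"] exI[of _ ?m]) (auto simp: plen_def)
qed

lemma greaterThan_not_empty: "{0::real<..} \<noteq> {}"
proof -
  have "1 \<in> {0::real<..}" by simp
  then show ?thesis by blast
qed

text \<open>A sequence is extracted because the continuous parameter runs in different directions:
  for \<open>vartheta\<close> it decreases to \<open>0\<close> at nonzero indices and increases at
  the index \<open>0\<close>, and for \<open>1 / vartheta\<close> it increases. In each case the
  weights decrease along the sequence.\<close>

locale cofinal_weights = weight_system \<theta> for \<theta> :: "nat \<Rightarrow> ('n::finite) mindex \<Rightarrow> ennreal" +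
  fixes \<eta> :: "real \<Rightarrow> 'n mindex \<Rightarrow> ennreal"
  assumes below: "0 < r \<Longrightarrow> \<exists>n. strongly_dominated mlen (\<theta> n) (\<eta> r)"
    and above: "\<exists>r>0. strongly_dominated mlen (\<eta> r) (\<theta> n)"
begin

lemma ind_lim_decay:
  assumes p: "0 < p"
  shows "ind_lim {0<..} (\<lambda>r. wlp p (\<eta> r)) = kothe_top (LE (\<lambda>n m. \<theta> n)) (LP (\<lambda>n m. \<theta> n))"
proof -
  have "ind_lim {0<..} (\<lambda>r. proj_lim {0::real<..} (\<lambda>_. wlp p (\<eta> r))) = kothe_top (LE (\<lambda>n m. \<theta> n)) (LP (\<lambda>n m. \<theta> n))"
  proof (rule ind_proj_wlp_eq_kothe[OF lf_weights_decay greaterThan_not_empty geom_summable_mlen p])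
    fix r :: real assume "r \<in> {0<..}"
    then obtain n where "strongly_dominated mlen (\<theta> n) (\<eta> r)" using below by auto
    then show "\<exists>n. \<forall>m::nat. \<exists>r'\<in>{0::real<..}. strongly_dominated mlen (\<theta> n) (\<eta> r)"
      using greaterThan_not_empty by blast
  next
    fix n
    obtain r where "r > 0" "strongly_dominated mlen (\<eta> r) (\<theta> n)" using above by blast
    then show "\<exists>r\<in>{0<..}. \<forall>r'\<in>{0::real<..}. \<exists>m::nat. strongly_dominated mlen (\<eta> r) (\<theta> n)"
      by auto
  qed
  then show ?thesis by (simp add: proj_lim_const[OF greaterThan_not_empty])
qed

lemma proj_lim_growth:
  assumes p: "0 < p"
  shows "proj_lim {0<..} (\<lambda>r. wlp p (\<lambda>\<alpha>. 1 / \<eta> r \<alpha>)) =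
    kothe_top (LE (\<lambda>n m \<alpha>. 1 / \<theta> m \<alpha>)) (LP (\<lambda>n m \<alpha>. 1 / \<theta> m \<alpha>))"
proof -
  show ?thesis
  proof (rule proj_lim_wlp_eq_kothe[OF lf_weights_growth greaterThan_not_empty geom_summable_mlen p])
    fix m
    show "\<exists>r\<in>{0<..}. strongly_dominated mlen (\<lambda>\<alpha>. 1 / \<theta> m \<alpha>) (\<lambda>\<alpha>. 1 / \<eta> r \<alpha>)"
      using above[of m] strongly_dominated_inverse by blast
  next
    fix r :: real assume "r \<in> {0<..}"
    then show "\<exists>m. strongly_dominated mlen (\<lambda>\<alpha>. 1 / \<eta> r \<alpha>) (\<lambda>\<alpha>. 1 / \<theta> m \<alpha>)"
      using below[of r] strongly_dominated_inverse by auto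
  qed
qed

lemma ind_lim_decay_symb:
  assumes p: "0 < p"
  shows "ind_lim {0<..} (\<lambda>r. proj_lim {0<..} (\<lambda>r'. wlp p (\<lambda>(\<alpha>, \<beta>). \<eta> r \<alpha> / \<eta> r' \<beta>))) =
    kothe_top (LE decay_symb) (LP decay_symb)"
proof -
  show ?thesis
  proof (rule ind_proj_wlp_eq_kothe[OF lf_weights_decay_symb greaterThan_not_empty geom_summable_plen p])
    fix r :: real assume "r \<in> {0<..}"
    then obtain n where n: "strongly_dominated mlen (\<theta> n) (\<eta> r)" using below by auto
    show "\<exists>n. \<forall>m. \<exists>r'\<in>{0<..}. strongly_dominated plen (decay_symb n m) (\<lambda>(\<alpha>, \<beta>). \<eta> r \<alpha> / \<eta> r' \<beta>)"
      unfolding decay_symb_def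
    proof (intro exI allI)
      fix m
      obtain r' where "r' > 0" "strongly_dominated mlen (\<eta> r') (\<theta> m)" using above by blast
      then show "\<exists>r'\<in>{0<..}. strongly_dominated plen (\<lambda>(\<alpha>, \<beta>). \<theta> n \<alpha> / \<theta> m \<beta>) (\<lambda>(\<alpha>, \<beta>). \<eta> r \<alpha> / \<eta> r' \<beta>)"
        by (intro bexI[of _ r'] strongly_dominated_divide(1)[OF n]) auto
    qed
  next
    fix n
    obtain r where r: "r > 0" "strongly_dominated mlen (\<eta> r) (\<theta> n)" using above by blast
    show "\<exists>r\<in>{0<..}. \<forall>r'\<in>{0<..}. \<exists>m. strongly_dominated plen (\<lambda>(\<alpha>, \<beta>). \<eta> r \<alpha> / \<eta> r' \<beta>) (decay_symb n m)"
      unfolding decay_symb_def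
    proof (intro bexI[of _ r] ballI)
      fix r' :: real assume "r' \<in> {0<..}"
      then obtain m where "strongly_dominated mlen (\<theta> m) (\<eta> r')" using below by auto
      then show "\<exists>m. strongly_dominated plen (\<lambda>(\<alpha>, \<beta>). \<eta> r \<alpha> / \<eta> r' \<beta>) (\<lambda>(\<alpha>, \<beta>). \<theta> n \<alpha> / \<theta> m \<beta>)"
        using strongly_dominated_divide(1)[OF r(2)] by blast
    qed (use r in simp)
  qed
qed

lemma ind_lim_growth_symb:
  assumes p: "0 < p"
  shows "ind_lim {0<..} (\<lambda>r. proj_lim {0<..} (\<lambda>r'. wlp p (\<lambda>(\<alpha>, \<beta>). \<eta> r \<beta> / \<eta> r' \<alpha>))) =
    kothe_top (LE growth_symb) (LP growth_symb)"
proof -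
  show ?thesis
  proof (rule ind_proj_wlp_eq_kothe[OF lf_weights_growth_symb greaterThan_not_empty geom_summable_plen p])
    fix r :: real assume "r \<in> {0<..}"
    then obtain n where n: "strongly_dominated mlen (\<theta> n) (\<eta> r)" using below by auto
    show "\<exists>n. \<forall>m. \<exists>r'\<in>{0<..}. strongly_dominated plen (growth_symb n m) (\<lambda>(\<alpha>, \<beta>). \<eta> r \<beta> / \<eta> r' \<alpha>)"
      unfolding growth_symb_def
    proof (intro exI allI)
      fix m
      obtain r' where "r' > 0" "strongly_dominated mlen (\<eta> r') (\<theta> m)" using above by blast
      then show "\<exists>r'\<in>{0<..}. strongly_dominated plen (\<lambda>(\<alpha>, \<beta>). \<theta> n \<beta> / \<theta> m \<alpha>) (\<lambda>(\<alpha>, \<beta>). \<eta> r \<beta> / \<eta> r' \<alpha>)"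
        by (intro bexI[of _ r'] strongly_dominated_divide(2)[OF n]) auto
    qed
  next
    fix n
    obtain r where r: "r > 0" "strongly_dominated mlen (\<eta> r) (\<theta> n)" using above by blast
    show "\<exists>r\<in>{0<..}. \<forall>r'\<in>{0<..}. \<exists>m. strongly_dominated plen (\<lambda>(\<alpha>, \<beta>). \<eta> r \<beta> / \<eta> r' \<alpha>) (growth_symb n m)"
      unfolding growth_symb_def
    proof (intro bexI[of _ r] ballI)
      fix r' :: real assume "r' \<in> {0<..}"
      then obtain m where "strongly_dominated mlen (\<theta> m) (\<eta> r')" using below by auto
      then show "\<exists>m. strongly_dominated plen (\<lambda>(\<alpha>, \<beta>). \<eta> r \<beta> / \<eta> r' \<alpha>) (\<lambda>(\<alpha>, \<beta>). \<theta> n \<beta> / \<theta> m \<alpha>)"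
        using strongly_dominated_divide(2)[OF r(2)] by blast
    qed (use r in simp)
  qed
qed

theorem uniquely_extendable_decay:
  assumes "0 < p" and T0: "\<And>a f. a \<in> fin_families \<Longrightarrow> f \<in> fin_families \<Longrightarrow> T0 (a, f) = kop toep a f"
  shows "uniquely_extendable (fin_families \<times> fin_families) T0
    (ind_lim {0<..} (\<lambda>r. proj_lim {0<..} (\<lambda>r'. wlp p (\<lambda>(\<alpha>, \<beta>). \<eta> r \<alpha> / \<eta> r' \<beta>))))
    (ind_lim {0<..} (\<lambda>r. wlp p (\<eta> r))) (ind_lim {0<..} (\<lambda>r. wlp p (\<eta> r)))"
  unfolding ind_lim_decay[OF assms(1)] ind_lim_decay_symb[OF assms(1)]
  by (rule kernel_operator.uniquely_extendable_kop[OF kernel_operator_decay T0])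

theorem uniquely_extendable_growth:
  assumes "0 < p" and T0: "\<And>a f. a \<in> fin_families \<Longrightarrow> f \<in> fin_families \<Longrightarrow> T0 (a, f) = kop toep a f"
  shows "uniquely_extendable (fin_families \<times> fin_families) T0
    (ind_lim {0<..} (\<lambda>r. proj_lim {0<..} (\<lambda>r'. wlp p (\<lambda>(\<alpha>, \<beta>). \<eta> r \<beta> / \<eta> r' \<alpha>))))
    (proj_lim {0<..} (\<lambda>r. wlp p (\<lambda>\<alpha>. 1 / \<eta> r \<alpha>))) (proj_lim {0<..} (\<lambda>r. wlp p (\<lambda>\<alpha>. 1 / \<eta> r \<alpha>)))"
  unfolding proj_lim_growth[OF assms(1)] ind_lim_growth_symb[OF assms(1)]
  by (rule kernel_operator.uniquely_extendable_kop[OF kernel_operator_growth T0])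

end

section \<open>Finite weights with a continuous parameter\<close>

locale real_weights =
  fixes v :: "real \<Rightarrow> ('n::finite) mindex \<Rightarrow> real"
  assumes v_pos: "0 < r \<Longrightarrow> 0 < v r \<alpha>"
    and v_less: "0 < r' \<Longrightarrow> r' < r \<Longrightarrow> \<exists>e. 0 < e \<and> e < 1 \<and> (\<forall>\<alpha>. v r' \<alpha> \<le> e ^ mlen \<alpha> * v r \<alpha>)"
begin

lemma v_mono:
  assumes "0 < r'" "r' \<le> r" shows "v r' \<alpha> \<le> v r \<alpha>"
proof (cases "r' = r")
  case False
  then obtain e where e: "0 < e" "e < 1" "\<forall>\<alpha>. v r' \<alpha> \<le> e ^ mlen \<alpha> * v r \<alpha>"
    using v_less[OF assms(1), of r] assms(2) by auto
  from e(3) have "v r' \<alpha> \<le> e ^ mlen \<alpha> * v r \<alpha>" ..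
  also have "\<dots> \<le> 1 * v r \<alpha>" using e v_pos[of r \<alpha>] assms by (intro mult_right_mono power_le_one) auto
  finally show ?thesis by simp
qed simp

lemma strongly_dominated_v:
  assumes "0 < r'" "r' < r"
  shows "strongly_dominated mlen (\<lambda>\<alpha>. ennreal (v r' \<alpha>)) (\<lambda>\<alpha>. ennreal (v r \<alpha>))"
proof -
  obtain e where e: "0 < e" "e < 1" "\<And>\<alpha>. v r' \<alpha> \<le> e ^ mlen \<alpha> * v r \<alpha>" using v_less assms by blast
  then have "ennreal (v r' \<alpha>) \<le> ennreal (1 * e ^ mlen \<alpha>) * ennreal (v r \<alpha>)" for \<alpha>
    using v_pos[of r \<alpha>] assms by (subst ennreal_mult[symmetric]) (auto intro: ennreal_leI)
  then show ?thesis unfolding strongly_dominated_def using e by (intro exI[of _ 1] exI[of _ e]) auto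
qed

text \<open>The offset in \<open>1 / (n + 1)\<close> keeps the parameters positive. The
  \<open>r'\<close> supplied by \<open>conv\<close> may be lowered to a parameter of this form
  because \<open>v\<close> is monotone in the parameter.\<close>

lemma cofinal_shrinking:
  assumes conv: "\<And>r. 0 < r \<Longrightarrow> \<exists>r'>0. \<exists>C>0. \<forall>\<alpha> \<beta> \<gamma> \<delta>. (\<forall>j. \<alpha> j + \<gamma> j = \<beta> j + \<delta> j) \<longrightarrow>
      2 ^ (mlen \<alpha> + mlen \<gamma>) * (v r' \<beta> * v r' \<delta>) \<le> C * (v r \<alpha> * v r \<gamma>)"
  shows "cofinal_weights (\<lambda>n \<alpha>. ennreal (v (1 / (real n + 1)) \<alpha>)) (\<lambda>r \<alpha>. ennreal (v r \<alpha>))"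
proof unfold_locales
  fix n m :: nat and \<alpha>
  show "0 < ennreal (v (1 / (real n + 1)) \<alpha>)" by (simp add: v_pos)
  show "\<exists>n. ennreal (v (1 / (real n + 1)) \<alpha>) < \<infinity>" by simp
  show "ennreal (v (1 / (real m + 1)) \<alpha>) \<le> ennreal (v (1 / (real n + 1)) \<alpha>)" if "n \<le> m"
    using that by (intro ennreal_leI v_mono) (auto simp: frac_le)
  have "1 / (real (Suc n) + 1) < 1 / (real n + 1)" by (simp add: field_simps)
  then show "\<exists>m. strongly_dominated mlen (\<lambda>\<alpha>. ennreal (v (1 / (real m + 1)) \<alpha>)) (\<lambda>\<alpha>. ennreal (v (1 / (real n + 1)) \<alpha>))"
    by (intro exI[of _ "Suc n"] strongly_dominated_v) auto
  from \<open>1 / (real (Suc n) + 1) < 1 / (real n + 1)\<close>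
  show "\<exists>r>0. strongly_dominated mlen (\<lambda>\<alpha>. ennreal (v r \<alpha>)) (\<lambda>\<alpha>. ennreal (v (1 / (real n + 1)) \<alpha>))"
    by (intro exI[of _ "1 / (real (Suc n) + 1)"] conjI strongly_dominated_v) auto
  define r where "r = 1 / (real n + 1)"
  have r: "0 < r" by (simp add: r_def)
  obtain r' C where C: "r' > 0" "C > 0" "\<And>\<alpha> \<beta> \<gamma> \<delta>. (\<forall>j. \<alpha> j + \<gamma> j = \<beta> j + \<delta> j) \<Longrightarrow>
      2 ^ (mlen \<alpha> + mlen \<gamma>) * (v r' \<beta> * v r' \<delta>) \<le> C * (v r \<alpha> * v r \<gamma>)"
    using conv[OF r] by blast
  obtain k where k: "inverse (real (Suc k)) < r'" using reals_Archimedean[OF C(1)] by blast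
  define t where "t = 1 / (real k + 1)"
  have t: "0 < t" "t < r'" using k by (auto simp: t_def inverse_eq_divide add.commute)
  have "ennreal (2 ^ (mlen \<alpha> + mlen \<gamma>)) * (ennreal (v t \<beta>) * ennreal (v t \<delta>)) \<le> ennreal C * (ennreal (v r \<alpha>) * ennreal (v r \<gamma>))"
    if eq: "\<forall>j. \<alpha> j + \<gamma> j = \<beta> j + \<delta> j" for \<alpha> \<beta> \<gamma> \<delta>
  proof -
    have "2 ^ (mlen \<alpha> + mlen \<gamma>) * (v t \<beta> * v t \<delta>) \<le> 2 ^ (mlen \<alpha> + mlen \<gamma>) * (v r' \<beta> * v r' \<delta>)"
      using t v_pos by (intro mult_left_mono mult_mono v_mono) (auto intro: less_imp_le)
    also have "\<dots> \<le> C * (v r \<alpha> * v r \<gamma>)" by (rule C(3)[OF eq])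
    finally have "ennreal (2 ^ (mlen \<alpha> + mlen \<gamma>) * (v t \<beta> * v t \<delta>)) \<le> ennreal (C * (v r \<alpha> * v r \<gamma>))" by (rule ennreal_leI)
    then show ?thesis using t r C(2) v_pos[THEN less_imp_le] by (simp add: ennreal_mult)
  qed
  then show "\<exists>m. \<exists>C>0. \<forall>\<alpha> \<beta> \<gamma> \<delta>. (\<forall>j. \<alpha> j + \<gamma> j = \<beta> j + \<delta> j) \<longrightarrow>
      ennreal (2 ^ (mlen \<alpha> + mlen \<gamma>)) * (ennreal (v (1 / (real m + 1)) \<beta>) * ennreal (v (1 / (real m + 1)) \<delta>))
      \<le> ennreal C * (ennreal (v (1 / (real n + 1)) \<alpha>) * ennreal (v (1 / (real n + 1)) \<gamma>))"
    using C(2) unfolding r_def t_def by blast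
next
  fix r :: real assume "0 < r"
  then obtain k where "inverse (real (Suc k)) < r" using reals_Archimedean by blast
  then show "\<exists>n. strongly_dominated mlen (\<lambda>\<alpha>. ennreal (v (1 / (real n + 1)) \<alpha>)) (\<lambda>\<alpha>. ennreal (v r \<alpha>))"
    by (intro exI[of _ k] strongly_dominated_v) (auto simp: inverse_eq_divide add.commute)
qed

text \<open>Reciprocals interchange the two sides of the convolution inequality. Hence
  \<open>conv\<close> may enlarge the parameter here, and it is used with the pairs
  \<open>\<alpha>\<close>, \<open>\<gamma>\<close> and \<open>\<beta>\<close>,
  \<open>\<delta>\<close> exchanged.\<close>

lemma cofinal_inverse:
  assumes conv: "\<And>r. 0 < r \<Longrightarrow> \<exists>r'>0. \<exists>C>0. \<forall>\<alpha> \<beta> \<gamma> \<delta>. (\<forall>j. \<alpha> j + \<gamma> j = \<beta> j + \<delta> j) \<longrightarrow>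
      2 ^ (mlen \<alpha> + mlen \<gamma>) * (v r \<beta> * v r \<delta>) \<le> C * (v r' \<alpha> * v r' \<gamma>)"
  shows "cofinal_weights (\<lambda>n \<alpha>. 1 / ennreal (v (real n + 1) \<alpha>)) (\<lambda>r \<alpha>. 1 / ennreal (v r \<alpha>))"
proof unfold_locales
  fix n m :: nat and \<alpha>
  show "0 < 1 / ennreal (v (real n + 1) \<alpha>)" by (simp add: ennreal_zero_less_divide)
  show "\<exists>n. 1 / ennreal (v (real n + 1) \<alpha>) < \<infinity>"
    by (auto intro!: ennreal_divide_finite simp: v_pos)
  show "1 / ennreal (v (real m + 1) \<alpha>) \<le> 1 / ennreal (v (real n + 1) \<alpha>)" if "n \<le> m"
    using that by (intro ennreal_divide_mono ennreal_leI v_mono) auto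
  show "\<exists>m. strongly_dominated mlen (\<lambda>\<alpha>. 1 / ennreal (v (real m + 1) \<alpha>)) (\<lambda>\<alpha>. 1 / ennreal (v (real n + 1) \<alpha>))"
    by (intro exI[of _ "Suc n"] strongly_dominated_inverse strongly_dominated_v) auto
  show "\<exists>r>0. strongly_dominated mlen (\<lambda>\<alpha>. 1 / ennreal (v r \<alpha>)) (\<lambda>\<alpha>. 1 / ennreal (v (real n + 1) \<alpha>))"
    by (intro exI[of _ "real n + 2"] conjI strongly_dominated_inverse strongly_dominated_v) auto
  define r where "r = real n + 1"
  have r: "0 < r" by (simp add: r_def)
  obtain r' C where C: "r' > 0" "C > 0" "\<And>\<alpha> \<beta> \<gamma> \<delta>. (\<forall>j. \<alpha> j + \<gamma> j = \<beta> j + \<delta> j) \<Longrightarrow>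
      2 ^ (mlen \<alpha> + mlen \<gamma>) * (v r \<beta> * v r \<delta>) \<le> C * (v r' \<alpha> * v r' \<gamma>)"
    using conv[OF r] by blast
  obtain k :: nat where k: "r' < real k" using reals_Archimedean2 by blast
  define t where "t = real k + 1"
  have t: "0 < t" "r' < t" using k by (auto simp: t_def)
  have one: "1 / ennreal x = ennreal (1 / x)" if "0 < x" for x
    using divide_ennreal[of 1 x] that by simp
  have "ennreal (2 ^ (mlen \<alpha> + mlen \<gamma>)) * (1 / ennreal (v t \<beta>) * (1 / ennreal (v t \<delta>)))
      \<le> ennreal C * (1 / ennreal (v r \<alpha>) * (1 / ennreal (v r \<gamma>)))"
    if eq: "\<forall>j. \<alpha> j + \<gamma> j = \<beta> j + \<delta> j" for \<alpha> \<beta> \<gamma> \<delta>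
  proof -
    have len: "mlen \<beta> + mlen \<delta> = mlen \<alpha> + mlen \<gamma>" using eq by (simp add: mlen_add[symmetric])
    have "2 ^ (mlen \<alpha> + mlen \<gamma>) * (v r \<alpha> * v r \<gamma>) \<le> C * (v r' \<beta> * v r' \<delta>)"
      using C(3)[of \<beta> \<delta> \<alpha> \<gamma>] eq len by simp
    also have "\<dots> \<le> C * (v t \<beta> * v t \<delta>)"
      using C t v_pos by (intro mult_left_mono mult_mono v_mono) (auto intro: less_imp_le)
    finally have "2 ^ (mlen \<alpha> + mlen \<gamma>) * (v r \<alpha> * v r \<gamma>) \<le> C * (v t \<beta> * v t \<delta>)" .
    then have "2 ^ (mlen \<alpha> + mlen \<gamma>) * ((1 / v t \<beta>) * (1 / v t \<delta>)) \<le> C * ((1 / v r \<alpha>) * (1 / v r \<gamma>))"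
      using v_pos[OF t(1)] v_pos[OF r] by (simp add: field_simps)
    then have "ennreal (2 ^ (mlen \<alpha> + mlen \<gamma>) * ((1 / v t \<beta>) * (1 / v t \<delta>))) \<le> ennreal (C * ((1 / v r \<alpha>) * (1 / v r \<gamma>)))"
      by (rule ennreal_leI)
    then show ?thesis
      unfolding one[OF v_pos[OF t(1)]] one[OF v_pos[OF r]]
      using C(2) v_pos[OF t(1), THEN less_imp_le] v_pos[OF r, THEN less_imp_le]
      by (simp only: ennreal_mult zero_le_power zero_le_numeral zero_le_mult_iff zero_le_divide_1_iff less_imp_le simp_thms)
  qed
  then show "\<exists>m. \<exists>C>0. \<forall>\<alpha> \<beta> \<gamma> \<delta>. (\<forall>j. \<alpha> j + \<gamma> j = \<beta> j + \<delta> j) \<longrightarrow>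
      ennreal (2 ^ (mlen \<alpha> + mlen \<gamma>)) * (1 / ennreal (v (real m + 1) \<beta>) * (1 / ennreal (v (real m + 1) \<delta>)))
      \<le> ennreal C * (1 / ennreal (v (real n + 1) \<alpha>) * (1 / ennreal (v (real n + 1) \<gamma>)))"
    using C(2) unfolding r_def t_def by blast
next
  fix r :: real assume "0 < r"
  obtain k :: nat where "r < real k" using reals_Archimedean2 by blast
  then show "\<exists>n. strongly_dominated mlen (\<lambda>\<alpha>. 1 / ennreal (v (real n + 1) \<alpha>)) (\<lambda>\<alpha>. 1 / ennreal (v r \<alpha>))"
    using \<open>0 < r\<close> by (intro exI[of _ k] strongly_dominated_inverse strongly_dominated_v) auto
qed

end

section \<open>The concrete weights\<close>

definition exp_weight :: "real \<Rightarrow> real \<Rightarrow> ('n::finite) mindex \<Rightarrow> real" where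
  "exp_weight q r \<alpha> = exp (r * real (mlen \<alpha>) powr q)"

definition fact_weight :: "real \<Rightarrow> real \<Rightarrow> ('n::finite) mindex \<Rightarrow> real" where
  "fact_weight t r \<alpha> = r ^ mlen \<alpha> * mfact \<alpha> powr t"

lemma nat_le_powr: "1 \<le> q \<Longrightarrow> real n \<le> real n powr q"
  using powr_mono[of 1 q "real n"] by (cases "n = 0") auto

text \<open>For \<open>q \<ge> 1\<close> the gain \<open>(r - r') * N powr q\<close> in the exponent
  at degree \<open>N\<close> is at least \<open>(r - r') * N\<close>, which provides the ratio
  \<open>exp (- (r - r'))\<close>.\<close>

lemma real_weights_exp:
  assumes q: "1 \<le> q"
  shows "real_weights (exp_weight q :: real \<Rightarrow> ('n::finite) mindex \<Rightarrow> real)"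
proof
  fix r :: real and \<alpha> :: "'n mindex" show "0 < exp_weight q r \<alpha>" by (simp add: exp_weight_def)
next
  fix r' r :: real assume r: "0 < r'" "r' < r"
  have "exp_weight q r' \<alpha> \<le> exp (- (r - r')) ^ mlen \<alpha> * exp_weight q r \<alpha>" for \<alpha> :: "'n mindex"
  proof -
    have "(r - r') * real (mlen \<alpha>) \<le> (r - r') * real (mlen \<alpha>) powr q"
      using r nat_le_powr[OF q] by (intro mult_left_mono) auto
    then have "r' * real (mlen \<alpha>) powr q \<le> real (mlen \<alpha>) * (- (r - r')) + r * real (mlen \<alpha>) powr q"
      by (simp add: algebra_simps)
    then show ?thesis
      by (simp add: exp_weight_def exp_of_nat_mult[symmetric] exp_add[symmetric])
  qed
  then show "\<exists>e. 0 < e \<and> e < 1 \<and> (\<forall>\<alpha> :: 'n mindex. exp_weight q r' \<alpha> \<le> e ^ mlen \<alpha> * exp_weight q r \<alpha>)"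
    using r by (intro exI[of _ "exp (- (r - r'))"]) auto
qed

lemma real_weights_fact:
  "real_weights (fact_weight t :: real \<Rightarrow> ('n::finite) mindex \<Rightarrow> real)"
proof
  fix r :: real and \<alpha> :: "'n mindex" assume "0 < r"
  then show "0 < fact_weight t r \<alpha>" using mfact_pos[of \<alpha>] by (simp add: fact_weight_def)
next
  fix r' r :: real assume r: "0 < r'" "r' < r"
  have "fact_weight t r' \<alpha> \<le> (r' / r) ^ mlen \<alpha> * fact_weight t r \<alpha>" for \<alpha> :: "'n mindex"
    using r by (simp add: fact_weight_def power_divide)
  then show "\<exists>e. 0 < e \<and> e < 1 \<and> (\<forall>\<alpha> :: 'n mindex. fact_weight t r' \<alpha> \<le> e ^ mlen \<alpha> * fact_weight t r \<alpha>)"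
    using r by (intro exI[of _ "r' / r"]) auto
qed

lemma mindex_sum_eq_mlen:
  assumes "\<forall>j. \<alpha> j + \<gamma> j = \<beta> j + (\<delta> j :: nat)"
  shows "mlen \<beta> + mlen \<delta> = mlen \<alpha> + mlen \<gamma>"
  using assms by (simp add: mlen_add[symmetric])

text \<open>Both \<open>b\<close> and \<open>d\<close> are at most the sum, and the larger of
  \<open>a\<close> and \<open>c\<close> is at least half of it; the constants \<open>2\<close> and
  \<open>2 powr - q\<close> record this.\<close>

lemma powr_split_le:
  assumes "1 \<le> q" "b + d = a + (c :: nat)"
  shows "real b powr q + real d powr q \<le> 2 * real (a + c) powr q"
    and "2 powr - q * real (a + c) powr q \<le> real a powr q + real c powr q"
proof -
  have "real b powr q \<le> real (a + c) powr q" "real d powr q \<le> real (a + c) powr q"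
    using assms by (intro powr_mono2; simp)+
  then show "real b powr q + real d powr q \<le> 2 * real (a + c) powr q" by simp
  have "real (a + c) / 2 \<le> real (max a c)" by auto
  then have "(real (a + c) / 2) powr q \<le> real (max a c) powr q"
    using assms by (intro powr_mono2) auto
  also have "\<dots> \<le> real a powr q + real c powr q" by (cases "a \<le> c") auto
  finally show "2 powr - q * real (a + c) powr q \<le> real a powr q + real c powr q"
    by (simp add: powr_divide powr_minus field_simps)
qed

text \<open>Logarithms turn the claim into the scalar inequality \<open>bound\<close>, into which
  the four degrees enter only through their common sum.\<close>

lemma exp_weight_convolution:
  assumes q: "1 \<le> q" and r: "0 < r" "0 < r'" and C: "0 < C"
    and bound: "\<And>N. real N * ln 2 + 2 * r' * real N powr q \<le> ln C + r * 2 powr - q * real N powr q"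
    and eq: "\<forall>j. \<alpha> j + \<gamma> j = \<beta> j + \<delta> j"
  shows "2 ^ (mlen \<alpha> + mlen \<gamma>) * (exp_weight q r' \<beta> * exp_weight q r' \<delta>) \<le> C * (exp_weight q r \<alpha> * exp_weight q r \<gamma>)"
proof -
  let ?N = "mlen \<alpha> + mlen \<gamma>"
  have len: "mlen \<beta> + mlen \<delta> = ?N" by (rule mindex_sum_eq_mlen[OF eq])
  note ps = powr_split_le[OF q len]
  have "r' * (real (mlen \<beta>) powr q + real (mlen \<delta>) powr q) \<le> r' * (2 * real ?N powr q)"
    using r by (intro mult_left_mono ps) auto
  moreover have "r * (2 powr - q * real ?N powr q) \<le> r * (real (mlen \<alpha>) powr q + real (mlen \<gamma>) powr q)"
    using r by (intro mult_left_mono ps) auto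
  ultimately have "real ?N * ln 2 + r' * (real (mlen \<beta>) powr q + real (mlen \<delta>) powr q)
      \<le> ln C + r * (real (mlen \<alpha>) powr q + real (mlen \<gamma>) powr q)"
    using bound[of ?N] by (simp only: mult.assoc)
  then have "exp (real ?N * ln 2 + r' * (real (mlen \<beta>) powr q + real (mlen \<delta>) powr q))
      \<le> exp (ln C + r * (real (mlen \<alpha>) powr q + real (mlen \<gamma>) powr q))" by simp
  moreover have "exp (real ?N * ln 2) = (2::real) ^ ?N" by (subst exp_of_nat_mult) simp
  ultimately show ?thesis
    using C by (simp only: exp_add distrib_left exp_weight_def exp_ln mult.assoc)
qed

lemma exp_weight_conv_shrink:
  assumes q: "1 < q" and r: "0 < r"
  shows "\<exists>r'>0. \<exists>C>0. \<forall>\<alpha> \<beta> \<gamma> (\<delta> :: ('n::finite) mindex). (\<forall>j. \<alpha> j + \<gamma> j = \<beta> j + \<delta> j) \<longrightarrow>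
    2 ^ (mlen \<alpha> + mlen \<gamma>) * (exp_weight q r' \<beta> * exp_weight q r' \<delta>) \<le> C * (exp_weight q r \<alpha> * exp_weight q r \<gamma>)"
proof -
  \<comment> \<open>Half of the available exponent \<open>r * 2 powr - q\<close> is kept for the two
    weights on the left, with parameter \<open>c / 2\<close> each, and half for the kernel
    factor.\<close>
  define c where "c = r * 2 powr - q / 2"
  have c: "0 < c" using r by (simp add: c_def)
  \<comment> \<open>\<open>K\<close> solves \<open>c * K powr (q - 1) = ln 2\<close>. Above it
    \<open>c * N powr q\<close> is at least \<open>N * ln 2\<close>; below it the constant
    \<open>exp (K * ln 2)\<close> pays. The exponent \<open>1 / (q - 1)\<close> is where
    \<open>q > 1\<close> enters.\<close>
  define K where "K = (ln 2 / c) powr (1 / (q - 1))"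
  have bound: "real N * ln 2 + 2 * (c / 2) * real N powr q \<le> ln (exp (K * ln 2)) + r * 2 powr - q * real N powr q" for N
  proof -
    have "real N * ln 2 \<le> K * ln 2 + c * real N powr q"
    proof (cases "real N \<le> K")
      case True
      have "real N * ln 2 \<le> K * ln 2" using True by (intro mult_right_mono) auto
      moreover have "0 \<le> c * real N powr q" using c by simp
      ultimately show ?thesis by linarith
    next
      case False
      have K: "0 \<le> K" by (simp add: K_def)
      have "ln 2 / c = K powr (q - 1)" using q c by (simp add: K_def powr_powr)
      also have "\<dots> \<le> real N powr (q - 1)" using False q K by (intro powr_mono2) auto
      finally have "ln 2 \<le> c * real N powr (q - 1)" using c by (simp add: field_simps)
      then have "real N * ln 2 \<le> real N * (c * real N powr (q - 1))" by (intro mult_left_mono) auto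
      also have "\<dots> = c * (real N powr 1 * real N powr (q - 1))" by simp
      also have "\<dots> = c * real N powr q" by (simp only: powr_add[symmetric]) simp
      finally show ?thesis using K by (smt (verit) ln_ge_zero mult_nonneg_nonneg)
    qed
    moreover have "r * 2 powr - q * real N powr q = 2 * (c * real N powr q)" by (simp add: c_def)
    ultimately have "real N * ln 2 + c * real N powr q \<le> K * ln 2 + r * 2 powr - q * real N powr q" by linarith
    then show ?thesis by simp
  qed
  have "0 < c / 2" "0 < exp (K * ln 2)" using c by auto
  then show ?thesis
    using exp_weight_convolution[OF less_imp_le[OF q] r _ _ bound] by blast
qed

lemma exp_weight_conv_expand:
  assumes q: "1 \<le> q" and r: "0 < r"
  shows "\<exists>r'>0. \<exists>C>0. \<forall>\<alpha> \<beta> \<gamma> (\<delta> :: ('n::finite) mindex). (\<forall>j. \<alpha> j + \<gamma> j = \<beta> j + \<delta> j) \<longrightarrow>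
    2 ^ (mlen \<alpha> + mlen \<gamma>) * (exp_weight q r \<beta> * exp_weight q r \<delta>) \<le> C * (exp_weight q r' \<alpha> * exp_weight q r' \<gamma>)"
proof -
  \<comment> \<open>Chosen so that \<open>r' * 2 powr - q = 2 * r + ln 2\<close>; since
    \<open>N \<le> N powr q\<close>, this pays for the weights as well as for the kernel, with
    \<open>C = 1\<close>.\<close>
  define r' where "r' = 2 powr q * (2 * r + ln 2)"
  have r': "0 < r'" using r by (simp add: r'_def add_pos_pos)
  have "real N * ln 2 + 2 * r * real N powr q \<le> ln 1 + r' * 2 powr - q * real N powr q" for N
  proof -
    have "real N * ln 2 \<le> real N powr q * ln 2" by (intro mult_right_mono nat_le_powr q) auto
    moreover have "r' * 2 powr - q = 2 * r + ln 2" by (simp add: r'_def powr_minus)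
    ultimately show ?thesis by (simp add: algebra_simps)
  qed
  from exp_weight_convolution[OF q r' r zero_less_one this] r' show ?thesis
    using zero_less_one by blast
qed

text \<open>With \<open>N\<close> the common degree, \<open>\<beta>! \<delta>! \<le> (\<beta> +
  \<delta>)! = (\<alpha> + \<gamma>)! \<le> 2^N \<alpha>! \<gamma>!\<close>, so the power
  \<open>t\<close> of the factorials loses only \<open>(2 powr t) ^ N\<close>. Together with the
  kernel factor this is geometric and is absorbed by scaling \<open>r\<close> with
  \<open>2 * 2 powr t\<close>.\<close>

lemma fact_weight_convolution:
  assumes t: "0 \<le> t" and r: "0 < r" and eq: "\<forall>j. \<alpha> j + \<gamma> j = \<beta> j + \<delta> j"
  shows "2 ^ (mlen \<alpha> + mlen \<gamma>) * (fact_weight t r \<beta> * fact_weight t r \<delta>)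
    \<le> 1 * (fact_weight t (2 * 2 powr t * r) \<alpha> * fact_weight t (2 * 2 powr t * r) \<gamma>)"
proof -
  let ?N = "mlen \<alpha> + mlen \<gamma>"
  have len: "mlen \<beta> + mlen \<delta> = ?N" by (rule mindex_sum_eq_mlen[OF eq])
  have "mfact \<beta> * mfact \<delta> \<le> mfact (\<lambda>j. \<beta> j + \<delta> j)" by (rule mfact_mult_le)
  also have "(\<lambda>j. \<beta> j + \<delta> j) = (\<lambda>j. \<alpha> j + \<gamma> j)" using eq by auto
  also have "mfact (\<lambda>j. \<alpha> j + \<gamma> j) \<le> 2 ^ ?N * (mfact \<alpha> * mfact \<gamma>)" by (rule mfact_add_le)
  finally have "(mfact \<beta> * mfact \<delta>) powr t \<le> (2 ^ ?N * (mfact \<alpha> * mfact \<gamma>)) powr t"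
    using t mfact_pos[of \<beta>] mfact_pos[of \<delta>] by (intro powr_mono2) auto
  also have "\<dots> = (2 powr t) ^ ?N * (mfact \<alpha> powr t * mfact \<gamma> powr t)"
    using mfact_pos[of \<alpha>] mfact_pos[of \<gamma>]
    by (simp add: powr_mult powr_realpow[symmetric] powr_powr mult.commute)
  finally have *: "mfact \<beta> powr t * mfact \<delta> powr t \<le> (2 powr t) ^ ?N * (mfact \<alpha> powr t * mfact \<gamma> powr t)"
    using mfact_pos[of \<beta>] mfact_pos[of \<delta>] by (simp add: powr_mult)
  have "2 ^ ?N * (fact_weight t r \<beta> * fact_weight t r \<delta>) = 2 ^ ?N * r ^ ?N * (mfact \<beta> powr t * mfact \<delta> powr t)"
    unfolding fact_weight_def len[symmetric] by (simp add: power_add)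
  also have "\<dots> \<le> 2 ^ ?N * r ^ ?N * ((2 powr t) ^ ?N * (mfact \<alpha> powr t * mfact \<gamma> powr t))"
    using r by (intro mult_left_mono *) auto
  also have "\<dots> = 1 * (fact_weight t (2 * 2 powr t * r) \<alpha> * fact_weight t (2 * 2 powr t * r) \<gamma>)"
    by (simp add: fact_weight_def power_add power_mult_distrib)
  finally show ?thesis .
qed

lemma fact_weight_conv_expand:
  assumes t: "0 \<le> t" and r: "0 < r"
  shows "\<exists>r'>0. \<exists>C>0. \<forall>\<alpha> \<beta> \<gamma> (\<delta> :: ('n::finite) mindex). (\<forall>j. \<alpha> j + \<gamma> j = \<beta> j + \<delta> j) \<longrightarrow>
    2 ^ (mlen \<alpha> + mlen \<gamma>) * (fact_weight t r \<beta> * fact_weight t r \<delta>) \<le> C * (fact_weight t r' \<alpha> * fact_weight t r' \<gamma>)"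
proof -
  have "0 < 2 * 2 powr t * r" using r by simp
  then show ?thesis using fact_weight_convolution[OF t r] zero_less_one by blast
qed

lemma fact_weight_conv_shrink:
  assumes t: "0 \<le> t" and r: "0 < r"
  shows "\<exists>r'>0. \<exists>C>0. \<forall>\<alpha> \<beta> \<gamma> (\<delta> :: ('n::finite) mindex). (\<forall>j. \<alpha> j + \<gamma> j = \<beta> j + \<delta> j) \<longrightarrow>
    2 ^ (mlen \<alpha> + mlen \<gamma>) * (fact_weight t r' \<beta> * fact_weight t r' \<delta>) \<le> C * (fact_weight t r \<alpha> * fact_weight t r \<gamma>)"
proof -
  define r' where "r' = r / (2 * 2 powr t)"
  have r': "0 < r'" "2 * 2 powr t * r' = r" using r by (auto simp: r'_def)
  show ?thesis using fact_weight_convolution[OF t r'(1)] zero_less_one r' by metis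
qed

section \<open>The weights \<open>vartheta\<close>, with the index zero apart\<close>

lemma vartheta_eq_exp_weight:
  "x \<noteq> 0 \<Longrightarrow> vartheta r (Num x) = (\<lambda>\<alpha>. ennreal (exp_weight (1 / (2 * x)) r \<alpha>))"
  by (simp add: vartheta_def exp_weight_def fun_eq_iff)

lemma vartheta_eq_fact_weight:
  "vartheta r (Flat \<sigma>) = (\<lambda>\<alpha>. ennreal (fact_weight (1 / (2 * \<sigma>)) r \<alpha>))"
  by (simp add: vartheta_def fact_weight_def fun_eq_iff)

lemma vartheta_0: "vartheta r (Num 0) \<alpha> = (if real (mlen \<alpha>) \<le> r then 1 else \<infinity>)"
  by (simp add: vartheta_def)

text \<open>Where the right-hand weight is finite the degree is at most a fixed \<open>k\<close>, so
  \<open>2 ^ k * (1 / 2) ^ mlen \<alpha>\<close> is at least \<open>1\<close>; elsewhere the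
  right-hand side is infinite. The geometric factor is thus free, even for
  \<open>r = r'\<close>.\<close>

lemma strongly_dominated_vartheta_0:
  assumes "r \<le> r'"
  shows "strongly_dominated mlen (vartheta r' (Num 0) :: ('n::finite) mindex \<Rightarrow> ennreal) (vartheta r (Num 0))"
proof -
  obtain k :: nat where k: "r < real k" using reals_Archimedean2 by blast
  have "vartheta r' (Num 0) \<alpha> \<le> ennreal (2 ^ k * (1 / 2) ^ mlen \<alpha>) * vartheta r (Num 0) \<alpha>" for \<alpha> :: "'n mindex"
  proof (cases "real (mlen \<alpha>) \<le> r")
    case True
    then have "mlen \<alpha> \<le> k" using k by simp
    then have "(2::real) ^ mlen \<alpha> \<le> 2 ^ k" by (intro power_increasing) auto
    then have "1 \<le> (2::real) ^ k * (1 / 2) ^ mlen \<alpha>" by (simp add: power_one_over field_simps)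
    then show ?thesis using True assms by (simp add: vartheta_0)
  next
    case False
    then show ?thesis by (simp add: vartheta_0 ennreal_mult_top)
  qed
  then show ?thesis
    unfolding strongly_dominated_def by (intro exI[of _ "2 ^ k"] conjI exI[of _ "1/2"] allI) auto
qed

lemma cofinal_vartheta_0:
  "cofinal_weights (\<lambda>n. vartheta (real n) (Num 0) :: ('n::finite) mindex \<Rightarrow> ennreal) (\<lambda>r. vartheta r (Num 0))"
proof unfold_locales
  fix n m :: nat and \<alpha> :: "'n mindex"
  show "0 < vartheta (real n) (Num 0) \<alpha>" by (simp add: vartheta_0)
  show "\<exists>n. vartheta (real n) (Num 0) \<alpha> < \<infinity>" by (intro exI[of _ "mlen \<alpha>"]) (simp add: vartheta_0)
  show "vartheta (real m) (Num 0) \<alpha> \<le> vartheta (real n) (Num 0) \<alpha>" if "n \<le> m"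
    using that by (auto simp: vartheta_0)
  show "\<exists>m. strongly_dominated mlen (vartheta (real m) (Num 0)) (vartheta (real n) (Num 0) :: 'n mindex \<Rightarrow> ennreal)"
    by (intro exI[of _ n] strongly_dominated_vartheta_0) simp
  show "\<exists>r>0. strongly_dominated mlen (vartheta r (Num 0)) (vartheta (real n) (Num 0) :: 'n mindex \<Rightarrow> ennreal)"
    by (intro exI[of _ "real n + 1"] conjI strongly_dominated_vartheta_0) auto
  \<comment> \<open>Degrees of \<open>\<alpha>\<close> and \<open>\<gamma>\<close> at most
    \<open>n\<close> force those of \<open>\<beta>\<close> and \<open>\<delta>\<close> to be at most
    \<open>2 * n\<close>, and the kernel factor to be at most \<open>2 ^ (2 * n)\<close>. Otherwise
    the right-hand side is infinite.\<close>
  have "ennreal (2 ^ (mlen \<alpha> + mlen \<gamma>)) * (vartheta (real (2 * n)) (Num 0) \<beta> * vartheta (real (2 * n)) (Num 0) \<delta>)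
      \<le> ennreal (2 ^ (2 * n)) * (vartheta (real n) (Num 0) \<alpha> * vartheta (real n) (Num 0) \<gamma>)"
    if eq: "\<forall>j. \<alpha> j + \<gamma> j = \<beta> j + \<delta> j" for \<alpha> \<beta> \<gamma> \<delta> :: "'n mindex"
  proof (cases "mlen \<alpha> \<le> n \<and> mlen \<gamma> \<le> n")
    case True
    then have "mlen \<beta> + mlen \<delta> \<le> 2 * n" using mindex_sum_eq_mlen[OF eq] by simp
    then have "mlen \<beta> \<le> 2 * n" "mlen \<delta> \<le> 2 * n" by auto
    moreover have "(2::real) ^ (mlen \<alpha> + mlen \<gamma>) \<le> 2 ^ (2 * n)" using True by (intro power_increasing) auto
    ultimately show ?thesis using True by (simp add: vartheta_0 ennreal_leI del: of_nat_mult)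
  next
    case False
    then have "vartheta (real n) (Num 0) \<alpha> * vartheta (real n) (Num 0) \<gamma> = top"
      by (auto simp: vartheta_0 ennreal_mult_top ennreal_top_mult)
    then show ?thesis by (simp add: ennreal_mult_top)
  qed
  then show "\<exists>m. \<exists>C>0. \<forall>\<alpha> \<beta> \<gamma> (\<delta> :: 'n mindex). (\<forall>j. \<alpha> j + \<gamma> j = \<beta> j + \<delta> j) \<longrightarrow>
      ennreal (2 ^ (mlen \<alpha> + mlen \<gamma>)) * (vartheta (real m) (Num 0) \<beta> * vartheta (real m) (Num 0) \<delta>)
      \<le> ennreal C * (vartheta (real n) (Num 0) \<alpha> * vartheta (real n) (Num 0) \<gamma>)"
    by (intro exI[of _ "2 * n"] exI[of _ "2 ^ (2 * n)"]) auto
next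
  fix r :: real assume "0 < r"
  obtain n :: nat where "r < real n" using reals_Archimedean2 by blast
  then show "\<exists>n. strongly_dominated mlen (vartheta (real n) (Num 0)) (vartheta r (Num 0) :: 'n mindex \<Rightarrow> ennreal)"
    by (intro exI[of _ n] strongly_dominated_vartheta_0) simp
qed

lemma cofinal_vartheta:
  assumes "s \<in> R_flat" "s < Num (1/2)"
  shows "\<exists>\<theta>. cofinal_weights \<theta> (\<lambda>r. vartheta r s :: ('n::finite) mindex \<Rightarrow> ennreal)"
proof (cases s)
  case (Num x)
  show ?thesis
  proof (cases "x = 0")
    case True
    then show ?thesis using cofinal_vartheta_0 Num by blast
  next
    case False
    then have x: "0 < x" "x < 1/2" using assms Num by (auto simp: R_flat_def)
    then have q: "1 < 1 / (2 * x)" by (simp add: field_simps)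
    interpret real_weights "exp_weight (1 / (2 * x)) :: real \<Rightarrow> 'n mindex \<Rightarrow> real"
      by (rule real_weights_exp) (use q in simp)
    show ?thesis
      unfolding Num vartheta_eq_exp_weight[OF False]
      using cofinal_shrinking[OF exp_weight_conv_shrink[OF q]] by blast
  qed
next
  case (Flat \<sigma>)
  then have "0 < \<sigma>" using assms by (auto simp: R_flat_def)
  then have t: "0 \<le> 1 / (2 * \<sigma>)" by simp
  interpret real_weights "fact_weight (1 / (2 * \<sigma>)) :: real \<Rightarrow> 'n mindex \<Rightarrow> real"
    by (rule real_weights_fact)
  show ?thesis
    unfolding Flat vartheta_eq_fact_weight
    using cofinal_shrinking[OF fact_weight_conv_shrink[OF t]] by blast
qed

lemma cofinal_inverse_vartheta:
  assumes "s \<in> R_flat" "Num 0 < s" "s \<le> Num (1/2)"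
  shows "\<exists>\<theta>. cofinal_weights \<theta> (\<lambda>r \<alpha>. 1 / vartheta r s (\<alpha> :: ('n::finite) mindex))"
proof (cases s)
  case (Num x)
  then have x: "0 < x" "x \<le> 1/2" using assms by (auto simp: less_eq_pindex_def)
  then have q: "1 \<le> 1 / (2 * x)" by (simp add: field_simps)
  interpret real_weights "exp_weight (1 / (2 * x)) :: real \<Rightarrow> 'n mindex \<Rightarrow> real"
    by (rule real_weights_exp[OF q])
  have "x \<noteq> 0" using x by simp
  then show ?thesis
    unfolding Num vartheta_eq_exp_weight[OF \<open>x \<noteq> 0\<close>]
    using cofinal_inverse[OF exp_weight_conv_expand[OF q]] by blast
next
  case (Flat \<sigma>)
  then have "0 < \<sigma>" using assms by (auto simp: R_flat_def)
  then have t: "0 \<le> 1 / (2 * \<sigma>)" by simp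
  interpret real_weights "fact_weight (1 / (2 * \<sigma>)) :: real \<Rightarrow> 'n mindex \<Rightarrow> real"
    by (rule real_weights_fact)
  show ?thesis
    unfolding Flat vartheta_eq_fact_weight
    using cofinal_inverse[OF fact_weight_conv_expand[OF t]] by blast
qed

lemma vartheta_real:
  assumes "s \<in> R_flat" "Num 0 < s" "0 < r"
  obtains x where "0 < x" "vartheta r s \<alpha> = ennreal x"
proof (cases s)
  case (Num x)
  then have "x \<noteq> 0" using assms by auto
  then show ?thesis using that[of "exp_weight (1 / (2 * x)) r \<alpha>"] by (simp add: Num vartheta_eq_exp_weight exp_weight_def)
next
  case (Flat \<sigma>)
  have "0 < fact_weight (1 / (2 * \<sigma>)) r \<alpha>" using assms(3) mfact_pos[of \<alpha>] by (simp add: fact_weight_def)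
  then show ?thesis using that by (simp add: Flat vartheta_eq_fact_weight)
qed

section \<open>Gaussian integrals\<close>

text \<open>The class contains constants, polynomials and exponentials, is closed under sums and
  products, and is integrable against every Gaussian; this settles integrability and boundary terms
  on the line.\<close>

definition exp_growth :: "(real \<Rightarrow> complex) \<Rightarrow> bool" where
  "exp_growth F \<longleftrightarrow> continuous_on UNIV F \<and> (\<exists>C a. 0 \<le> C \<and> 0 \<le> a \<and> (\<forall>x. norm (F x) \<le> C * exp (a * \<bar>x\<bar>)))"

lemma exp_growthI:
  "continuous_on UNIV F \<Longrightarrow> 0 \<le> C \<Longrightarrow> 0 \<le> a \<Longrightarrow> (\<And>x. norm (F x) \<le> C * exp (a * \<bar>x\<bar>)) \<Longrightarrow> exp_growth F"
  unfolding exp_growth_def by blast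

lemma exp_growth_const: "exp_growth (\<lambda>x. c)"
  by (rule exp_growthI[of _ "norm c" 0]) auto

lemma exp_growth_of_real: "exp_growth of_real"
proof (rule exp_growthI[of _ 1 1])
  fix x :: real
  show "norm (complex_of_real x) \<le> 1 * exp (1 * \<bar>x\<bar>)" using exp_ge_add_one_self[of "\<bar>x\<bar>"] unfolding norm_of_real mult_1 by linarith
qed (auto intro!: continuous_intros)

lemma exp_growth_add:
  assumes "exp_growth F" "exp_growth G" shows "exp_growth (\<lambda>x. F x + G x)"
proof -
  obtain C a where F: "0 \<le> C" "0 \<le> a" "\<And>x. norm (F x) \<le> C * exp (a * \<bar>x\<bar>)" and cF: "continuous_on UNIV F"
    using assms unfolding exp_growth_def by auto
  obtain D b where G: "0 \<le> D" "0 \<le> b" "\<And>x. norm (G x) \<le> D * exp (b * \<bar>x\<bar>)" and cG: "continuous_on UNIV G"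
    using assms unfolding exp_growth_def by auto
  show ?thesis
  proof (rule exp_growthI[of _ "C + D" "a + b"])
    fix x :: real
    have "norm (F x + G x) \<le> C * exp (a * \<bar>x\<bar>) + D * exp (b * \<bar>x\<bar>)"
      using F(3)[of x] G(3)[of x] norm_triangle_ineq[of "F x" "G x"] by linarith
    also have "\<dots> \<le> C * exp ((a + b) * \<bar>x\<bar>) + D * exp ((a + b) * \<bar>x\<bar>)"
      using F G by (intro add_mono mult_left_mono) (auto intro!: mult_right_mono)
    finally show "norm (F x + G x) \<le> (C + D) * exp ((a + b) * \<bar>x\<bar>)" by (simp add: distrib_right)
  qed (use F G cF cG in \<open>auto intro!: continuous_intros\<close>)
qed

lemma exp_growth_mult:
  assumes "exp_growth F" "exp_growth G" shows "exp_growth (\<lambda>x. F x * G x)"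
proof -
  obtain C a where F: "0 \<le> C" "0 \<le> a" "\<And>x. norm (F x) \<le> C * exp (a * \<bar>x\<bar>)" and cF: "continuous_on UNIV F"
    using assms unfolding exp_growth_def by auto
  obtain D b where G: "0 \<le> D" "0 \<le> b" "\<And>x. norm (G x) \<le> D * exp (b * \<bar>x\<bar>)" and cG: "continuous_on UNIV G"
    using assms unfolding exp_growth_def by auto
  show ?thesis
  proof (rule exp_growthI[of _ "C * D" "a + b"])
    fix x :: real
    have "norm (F x * G x) \<le> (C * exp (a * \<bar>x\<bar>)) * (D * exp (b * \<bar>x\<bar>))"
      unfolding norm_mult using F G by (intro mult_mono) auto
    also have "\<dots> = C * D * exp ((a + b) * \<bar>x\<bar>)" by (simp add: distrib_right exp_add)
    finally show "norm (F x * G x) \<le> C * D * exp ((a + b) * \<bar>x\<bar>)" .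
  qed (use F G cF cG in \<open>auto intro!: continuous_intros\<close>)
qed

lemma exp_growth_exp: "exp_growth (\<lambda>x. exp (\<zeta> * of_real x))"
proof (rule exp_growthI[of _ 1 "\<bar>Re \<zeta>\<bar>"])
  fix x :: real
  show "norm (exp (\<zeta> * of_real x)) \<le> 1 * exp (\<bar>Re \<zeta>\<bar> * \<bar>x\<bar>)"
    by (simp add: abs_mult[symmetric])
qed (auto intro!: continuous_intros)

lemma exp_growth_poly: "exp_growth (\<lambda>x. of_real (poly p x))"
proof (induction p)
  case (pCons c p)
  have "exp_growth (\<lambda>x. of_real c + of_real x * of_real (poly p x))"
    by (intro exp_growth_add exp_growth_mult exp_growth_const exp_growth_of_real pCons.IH)
  then show ?case by simp
qed (simp add: exp_growth_const)

section \<open>Integrability against Gaussians and integration by parts\<close>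

lemma integrable_gauss:
  assumes "0 < c" shows "integrable lborel (\<lambda>x. exp (- c * x\<^sup>2) :: real)"
proof -
  define s where "s = 1 / sqrt (2 * c)"
  have s: "0 < s" "2 * s\<^sup>2 = 1 / c" using assms by (auto simp: s_def power_divide)
  have "integrable lborel (\<lambda>x. sqrt (pi / c) * normal_density 0 s x)"
    by (intro integrable_mult_right integrable_normal_density s)
  moreover have "sqrt (pi / c) * normal_density 0 s x = exp (- c * x\<^sup>2)" for x
  proof -
    have "2 * pi * s\<^sup>2 = pi / c" using s(2) by (metis mult.assoc mult.commute times_divide_eq_right mult_1_right)
    moreover have "- x\<^sup>2 / (2 * s\<^sup>2) = - c * x\<^sup>2" unfolding s(2) by simp
    moreover have "sqrt (pi / c) \<noteq> 0" using assms by simp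
    ultimately show ?thesis unfolding normal_density_def by simp
  qed
  ultimately show ?thesis by simp
qed

text \<open>Completing the square: half of the Gaussian exponent absorbs the exponential growth, at
  the price of the constant \<open>exp (a\<^sup>2 / (2 * c))\<close>.\<close>

lemma exp_growth_gauss_bound:
  assumes F: "exp_growth F" and c: "0 < c"
  obtains C where "0 \<le> C" "\<And>x. norm (F x * of_real (exp (- c * x\<^sup>2))) \<le> C * exp (- (c / 2) * x\<^sup>2)"
proof -
  obtain C a where C: "0 \<le> C" "0 \<le> a" "\<And>x. norm (F x) \<le> C * exp (a * \<bar>x\<bar>)"
    using F unfolding exp_growth_def by auto
  have "norm (F x * of_real (exp (- c * x\<^sup>2))) \<le> (C * exp (a\<^sup>2 / (2 * c))) * exp (- (c / 2) * x\<^sup>2)" for x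
  proof -
    have "0 \<le> (a - c * \<bar>x\<bar>)\<^sup>2 / (2 * c)" using c by simp
    then have "a * \<bar>x\<bar> - c * x\<^sup>2 \<le> a\<^sup>2 / (2 * c) - (c / 2) * x\<^sup>2"
      using c by (simp add: power2_diff power_mult_distrib field_simps power2_eq_square)
    then have "exp (a * \<bar>x\<bar>) * exp (- c * x\<^sup>2) \<le> exp (a\<^sup>2 / (2 * c)) * exp (- (c / 2) * x\<^sup>2)"
      by (simp add: exp_add[symmetric])
    then have "C * (exp (a * \<bar>x\<bar>) * exp (- c * x\<^sup>2)) \<le> C * (exp (a\<^sup>2 / (2 * c)) * exp (- (c / 2) * x\<^sup>2))"
      using C by (intro mult_left_mono)
    moreover have "norm (F x * of_real (exp (- c * x\<^sup>2))) \<le> (C * exp (a * \<bar>x\<bar>)) * exp (- c * x\<^sup>2)"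
      unfolding norm_mult norm_of_real using C(3)[of x] by (auto intro: mult_right_mono)
    ultimately show ?thesis by (simp only: mult.assoc)
  qed
  then show thesis using that[of "C * exp (a\<^sup>2 / (2 * c))"] C by auto
qed

lemma exp_growth_measurable: "exp_growth F \<Longrightarrow> F \<in> borel_measurable borel"
  unfolding exp_growth_def by (auto intro: borel_measurable_continuous_onI)

lemma exp_growth_integrable:
  assumes F: "exp_growth F" and c: "0 < c"
  shows "integrable lborel (\<lambda>x. F x * of_real (exp (- c * x\<^sup>2)))"
proof -
  obtain C where C: "0 \<le> C" "\<And>x. norm (F x * of_real (exp (- c * x\<^sup>2))) \<le> C * exp (- (c / 2) * x\<^sup>2)"
    using exp_growth_gauss_bound[OF assms] by blast
  show ?thesis
  proof (rule Bochner_Integration.integrable_bound)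
    show "integrable lborel (\<lambda>x. C * exp (- (c / 2) * x\<^sup>2))"
      by (intro integrable_mult_right integrable_gauss) (use c in simp)
    show "AE x in lborel. norm (F x * of_real (exp (- c * x\<^sup>2))) \<le> norm (C * exp (- (c / 2) * x\<^sup>2))"
      using C by (intro AE_I2) (auto intro: order_trans)
  qed (use exp_growth_measurable[OF F] in measurable)
qed

lemma exp_growth_gauss_limit:
  assumes F: "exp_growth F" and c: "0 < c" and L: "filterlim (\<lambda>x::real. x\<^sup>2) at_top L"
  shows "((\<lambda>x. F x * of_real (exp (- c * x\<^sup>2))) \<longlongrightarrow> 0) L"
proof -
  obtain C where C: "0 \<le> C" "\<And>x. norm (F x * of_real (exp (- c * x\<^sup>2))) \<le> C * exp (- (c / 2) * x\<^sup>2)"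
    using exp_growth_gauss_bound[OF F c] by blast
  have "filterlim (\<lambda>x::real. (c / 2) * x\<^sup>2) at_top L"
    using c by (intro filterlim_tendsto_pos_mult_at_top[OF tendsto_const _ L]) auto
  then have "filterlim (\<lambda>x::real. - ((c / 2) * x\<^sup>2)) at_bot L" by (simp add: filterlim_uminus_at_top)
  then have "((\<lambda>x. exp (- ((c / 2) * x\<^sup>2))) \<longlongrightarrow> 0) L" by (rule filterlim_compose[OF exp_at_bot])
  then have "((\<lambda>x. C * exp (- (c / 2) * x\<^sup>2)) \<longlongrightarrow> C * 0) L" by (intro tendsto_mult tendsto_const) simp
  then have "((\<lambda>x. C * exp (- (c / 2) * x\<^sup>2)) \<longlongrightarrow> 0) L" by (simp only: mult_zero_right)
  with always_eventually[OF allI, OF C(2)] show ?thesis by (rule Lim_null_comparison)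
qed

text \<open>The derivative of \<open>F\<close> times the Gaussian has integral \<open>0\<close>,
  since the product vanishes at both ends.\<close>

lemma gauss_integration_by_parts:
  assumes F: "exp_growth F" "exp_growth F'" and D: "\<And>x. (F has_vector_derivative F' x) (at x)" and c: "0 < c"
  shows "(LINT x|lborel. F' x * of_real (exp (- c * x\<^sup>2))) =
    (LINT x|lborel. of_real (2 * c * x) * F x * of_real (exp (- c * x\<^sup>2)))"
proof -
  let ?g = "\<lambda>x. complex_of_real (exp (- c * x\<^sup>2))"
  let ?d = "\<lambda>x. F' x * ?g x - of_real (2 * c * x) * F x * ?g x"
  have xF: "exp_growth (\<lambda>x. of_real (2 * c * x) * F x)"
    unfolding of_real_mult by (intro exp_growth_mult exp_growth_const exp_growth_of_real F)
  have int: "integrable lborel (\<lambda>x. F' x * ?g x)" "integrable lborel (\<lambda>x. of_real (2 * c * x) * F x * ?g x)"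
    using exp_growth_integrable[OF F(2) c] exp_growth_integrable[OF xF c] by auto
  have cont: "isCont F' x" "isCont F x" for x
    using F unfolding exp_growth_def by (auto simp: continuous_on_eq_continuous_at)
  have "(LBINT x=-\<infinity>..\<infinity>. ?d x) = 0 - 0"
  proof (rule interval_integral_FTC_integrable)
    fix x :: real
    have "((\<lambda>x. exp (- c * x\<^sup>2)) has_real_derivative exp (- c * x\<^sup>2) * (- c * (2 * x))) (at x)"
      by (auto intro!: derivative_eq_intros)
    then have "(?g has_vector_derivative of_real (exp (- c * x\<^sup>2) * (- c * (2 * x)))) (at x)"
      by (rule has_vector_derivative_of_real)
    from has_vector_derivative_mult[OF D[of x] this]
    show "((\<lambda>x. F x * ?g x) has_vector_derivative ?d x) (at x)"
      by (simp add: algebra_simps)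
    show "isCont ?d x" using cont[of x] by (intro continuous_intros) auto
  next
    show "set_integrable lborel (einterval (- \<infinity>) \<infinity>) ?d"
      using int by (simp add: set_integrable_def)
    have "filterlim (\<lambda>x::real. x\<^sup>2) at_top at_top" "filterlim (\<lambda>x::real. x\<^sup>2) at_top at_bot"
      by real_asymp+
    then show "(((\<lambda>x. F x * ?g x) \<circ> real_of_ereal) \<longlongrightarrow> 0) (at_right (- \<infinity>))"
      "(((\<lambda>x. F x * ?g x) \<circ> real_of_ereal) \<longlongrightarrow> 0) (at_left \<infinity>)"
      using exp_growth_gauss_limit[OF F(1) c] by (auto simp: ereal_tendsto_simps)
  qed simp
  then have "(LINT x|lborel. ?d x) = 0"
    by (simp add: interval_lebesgue_integral_def set_lebesgue_integral_def)
  then show ?thesis using int by simp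
qed

text \<open>The characteristic function of the standard normal law, after substituting
  \<open>sqrt 2 * y\<close>.\<close>

lemma gauss_fourier:
  "(LINT y|lborel. exp (- \<i> * of_real (y * \<xi>)) * of_real (exp (- y\<^sup>2))) = of_real (sqrt pi * exp (- \<xi>\<^sup>2 / 4))"
proof -
  let ?t = "- \<xi> / sqrt 2"
  have "(LINT v|std_normal_distribution. iexp (?t * v)) = of_real (exp (- (?t\<^sup>2) / 2))"
    using fun_cong[OF char_std_normal_distribution, of ?t] by (simp add: char_def)
  then have "(LINT v|lborel. std_normal_density v *\<^sub>R iexp (?t * v)) = of_real (exp (- (?t\<^sup>2) / 2))"
    by (subst (asm) integral_density) (auto simp: normal_density_nonneg)
  moreover have "- (?t\<^sup>2) / 2 = - \<xi>\<^sup>2 / 4" by (simp add: power_divide)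
  ultimately have 1: "(LINT v|lborel. std_normal_density v *\<^sub>R iexp (?t * v)) = of_real (exp (- \<xi>\<^sup>2 / 4))"
    by simp
  have "(LINT v|lborel. std_normal_density v *\<^sub>R iexp (?t * v)) =
      \<bar>sqrt 2\<bar> *\<^sub>R (LINT y|lborel. std_normal_density (0 + sqrt 2 * y) *\<^sub>R iexp (?t * (0 + sqrt 2 * y)))"
    by (rule lborel_integral_real_affine) simp
  also have "\<dots> = (LINT y|lborel. \<bar>sqrt 2\<bar> *\<^sub>R (std_normal_density (0 + sqrt 2 * y) *\<^sub>R iexp (?t * (0 + sqrt 2 * y))))"
    by (rule integral_scaleR_right[symmetric])
  also have "\<dots> = (LINT y|lborel. of_real (1 / sqrt pi) * (exp (- \<i> * of_real (y * \<xi>)) * of_real (exp (- y\<^sup>2))))"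
  proof (rule Bochner_Integration.integral_cong[OF refl])
    fix y :: real
    have e: "?t * (0 + sqrt 2 * y) = - (y * \<xi>)" by simp
    have "sqrt 2 * std_normal_density (0 + sqrt 2 * y) = 1 / sqrt pi * exp (- y\<^sup>2)"
      by (simp add: std_normal_density_def power_mult_distrib real_sqrt_mult)
    then show "\<bar>sqrt 2\<bar> *\<^sub>R (std_normal_density (0 + sqrt 2 * y) *\<^sub>R iexp (?t * (0 + sqrt 2 * y))) =
        of_real (1 / sqrt pi) * (exp (- \<i> * of_real (y * \<xi>)) * of_real (exp (- y\<^sup>2)))"
      unfolding e scaleR_scaleR by (simp add: scaleR_conv_of_real)
  qed
  also have "\<dots> = of_real (1 / sqrt pi) * (LINT y|lborel. exp (- \<i> * of_real (y * \<xi>)) * of_real (exp (- y\<^sup>2)))"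
    by (rule integral_mult_right_zero)
  finally have "of_real (1 / sqrt pi) * (LINT y|lborel. exp (- \<i> * of_real (y * \<xi>)) * of_real (exp (- y\<^sup>2)))
      = complex_of_real (exp (- \<xi>\<^sup>2 / 4))" using 1 by simp
  then have "of_real (sqrt pi) * (of_real (1 / sqrt pi) * (LINT y|lborel. exp (- \<i> * of_real (y * \<xi>)) * of_real (exp (- y\<^sup>2))))
      = of_real (sqrt pi) * complex_of_real (exp (- \<xi>\<^sup>2 / 4))" by simp
  moreover have "of_real (sqrt pi) * complex_of_real (1 / sqrt pi) = 1"
    by (simp only: of_real_mult[symmetric]) simp
  ultimately show ?thesis by (simp only: mult.assoc[symmetric]) simp
qed

text \<open>Translation by the real number \<open>x / 2\<close> completes the square for the real
  part of the exponent and leaves a Fourier integral.\<close>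

lemma gauss_laplace:
  "(LINT y|lborel. exp (Complex x (- \<xi>) * of_real y) * of_real (exp (- y\<^sup>2))) =
    of_real (sqrt pi) * exp ((Complex x (- \<xi>))\<^sup>2 / 4)"
proof -
  have "(LINT y|lborel. exp (Complex x (- \<xi>) * of_real y) * of_real (exp (- y\<^sup>2))) =
      (LINT y|lborel. exp (Complex x (- \<xi>) * of_real (x / 2 + 1 * y)) * of_real (exp (- (x / 2 + 1 * y)\<^sup>2)))"
    by (subst lborel_integral_real_affine[of 1 _ "x / 2"]) auto
  also have "\<dots> = (LINT y|lborel. exp (of_real (x\<^sup>2 / 4) - \<i> * of_real (x * \<xi> / 2)) *
      (exp (- \<i> * of_real (y * \<xi>)) * of_real (exp (- y\<^sup>2))))"
  proof (rule Bochner_Integration.integral_cong[OF refl])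
    fix y :: real
    have "Complex x (- \<xi>) * of_real (x / 2 + 1 * y) + of_real (- (x / 2 + 1 * y)\<^sup>2) =
        (of_real (x\<^sup>2 / 4) - \<i> * of_real (x * \<xi> / 2)) + (- \<i> * of_real (y * \<xi>) + of_real (- y\<^sup>2))"
      by (rule complex_eqI) (simp_all add: power2_eq_square field_simps)
    then show "exp (Complex x (- \<xi>) * of_real (x / 2 + 1 * y)) * of_real (exp (- (x / 2 + 1 * y)\<^sup>2)) =
        exp (of_real (x\<^sup>2 / 4) - \<i> * of_real (x * \<xi> / 2)) * (exp (- \<i> * of_real (y * \<xi>)) * of_real (exp (- y\<^sup>2)))"
      by (simp only: exp_of_real[symmetric] exp_add[symmetric])
  qed
  also have "\<dots> = exp (of_real (x\<^sup>2 / 4) - \<i> * of_real (x * \<xi> / 2)) * of_real (sqrt pi * exp (- \<xi>\<^sup>2 / 4))"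
    by (subst integral_mult_right_zero) (simp only: gauss_fourier)
  also have "\<dots> = of_real (sqrt pi) * exp ((of_real (x\<^sup>2 / 4) - \<i> * of_real (x * \<xi> / 2)) + of_real (- \<xi>\<^sup>2 / 4))"
    by (simp only: exp_add of_real_mult exp_of_real ac_simps)
  also have "(of_real (x\<^sup>2 / 4) - \<i> * of_real (x * \<xi> / 2)) + of_real (- \<xi>\<^sup>2 / 4) = (Complex x (- \<xi>))\<^sup>2 / 4"
    by (rule complex_eqI) (simp_all add: power2_eq_square field_simps)
  finally show ?thesis .
qed

text \<open>\<open>gauss_poly k\<close> is (-1)^k times the k-th physicists' Hermite polynomial; the
  recursion differentiates its product with exp(-t^2).\<close>

fun gauss_poly :: "nat \<Rightarrow> real poly" where
  "gauss_poly 0 = 1"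
| "gauss_poly (Suc k) = pderiv (gauss_poly k) - [:0, 2:] * gauss_poly k"

definition gauss_deriv :: "nat \<Rightarrow> real \<Rightarrow> real" where
  "gauss_deriv k t = poly (gauss_poly k) t * exp (- t\<^sup>2)"

lemma gauss_deriv_0: "gauss_deriv 0 t = exp (- t\<^sup>2)"
  by (simp add: gauss_deriv_def)

lemma gauss_deriv_has_derivative:
  "(gauss_deriv k has_real_derivative gauss_deriv (Suc k) t) (at t)"
  unfolding gauss_deriv_def
  by (auto intro!: derivative_eq_intros simp: algebra_simps)

lemma integrable_gauss_deriv_exp:
  fixes \<zeta> :: complex
  shows
  "integrable lborel (\<lambda>y. of_real (gauss_deriv k y) * exp (\<zeta> * of_real y))"
proof -
  have "exp_growth (\<lambda>y. of_real (poly (gauss_poly k) y) * exp (\<zeta> * of_real y))"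
    by (intro exp_growth_mult exp_growth_poly exp_growth_exp)
  from exp_growth_integrable[OF this, of 1] show ?thesis by (simp add: gauss_deriv_def ac_simps)
qed

text \<open>Each derivative of the Gaussian is moved to the exponential by parts and yields a factor
  \<open>- \<zeta>\<close>.\<close>

lemma laplace_gauss_deriv:
  fixes \<zeta> :: complex
  shows
  "(LINT y|lborel. of_real (gauss_deriv k y) * exp (\<zeta> * of_real y)) =
    (- \<zeta>) ^ k * (LINT y|lborel. exp (\<zeta> * of_real y) * of_real (exp (- y\<^sup>2)))"
proof (induction k)
  case 0
  then show ?case by (simp add: gauss_deriv_0 mult.commute)
next
  case (Suc k)
  let ?e = "\<lambda>y. exp (\<zeta> * complex_of_real y)" and ?p = "\<lambda>y. complex_of_real (poly (gauss_poly k) y)"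
    and ?p' = "\<lambda>y. complex_of_real (poly (pderiv (gauss_poly k)) y)"
  let ?g = "\<lambda>y. complex_of_real (exp (- y\<^sup>2))"
  have "(LINT y|lborel. (?p' y * ?e y + ?p y * (\<zeta> * ?e y)) * of_real (exp (- 1 * y\<^sup>2))) =
      (LINT y|lborel. of_real (2 * 1 * y) * (?p y * ?e y) * of_real (exp (- 1 * y\<^sup>2)))"
  proof (rule gauss_integration_by_parts)
    fix y :: real
    have 1: "(?p has_vector_derivative ?p' y) (at y)"
      by (rule has_vector_derivative_of_real[OF poly_DERIV])
    have "((\<lambda>z. exp (\<zeta> * z)) has_field_derivative \<zeta> * ?e y) (at (of_real y))"
      by (auto intro!: derivative_eq_intros)
    then have 2: "(?e has_vector_derivative \<zeta> * ?e y) (at y)"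
      by (rule has_vector_derivative_real_field)
    show "((\<lambda>y. ?p y * ?e y) has_vector_derivative ?p' y * ?e y + ?p y * (\<zeta> * ?e y)) (at y)"
      using has_vector_derivative_mult[OF 1 2] by (simp add: add.commute)
  qed (auto intro!: exp_growth_add exp_growth_mult exp_growth_poly exp_growth_exp exp_growth_const)
  then have ibp: "(LINT y|lborel. (?p' y * ?e y + ?p y * (\<zeta> * ?e y)) * ?g y) = (LINT y|lborel. of_real (2 * y) * (?p y * ?e y) * ?g y)"
    by simp
  have int: "integrable lborel (\<lambda>y. (?p' y * ?e y + ?p y * (\<zeta> * ?e y)) * ?g y)"
    "integrable lborel (\<lambda>y. of_real (2 * y) * (?p y * ?e y) * ?g y)"
    "integrable lborel (\<lambda>y. \<zeta> * (?p y * ?e y * ?g y))"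
  proof -
    have "exp_growth (\<lambda>y. ?p' y * ?e y + ?p y * (\<zeta> * ?e y))" "exp_growth (\<lambda>y. of_real (2 * y) * (?p y * ?e y))"
      "exp_growth (\<lambda>y. \<zeta> * (?p y * ?e y))" unfolding of_real_mult
      by (intro exp_growth_add exp_growth_mult exp_growth_poly exp_growth_exp exp_growth_const exp_growth_of_real)+
    from this[THEN exp_growth_integrable, of 1]
    show "integrable lborel (\<lambda>y. (?p' y * ?e y + ?p y * (\<zeta> * ?e y)) * ?g y)"
      "integrable lborel (\<lambda>y. of_real (2 * y) * (?p y * ?e y) * ?g y)"
      "integrable lborel (\<lambda>y. \<zeta> * (?p y * ?e y * ?g y))" by (simp_all add: mult.assoc)
  qed
  have "(LINT y|lborel. of_real (gauss_deriv (Suc k) y) * ?e y) =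
      (LINT y|lborel. ((?p' y * ?e y + ?p y * (\<zeta> * ?e y)) * ?g y - of_real (2 * y) * (?p y * ?e y) * ?g y) - \<zeta> * (?p y * ?e y * ?g y))"
    by (rule Bochner_Integration.integral_cong) (simp_all add: gauss_deriv_def algebra_simps)
  also have "\<dots> = 0 - \<zeta> * (LINT y|lborel. ?p y * ?e y * ?g y)"
    using int ibp by (simp add: Bochner_Integration.integral_diff)
  also have "(LINT y|lborel. ?p y * ?e y * ?g y) = (LINT y|lborel. of_real (gauss_deriv k y) * ?e y)"
    by (rule Bochner_Integration.integral_cong) (simp_all add: gauss_deriv_def ac_simps)
  finally show ?case by (simp add: Suc.IH)
qed

text \<open>The point (x - i \<xi>) / sqrt 2 at which \<open>toeplitz_symb\<close> evaluates the
  symbol, coordinate by coordinate. It is also the Bargmann variable, in which transforms of Hermite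
  functions become monomials.\<close>

definition phase_z :: "real \<Rightarrow> real \<Rightarrow> complex" where
  "phase_z x \<xi> = Complex (x / sqrt 2) (- \<xi> / sqrt 2)"

lemma phase_z_alt: "phase_z x \<xi> = of_real x * of_real (1 / sqrt 2) - \<i> * of_real (\<xi> * (1 / sqrt 2))"
  by (rule complex_eqI) (simp_all add: phase_z_def)

lemma cnj_phase_z_alt: "cnj (phase_z x \<xi>) = of_real x * of_real (1 / sqrt 2) + \<i> * of_real (\<xi> * (1 / sqrt 2))"
  by (rule complex_eqI) (simp_all add: phase_z_def)

lemma continuous_phase_z [continuous_intros]:
  "continuous_on S f \<Longrightarrow> continuous_on S g \<Longrightarrow> continuous_on S (\<lambda>w. phase_z (f w) (g w))"
  unfolding phase_z_alt by (intro continuous_intros)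

lemma norm_phase_z: "norm (phase_z x \<xi>) \<le> exp \<bar>x\<bar> * exp \<bar>\<xi>\<bar>"
proof -
  have "sqrt 2 \<ge> 1" by simp
  then have "\<bar>x / sqrt 2\<bar> \<le> \<bar>x\<bar>" "\<bar>\<xi> / sqrt 2\<bar> \<le> \<bar>\<xi>\<bar>"
    by (auto simp: divide_le_eq mult_le_cancel_left1)
  moreover have "norm (phase_z x \<xi>) \<le> \<bar>x / sqrt 2\<bar> + \<bar>\<xi> / sqrt 2\<bar>"
    using cmod_le[of "phase_z x \<xi>"] by (simp add: phase_z_def)
  moreover have "1 + (\<bar>x\<bar> + \<bar>\<xi>\<bar>) \<le> exp (\<bar>x\<bar> + \<bar>\<xi>\<bar>)" by (rule exp_ge_add_one_self)
  ultimately show ?thesis unfolding exp_add by linarith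
qed

section \<open>Complex Gaussian moments in the plane\<close>

definition gauss2 :: "real \<Rightarrow> real" where
  "gauss2 x = exp (- (1 / 2) * x\<^sup>2)"

lemma integrable_pair_gauss:
  fixes F :: "real \<times> real \<Rightarrow> complex"
  assumes F: "continuous_on UNIV F" and b: "0 \<le> a" "\<And>x \<xi>. norm (F (x, \<xi>)) \<le> exp (a * \<bar>x\<bar>) * exp (a * \<bar>\<xi>\<bar>)"
  shows "integrable lborel (\<lambda>w. F w * of_real (gauss2 (fst w) * gauss2 (snd w)))"
proof -
  define h where "h x = exp (a * \<bar>x\<bar>) * gauss2 x" for x
  have h0: "0 \<le> h x" for x by (simp add: h_def gauss2_def)
  have "exp_growth (\<lambda>x. of_real (exp (a * \<bar>x\<bar>)))"
    using b(1) by (intro exp_growthI[of _ 1 a] continuous_intros) auto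
  from exp_growth_integrable[OF this, of "1/2"]
  have "integrable lborel (\<lambda>x. complex_of_real (h x))" by (simp add: h_def gauss2_def)
  then have h: "integrable lborel h" by (simp only: complex_of_real_integrable_eq)
  have "integrable (lborel \<Otimes>\<^sub>M lborel) (\<lambda>w. h (fst w) * h (snd w))"
  proof (rule lborel_pair.Fubini_integrable)
    show "(\<lambda>w. h (fst w) * h (snd w)) \<in> borel_measurable (lborel \<Otimes>\<^sub>M lborel)"
      using borel_measurable_integrable[OF h] by measurable
    have "(LINT y|lborel. norm (h x * h y)) = h x * (LINT y|lborel. h y)" for x
      using h0 by (simp add: abs_mult)
    then show "integrable lborel (\<lambda>x. LINT y|lborel. norm (h (fst (x, y)) * h (snd (x, y))))"
      using h by simp
  qed (use h in auto)
  then have int: "integrable lborel (\<lambda>w. h (fst w) * h (snd w))" by (simp add: lborel_prod)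
  show ?thesis
  proof (rule Bochner_Integration.integrable_bound[OF int])
    show "(\<lambda>w. F w * of_real (gauss2 (fst w) * gauss2 (snd w))) \<in> borel_measurable lborel"
    proof -
      have "continuous_on UNIV (\<lambda>w. F w * of_real (gauss2 (fst w) * gauss2 (snd w)))"
        unfolding gauss2_def by (intro continuous_intros F)
      then show ?thesis by (simp add: borel_measurable_continuous_onI)
    qed
    show "AE w in lborel. norm (F w * of_real (gauss2 (fst w) * gauss2 (snd w))) \<le> norm (h (fst w) * h (snd w))"
    proof (intro AE_I2)
      fix w :: "real \<times> real"
      have "norm (F w * of_real (gauss2 (fst w) * gauss2 (snd w))) = norm (F w) * (gauss2 (fst w) * gauss2 (snd w))"
        unfolding norm_mult norm_of_real by (simp add: gauss2_def)
      also have "\<dots> \<le> (exp (a * \<bar>fst w\<bar>) * exp (a * \<bar>snd w\<bar>)) * (gauss2 (fst w) * gauss2 (snd w))"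
        using b(2)[of "fst w" "snd w"] by (intro mult_right_mono) (auto simp: gauss2_def)
      also have "\<dots> = h (fst w) * h (snd w)" by (simp add: h_def ac_simps)
      finally show "norm (F w * of_real (gauss2 (fst w) * gauss2 (snd w))) \<le> norm (h (fst w) * h (snd w))"
        using h0 by simp
    qed
  qed
qed

definition zmono :: "nat \<Rightarrow> nat \<Rightarrow> real \<Rightarrow> real \<Rightarrow> complex" where
  "zmono m n x \<xi> = phase_z x \<xi> ^ m * cnj (phase_z x \<xi>) ^ n"

definition gmoment :: "nat \<Rightarrow> nat \<Rightarrow> complex" where
  "gmoment m n = (LINT w|lborel. zmono m n (fst w) (snd w) * of_real (gauss2 (fst w) * gauss2 (snd w)))"

lemma norm_zmono: "norm (zmono m n x \<xi>) \<le> exp (real (m + n) * \<bar>x\<bar>) * exp (real (m + n) * \<bar>\<xi>\<bar>)"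
proof -
  have "norm (zmono m n x \<xi>) = norm (phase_z x \<xi>) ^ (m + n)"
    by (simp add: zmono_def norm_mult norm_power power_add)
  also have "\<dots> \<le> (exp \<bar>x\<bar> * exp \<bar>\<xi>\<bar>) ^ (m + n)" by (intro power_mono norm_phase_z) simp
  also have "\<dots> = exp (real (m + n) * \<bar>x\<bar>) * exp (real (m + n) * \<bar>\<xi>\<bar>)"
    by (simp only: power_mult_distrib exp_of_nat_mult)
  finally show ?thesis .
qed

lemma continuous_zmono [continuous_intros]:
  "continuous_on S f \<Longrightarrow> continuous_on S g \<Longrightarrow> continuous_on S (\<lambda>w. zmono m n (f w) (g w))"
  unfolding zmono_def by (intro continuous_intros)

lemma integrable_zmono:
  "integrable lborel (\<lambda>w. zmono m n (fst w) (snd w) * of_real (gauss2 (fst w) * gauss2 (snd w)))"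
  by (rule integrable_pair_gauss[of _ "real (m + n)"])
     (auto intro!: continuous_intros norm_zmono[unfolded of_nat_add, simplified] simp: norm_zmono[simplified])

lemma integrable_coord_zmono:
  "integrable lborel (\<lambda>w. (of_real (fst w) * zmono m n (fst w) (snd w)) * of_real (gauss2 (fst w) * gauss2 (snd w)))"
  "integrable lborel (\<lambda>w. (of_real (snd w) * zmono m n (fst w) (snd w)) * of_real (gauss2 (fst w) * gauss2 (snd w)))"
proof -
  let ?a = "real (m + n) + 1"
  have t: "\<bar>t\<bar> \<le> exp \<bar>t\<bar>" for t :: real using exp_ge_add_one_self[of "\<bar>t\<bar>"] by linarith
  have e: "exp \<bar>t\<bar> * exp (real (m + n) * \<bar>t\<bar>) = exp (?a * \<bar>t\<bar>)" for t :: real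
    by (simp add: exp_add[symmetric] algebra_simps)
  have e': "exp (real (m + n) * \<bar>t\<bar>) \<le> exp (?a * \<bar>t\<bar>)" for t :: real by (simp add: mult_right_mono)
  have 1: "norm (of_real x * zmono m n x \<xi>) \<le> exp (?a * \<bar>x\<bar>) * exp (?a * \<bar>\<xi>\<bar>)" for x \<xi>
  proof -
    have "norm (of_real x * zmono m n x \<xi>) \<le> exp \<bar>x\<bar> * (exp (real (m + n) * \<bar>x\<bar>) * exp (real (m + n) * \<bar>\<xi>\<bar>))"
      unfolding norm_mult norm_of_real by (intro mult_mono t norm_zmono) auto
    also have "\<dots> \<le> exp (?a * \<bar>x\<bar>) * exp (?a * \<bar>\<xi>\<bar>)"
      unfolding mult.assoc[symmetric] e by (intro mult_left_mono e') simp
    finally show ?thesis .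
  qed
  have 2: "norm (of_real \<xi> * zmono m n x \<xi>) \<le> exp (?a * \<bar>x\<bar>) * exp (?a * \<bar>\<xi>\<bar>)" for x \<xi>
  proof -
    have "norm (of_real \<xi> * zmono m n x \<xi>) \<le> exp \<bar>\<xi>\<bar> * (exp (real (m + n) * \<bar>x\<bar>) * exp (real (m + n) * \<bar>\<xi>\<bar>))"
      unfolding norm_mult norm_of_real by (intro mult_mono t norm_zmono) auto
    also have "\<dots> = exp (real (m + n) * \<bar>x\<bar>) * exp (?a * \<bar>\<xi>\<bar>)"
      unfolding e[symmetric] by (simp only: ac_simps)
    also have "\<dots> \<le> exp (?a * \<bar>x\<bar>) * exp (?a * \<bar>\<xi>\<bar>)" by (intro mult_right_mono e') simp
    finally show ?thesis .
  qed
  show "integrable lborel (\<lambda>w. (of_real (fst w) * zmono m n (fst w) (snd w)) * of_real (gauss2 (fst w) * gauss2 (snd w)))"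
    by (rule integrable_pair_gauss[of _ ?a]) (use 1 in \<open>auto intro!: continuous_intros\<close>)
  show "integrable lborel (\<lambda>w. (of_real (snd w) * zmono m n (fst w) (snd w)) * of_real (gauss2 (fst w) * gauss2 (snd w)))"
    by (rule integrable_pair_gauss[of _ ?a]) (use 2 in \<open>auto intro!: continuous_intros\<close>)
qed

lemma lborel_pair_integral:
  fixes f :: "real \<times> real \<Rightarrow> complex"
  assumes "integrable lborel f"
  shows "(LINT w|lborel. f w) = (LINT \<xi>|lborel. LINT x|lborel. f (x, \<xi>))"
    and "(LINT w|lborel. f w) = (LINT x|lborel. LINT \<xi>|lborel. f (x, \<xi>))"
proof -
  have f: "integrable (lborel \<Otimes>\<^sub>M lborel) f" using assms by (simp add: lborel_prod)
  show "(LINT w|lborel. f w) = (LINT \<xi>|lborel. LINT x|lborel. f (x, \<xi>))"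
    using lborel_pair.integral_snd[of "\<lambda>x \<xi>. f (x, \<xi>)"] f by (simp add: lborel_prod)
  show "(LINT w|lborel. f w) = (LINT x|lborel. LINT \<xi>|lborel. f (x, \<xi>))"
    using lborel_pair.integral_fst'[OF f] by (simp add: lborel_prod)
qed

lemma exp_growth_zmono: "exp_growth (\<lambda>x. zmono m n x \<xi>)" "exp_growth (\<lambda>\<xi>. zmono m n x \<xi>)"
proof -
  have "norm (zmono m n x \<xi>) \<le> exp (real (m + n) * \<bar>\<xi>\<bar>) * exp (real (m + n) * \<bar>x\<bar>)" for x
    by (subst mult.commute) (rule norm_zmono)
  then show "exp_growth (\<lambda>x. zmono m n x \<xi>)"
    by (intro exp_growthI[of _ "exp (real (m + n) * \<bar>\<xi>\<bar>)" "real (m + n)"] continuous_intros) auto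
  show "exp_growth (\<lambda>\<xi>. zmono m n x \<xi>)"
    by (intro exp_growthI[of _ "exp (real (m + n) * \<bar>x\<bar>)" "real (m + n)"] continuous_intros norm_zmono) auto
qed

text \<open>In terms of Wirtinger derivatives the first is (d/dz + d/dcnj z) / sqrt 2 and the second
  i (d/dcnj z - d/dz) / sqrt 2. The truncated exponents \<open>m - 1\<close> and
  \<open>n - 1\<close> carry a factor \<open>0\<close> when they start from
  \<open>0\<close>.\<close>

lemma zmono_derivative:
  "((\<lambda>x. zmono m n x \<xi>) has_vector_derivative
     of_real (1 / sqrt 2) * (of_nat m * zmono (m - 1) n x \<xi> + of_nat n * zmono m (n - 1) x \<xi>)) (at x)"
  "((\<lambda>\<xi>. zmono m n x \<xi>) has_vector_derivative
     \<i> * of_real (1 / sqrt 2) * (of_nat n * zmono m (n - 1) x \<xi> - of_nat m * zmono (m - 1) n x \<xi>)) (at \<xi>)"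
proof -
  let ?c = "complex_of_real (1 / sqrt 2)"
  have 1: "((\<lambda>z. (z * ?c - b) ^ m * (z * ?c + b) ^ n) has_field_derivative
      ?c * (of_nat m * ((z * ?c - b) ^ (m - 1) * (z * ?c + b) ^ n) + of_nat n * ((z * ?c - b) ^ m * (z * ?c + b) ^ (n - 1)))) (at z)"
    for b z :: complex
    by (auto intro!: derivative_eq_intros simp: algebra_simps)
  show "((\<lambda>x. zmono m n x \<xi>) has_vector_derivative
     ?c * (of_nat m * zmono (m - 1) n x \<xi> + of_nat n * zmono m (n - 1) x \<xi>)) (at x)"
    unfolding zmono_def cnj_phase_z_alt unfolding phase_z_alt
    by (rule has_vector_derivative_real_field[OF 1])
  have 2: "((\<lambda>z. (a - \<i> * (z * ?c)) ^ m * (a + \<i> * (z * ?c)) ^ n) has_field_derivative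
      \<i> * ?c * (of_nat n * ((a - \<i> * (z * ?c)) ^ m * (a + \<i> * (z * ?c)) ^ (n - 1)) - of_nat m * ((a - \<i> * (z * ?c)) ^ (m - 1) * (a + \<i> * (z * ?c)) ^ n))) (at z)"
    for a z :: complex
    by (auto intro!: derivative_eq_intros simp: algebra_simps)
  show "((\<lambda>\<xi>. zmono m n x \<xi>) has_vector_derivative
     \<i> * ?c * (of_nat n * zmono m (n - 1) x \<xi> - of_nat m * zmono (m - 1) n x \<xi>)) (at \<xi>)"
    unfolding zmono_def cnj_phase_z_alt unfolding phase_z_alt of_real_mult[of \<xi>] of_real_mult[of "_::real" "1 / sqrt 2"]
    by (rule has_vector_derivative_real_field[OF 2])
qed

text \<open>Fubini and integration by parts in the first variable, with Gaussian constant
  \<open>1/2\<close>: multiplication by x becomes differentiation in x.\<close>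

lemma gmoment_fst:
  "(LINT w|lborel. (of_real (fst w) * zmono m n (fst w) (snd w)) * of_real (gauss2 (fst w) * gauss2 (snd w))) =
    of_real (1 / sqrt 2) * (of_nat m * gmoment (m - 1) n + of_nat n * gmoment m (n - 1))"
proof -
  let ?c = "complex_of_real (1 / sqrt 2)"
  let ?D = "\<lambda>x \<xi>. ?c * (of_nat m * zmono (m - 1) n x \<xi> + of_nat n * zmono m (n - 1) x \<xi>)"
  have D: "(\<lambda>w. ?D (fst w) (snd w) * of_real (gauss2 (fst w) * gauss2 (snd w))) =
      (\<lambda>w. ?c * (of_nat m * (zmono (m - 1) n (fst w) (snd w) * of_real (gauss2 (fst w) * gauss2 (snd w))) +
        of_nat n * (zmono m (n - 1) (fst w) (snd w) * of_real (gauss2 (fst w) * gauss2 (snd w)))))"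
    by (simp add: fun_eq_iff algebra_simps)
  have int: "integrable lborel (\<lambda>w. ?D (fst w) (snd w) * of_real (gauss2 (fst w) * gauss2 (snd w)))"
    unfolding D by (intro integrable_mult_right Bochner_Integration.integrable_add integrable_zmono)
  have "(LINT w|lborel. (of_real (fst w) * zmono m n (fst w) (snd w)) * of_real (gauss2 (fst w) * gauss2 (snd w))) =
      (LINT \<xi>|lborel. LINT x|lborel. (of_real x * zmono m n x \<xi>) * of_real (gauss2 x * gauss2 \<xi>))"
    by (subst lborel_pair_integral(1)[OF integrable_coord_zmono(1)]) simp
  also have "\<dots> = (LINT \<xi>|lborel. LINT x|lborel. ?D x \<xi> * of_real (gauss2 x * gauss2 \<xi>))"
  proof (rule Bochner_Integration.integral_cong[OF refl])
    fix \<xi> :: real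
    have "(LINT x|lborel. ?D x \<xi> * of_real (exp (- (1 / 2) * x\<^sup>2))) =
      (LINT x|lborel. of_real (2 * (1 / 2) * x) * zmono m n x \<xi> * of_real (exp (- (1 / 2) * x\<^sup>2)))"
    proof (rule gauss_integration_by_parts[OF exp_growth_zmono(1) _ zmono_derivative(1)])
      show "exp_growth (\<lambda>x. ?D x \<xi>)"
        by (intro exp_growth_add exp_growth_mult exp_growth_const exp_growth_zmono)
    qed simp
    then have "(LINT x|lborel. (of_real x * zmono m n x \<xi>) * of_real (gauss2 x)) = (LINT x|lborel. ?D x \<xi> * of_real (gauss2 x))"
      by (simp add: gauss2_def)
    then have "of_real (gauss2 \<xi>) * (LINT x|lborel. (of_real x * zmono m n x \<xi>) * of_real (gauss2 x)) =
        of_real (gauss2 \<xi>) * (LINT x|lborel. ?D x \<xi> * of_real (gauss2 x))" by (simp only:)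
    then show "(LINT x|lborel. (of_real x * zmono m n x \<xi>) * of_real (gauss2 x * gauss2 \<xi>)) =
        (LINT x|lborel. ?D x \<xi> * of_real (gauss2 x * gauss2 \<xi>))"
      by (simp only: integral_mult_right_zero[symmetric] of_real_mult ac_simps)
  qed
  also have "\<dots> = (LINT w|lborel. ?D (fst w) (snd w) * of_real (gauss2 (fst w) * gauss2 (snd w)))"
    by (subst lborel_pair_integral(1)[OF int]) simp
  also have "\<dots> = ?c * (of_nat m * gmoment (m - 1) n + of_nat n * gmoment m (n - 1))"
    unfolding D gmoment_def
    by (simp only: integral_mult_right_zero Bochner_Integration.integral_add[OF integrable_mult_right integrable_mult_right, OF integrable_zmono integrable_zmono])
  finally show ?thesis .
qed

lemma gmoment_snd:
  "(LINT w|lborel. (of_real (snd w) * zmono m n (fst w) (snd w)) * of_real (gauss2 (fst w) * gauss2 (snd w))) =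
    \<i> * of_real (1 / sqrt 2) * (of_nat n * gmoment m (n - 1) - of_nat m * gmoment (m - 1) n)"
proof -
  let ?c = "\<i> * complex_of_real (1 / sqrt 2)"
  let ?D = "\<lambda>x \<xi>. ?c * (of_nat n * zmono m (n - 1) x \<xi> - of_nat m * zmono (m - 1) n x \<xi>)"
  have D: "(\<lambda>w. ?D (fst w) (snd w) * of_real (gauss2 (fst w) * gauss2 (snd w))) =
      (\<lambda>w. ?c * (of_nat n * (zmono m (n - 1) (fst w) (snd w) * of_real (gauss2 (fst w) * gauss2 (snd w))) -
        of_nat m * (zmono (m - 1) n (fst w) (snd w) * of_real (gauss2 (fst w) * gauss2 (snd w)))))"
    by (simp add: fun_eq_iff algebra_simps)
  have int: "integrable lborel (\<lambda>w. ?D (fst w) (snd w) * of_real (gauss2 (fst w) * gauss2 (snd w)))"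
    unfolding D by (intro integrable_mult_right Bochner_Integration.integrable_diff integrable_zmono)
  have "(LINT w|lborel. (of_real (snd w) * zmono m n (fst w) (snd w)) * of_real (gauss2 (fst w) * gauss2 (snd w))) =
      (LINT x|lborel. LINT \<xi>|lborel. (of_real \<xi> * zmono m n x \<xi>) * of_real (gauss2 x * gauss2 \<xi>))"
    by (subst lborel_pair_integral(2)[OF integrable_coord_zmono(2)]) simp
  also have "\<dots> = (LINT x|lborel. LINT \<xi>|lborel. ?D x \<xi> * of_real (gauss2 x * gauss2 \<xi>))"
  proof (rule Bochner_Integration.integral_cong[OF refl])
    fix x :: real
    have "(LINT \<xi>|lborel. ?D x \<xi> * of_real (exp (- (1 / 2) * \<xi>\<^sup>2))) =
      (LINT \<xi>|lborel. of_real (2 * (1 / 2) * \<xi>) * zmono m n x \<xi> * of_real (exp (- (1 / 2) * \<xi>\<^sup>2)))"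
    proof (rule gauss_integration_by_parts[OF exp_growth_zmono(2) _ zmono_derivative(2)])
      have "?D x = (\<lambda>\<xi>. ?c * (of_nat n * zmono m (n - 1) x \<xi> + (- of_nat m) * zmono (m - 1) n x \<xi>))"
        by (simp add: fun_eq_iff)
      moreover have "exp_growth (\<lambda>\<xi>. ?c * (of_nat n * zmono m (n - 1) x \<xi> + (- of_nat m) * zmono (m - 1) n x \<xi>))"
        by (intro exp_growth_add exp_growth_mult exp_growth_const exp_growth_zmono)
      ultimately show "exp_growth (?D x)" by (simp only:)
    qed simp
    then have "(LINT \<xi>|lborel. (of_real \<xi> * zmono m n x \<xi>) * of_real (gauss2 \<xi>)) = (LINT \<xi>|lborel. ?D x \<xi> * of_real (gauss2 \<xi>))"
      by (simp add: gauss2_def)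
    then have "of_real (gauss2 x) * (LINT \<xi>|lborel. (of_real \<xi> * zmono m n x \<xi>) * of_real (gauss2 \<xi>)) =
        of_real (gauss2 x) * (LINT \<xi>|lborel. ?D x \<xi> * of_real (gauss2 \<xi>))" by (simp only:)
    then show "(LINT \<xi>|lborel. (of_real \<xi> * zmono m n x \<xi>) * of_real (gauss2 x * gauss2 \<xi>)) =
        (LINT \<xi>|lborel. ?D x \<xi> * of_real (gauss2 x * gauss2 \<xi>))"
      by (simp only: integral_mult_right_zero[symmetric] of_real_mult ac_simps)
  qed
  also have "\<dots> = (LINT w|lborel. ?D (fst w) (snd w) * of_real (gauss2 (fst w) * gauss2 (snd w)))"
    by (subst lborel_pair_integral(2)[OF int]) simp
  also have "\<dots> = ?c * (of_nat n * gmoment m (n - 1) - of_nat m * gmoment (m - 1) n)"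
    unfolding D gmoment_def
    by (simp only: integral_mult_right_zero Bochner_Integration.integral_diff[OF integrable_mult_right integrable_mult_right, OF integrable_zmono integrable_zmono])
  finally show ?thesis .
qed

text \<open>One factor z is written as (x - i \<xi>) / sqrt 2 and both parts are integrated by
  parts. The terms with d/dz cancel: under the Gaussian integral, multiplication by z acts like
  differentiation in cnj z.\<close>

lemma gmoment_Suc: "gmoment (Suc m) n = of_nat n * gmoment m (n - 1)"
proof -
  let ?c = "complex_of_real (1 / sqrt 2)" and ?g = "\<lambda>w. complex_of_real (gauss2 (fst w) * gauss2 (snd w))"
  have cc: "?c * ?c = 1 / 2" by (simp only: of_real_mult[symmetric]) simp
  have "gmoment (Suc m) n = (LINT w|lborel. ?c * ((of_real (fst w) * zmono m n (fst w) (snd w)) * ?g w)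
      - \<i> * ?c * ((of_real (snd w) * zmono m n (fst w) (snd w)) * ?g w))"
    unfolding gmoment_def
  proof (rule Bochner_Integration.integral_cong[OF refl])
    fix w :: "real \<times> real"
    have "zmono (Suc m) n (fst w) (snd w) = phase_z (fst w) (snd w) * zmono m n (fst w) (snd w)"
      by (simp add: zmono_def)
    also have "phase_z (fst w) (snd w) = of_real (fst w) * ?c - \<i> * (of_real (snd w) * ?c)"
      by (simp only: phase_z_alt of_real_mult)
    finally have z: "zmono (Suc m) n (fst w) (snd w) =
        (of_real (fst w) * ?c - \<i> * (of_real (snd w) * ?c)) * zmono m n (fst w) (snd w)" .
    show "zmono (Suc m) n (fst w) (snd w) * ?g w = ?c * ((of_real (fst w) * zmono m n (fst w) (snd w)) * ?g w)
      - \<i> * ?c * ((of_real (snd w) * zmono m n (fst w) (snd w)) * ?g w)"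
      unfolding z left_diff_distrib by (simp only: ac_simps)
  qed
  also have "\<dots> = ?c * (LINT w|lborel. (of_real (fst w) * zmono m n (fst w) (snd w)) * ?g w)
      - \<i> * ?c * (LINT w|lborel. (of_real (snd w) * zmono m n (fst w) (snd w)) * ?g w)"
    by (simp only: integral_mult_right_zero Bochner_Integration.integral_diff[OF integrable_mult_right integrable_mult_right, OF integrable_coord_zmono])
  also have "\<dots> = (?c * ?c) * (of_nat m * gmoment (m - 1) n + of_nat n * gmoment m (n - 1))
      - (\<i> * \<i>) * (?c * ?c) * (of_nat n * gmoment m (n - 1) - of_nat m * gmoment (m - 1) n)"
    unfolding gmoment_fst gmoment_snd by (simp only: ac_simps)
  also have "\<dots> = of_nat n * gmoment m (n - 1)"
    unfolding cc by (simp add: algebra_simps)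
  finally show ?thesis .
qed

lemma gmoment_cnj: "gmoment m n = cnj (gmoment n m)"
proof -
  have "cnj (gmoment n m) = (LINT w|lborel. cnj (zmono n m (fst w) (snd w) * of_real (gauss2 (fst w) * gauss2 (snd w))))"
    unfolding gmoment_def by (rule Bochner_Integration.integral_cnj[symmetric])
  also have "\<dots> = gmoment m n"
    unfolding gmoment_def by (rule Bochner_Integration.integral_cong) (simp_all add: zmono_def mult.commute)
  finally show ?thesis by simp
qed

lemma gmoment_0: "gmoment 0 0 = of_real (2 * pi)"
proof -
  have g: "(LINT x|lborel. gauss2 x) = sqrt (2 * pi)"
  proof -
    have "sqrt (2 * pi) * std_normal_density x = gauss2 x" for x
      by (simp add: std_normal_density_def gauss2_def)
    then have "(LINT x|lborel. gauss2 x) = (LINT x|lborel. sqrt (2 * pi) * std_normal_density x)" by simp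
    also have "\<dots> = sqrt (2 * pi) * 1" by (simp only: integral_mult_right_zero) simp
    finally show ?thesis by simp
  qed
  have "gmoment 0 0 = (LINT \<xi>|lborel. LINT x|lborel. complex_of_real (gauss2 x * gauss2 \<xi>))"
    using lborel_pair_integral(1)[OF integrable_zmono[of 0 0]] by (simp add: gmoment_def zmono_def)
  also have "\<dots> = of_real (LINT \<xi>|lborel. LINT x|lborel. gauss2 x * gauss2 \<xi>)"
    by (simp only: integral_complex_of_real)
  also have "(LINT \<xi>|lborel. LINT x|lborel. gauss2 x * gauss2 \<xi>) = sqrt (2 * pi) * sqrt (2 * pi)"
    by (simp add: g)
  finally show ?thesis by simp
qed

lemma gmoment_eq: "gmoment m n = (if m = n then of_real (2 * pi * fact m) else 0)"
proof (induction m arbitrary: n)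
  case 0
  show ?case
  proof (cases n)
    case (Suc k)
    \<comment> \<open>The recursion starts from a positive first exponent; conjugation brings the
      case \<open>m = 0\<close> to this form, and there \<open>gmoment_Suc\<close> supplies the
      factor \<open>0\<close>.\<close>
    have "gmoment 0 (Suc k) = cnj (gmoment (Suc k) 0)" by (rule gmoment_cnj)
    then show ?thesis by (simp add: gmoment_Suc Suc)
  qed (simp add: gmoment_0)
next
  case (Suc m)
  show ?case
    by (cases n) (simp_all add: gmoment_Suc Suc.IH)
qed

section \<open>Lebesgue measure as a product over coordinates\<close>

lemma prod_Basis_vec: "(\<Prod>b\<in>(Basis :: (real^'n) set). f b) = (\<Prod>i\<in>(UNIV :: 'n::finite set). f (axis i 1))"
proof -
  have 1: "(Basis :: (real^'n) set) = (\<lambda>i. axis i 1) ` UNIV" by (auto simp: Basis_vec_def)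
  have 2: "inj (\<lambda>i::'n. axis i (1::real))" by (auto simp: inj_on_def axis_eq_axis)
  show ?thesis unfolding 1 by (subst prod.reindex[OF 2]) simp
qed

lemma prod_Basis_prod:
  "(\<Prod>b\<in>(Basis :: ('a::euclidean_space \<times> 'b::euclidean_space) set). f b) = (\<Prod>b\<in>Basis. f (b, 0)) * (\<Prod>b\<in>Basis. f (0, b))"
proof -
  have "inj (\<lambda>b::'a. (b, 0::'b))" "inj (\<lambda>b::'b. (0::'a, b))" by (auto simp: inj_on_def)
  then show ?thesis
    unfolding Basis_prod_def
    by (subst prod.union_disjoint) (auto simp: prod.reindex inj_on_def)
qed

lemma emeasure_PiM_box:
  fixes l u :: "'n::finite \<Rightarrow> 'b::euclidean_space"
  assumes "\<And>i b. b \<in> Basis \<Longrightarrow> l i \<bullet> b \<le> u i \<bullet> b"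
  shows "emeasure (PiM UNIV (\<lambda>_. lborel)) (PiE UNIV (\<lambda>i. box (l i) (u i))) = ennreal (\<Prod>i\<in>UNIV. \<Prod>b\<in>Basis. (u i - l i) \<bullet> b)"
proof -
  interpret product_sigma_finite "\<lambda>_::'n. lborel :: 'b measure" by standard
  have "emeasure (PiM UNIV (\<lambda>_. lborel)) (PiE UNIV (\<lambda>i. box (l i) (u i))) = (\<Prod>i\<in>UNIV. emeasure lborel (box (l i) (u i)))"
    by (rule emeasure_PiM) auto
  also have "\<dots> = (\<Prod>i\<in>UNIV. ennreal (\<Prod>b\<in>Basis. (u i - l i) \<bullet> b))"
    using assms by (intro prod.cong refl emeasure_lborel_box) auto
  also have "\<dots> = ennreal (\<Prod>i\<in>UNIV. \<Prod>b\<in>Basis. (u i - l i) \<bullet> b)"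
    using assms by (intro prod_ennreal prod_nonneg) (auto simp: inner_diff_left)
  finally show ?thesis .
qed

definition vec_of :: "('n::finite \<Rightarrow> real) \<Rightarrow> real^'n" where
  "vec_of f = (\<chi> i. f i)"

text \<open>Coordinates are grouped into pairs of a position and a frequency, so that phase space
  integrals split into planar ones, one for each complex variable.\<close>

definition phase_of :: "('n::finite \<Rightarrow> real \<times> real) \<Rightarrow> (real^'n) \<times> (real^'n)" where
  "phase_of f = ((\<chi> i. fst (f i)), (\<chi> i. snd (f i)))"

lemma vec_of_measurable [measurable]: "vec_of \<in> borel_measurable (PiM UNIV (\<lambda>_. lborel))"
  unfolding borel_measurable_euclidean_space[of vec_of]
proof
  fix b :: "real^'n" assume "b \<in> Basis"
  then obtain i where b: "b = axis i 1" by (auto simp: Basis_vec_def)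
  have "(\<lambda>f. f i) \<in> measurable (PiM UNIV (\<lambda>_. lborel :: real measure)) lborel"
    by (rule measurable_component_singleton) simp
  then show "(\<lambda>f. vec_of f \<bullet> b) \<in> borel_measurable (PiM UNIV (\<lambda>_. lborel))"
    unfolding b vec_of_def cart_eq_inner_axis[symmetric] by simp
qed

lemma phase_of_measurable [measurable]: "phase_of \<in> borel_measurable (PiM UNIV (\<lambda>_. lborel))"
proof -
  have c: "(\<lambda>f. f i) \<in> measurable (PiM UNIV (\<lambda>_. lborel :: (real \<times> real) measure)) lborel" for i :: 'n
    by (rule measurable_component_singleton) simp
  have 1: "(\<lambda>f. (\<chi> i. fst (f i)) :: real^'n) \<in> borel_measurable (PiM UNIV (\<lambda>_. lborel :: (real \<times> real) measure))"
    unfolding borel_measurable_euclidean_space[of "\<lambda>f. \<chi> i. fst (f i)"]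
  proof
    fix b :: "real^'n" assume "b \<in> Basis"
    then obtain i where b: "b = axis i 1" by (auto simp: Basis_vec_def)
    have "(\<lambda>f. fst (f i)) \<in> borel_measurable (PiM UNIV (\<lambda>_. lborel :: (real \<times> real) measure))"
      by (rule measurable_compose[OF c]) (simp add: borel_measurable_continuous_onI continuous_on_fst continuous_on_id)
    then show "(\<lambda>f. (\<chi> i. fst (f i)) \<bullet> b) \<in> borel_measurable (PiM UNIV (\<lambda>_. lborel :: (real \<times> real) measure))"
      unfolding b cart_eq_inner_axis[symmetric] by simp
  qed
  have 2: "(\<lambda>f. (\<chi> i. snd (f i)) :: real^'n) \<in> borel_measurable (PiM UNIV (\<lambda>_. lborel :: (real \<times> real) measure))"
    unfolding borel_measurable_euclidean_space[of "\<lambda>f. \<chi> i. snd (f i)"]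
  proof
    fix b :: "real^'n" assume "b \<in> Basis"
    then obtain i where b: "b = axis i 1" by (auto simp: Basis_vec_def)
    have "(\<lambda>f. snd (f i)) \<in> borel_measurable (PiM UNIV (\<lambda>_. lborel :: (real \<times> real) measure))"
      by (rule measurable_compose[OF c]) (simp add: borel_measurable_continuous_onI continuous_on_snd continuous_on_id)
    then show "(\<lambda>f. (\<chi> i. snd (f i)) \<bullet> b) \<in> borel_measurable (PiM UNIV (\<lambda>_. lborel :: (real \<times> real) measure))"
      unfolding b cart_eq_inner_axis[symmetric] by simp
  qed
  show ?thesis unfolding phase_of_def by (rule borel_measurable_Pair[OF 1 2])
qed

text \<open>Lebesgue measure is determined by its values on boxes, and preimages of boxes under
  \<open>vec_of\<close> are product sets.\<close>

lemma lborel_vec: "(lborel :: (real^'n::finite) measure) = distr (PiM UNIV (\<lambda>_. lborel)) borel vec_of"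
proof (rule lborel_eqI)
  fix l u :: "real^'n" assume le: "\<And>b. b \<in> Basis \<Longrightarrow> l \<bullet> b \<le> u \<bullet> b"
  have le': "l $ i \<le> u $ i" for i
    using le[of "axis i 1"] by (simp add: cart_eq_inner_axis axis_in_Basis_iff)
  have "vec_of -` box l u \<inter> space (PiM UNIV (\<lambda>_. lborel)) = PiE UNIV (\<lambda>i. box (l $ i) (u $ i))"
    by (auto simp: space_PiM vec_of_def mem_box_cart PiE_iff)
  then have "emeasure (distr (PiM UNIV (\<lambda>_. lborel)) borel vec_of) (box l u) =
      emeasure (PiM UNIV (\<lambda>_. lborel)) (PiE UNIV (\<lambda>i. box (l $ i) (u $ i)))"
    by (subst emeasure_distr) auto
  also have "\<dots> = ennreal (\<Prod>i\<in>UNIV. \<Prod>b\<in>Basis. (u $ i - l $ i) \<bullet> b)"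
    by (rule emeasure_PiM_box) (use le' in simp)
  also have "(\<Prod>i\<in>UNIV. \<Prod>b\<in>Basis. (u $ i - l $ i) \<bullet> b) = (\<Prod>b\<in>Basis. (u - l) \<bullet> b)"
    unfolding prod_Basis_vec by (simp add: cart_eq_inner_axis[symmetric] del: inner_diff_left)
  finally show "emeasure (distr (PiM UNIV (\<lambda>_. lborel)) borel vec_of) (box l u) = ennreal (\<Prod>b\<in>Basis. (u - l) \<bullet> b)" .
qed simp

lemma lborel_phase: "(lborel :: ((real^'n::finite) \<times> (real^'n)) measure) = distr (PiM UNIV (\<lambda>_. lborel)) borel phase_of"
proof (rule lborel_eqI)
  fix l u :: "(real^'n) \<times> (real^'n)" assume le: "\<And>b. b \<in> Basis \<Longrightarrow> l \<bullet> b \<le> u \<bullet> b"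
  have le': "fst l $ i \<le> fst u $ i" "snd l $ i \<le> snd u $ i" for i
    using le[of "(axis i 1, 0)"] le[of "(0, axis i 1)"]
    by (simp_all add: cart_eq_inner_axis axis_in_Basis_iff Basis_prod_def inner_prod_def)
  let ?l = "\<lambda>i. (fst l $ i, snd l $ i)" and ?u = "\<lambda>i. (fst u $ i, snd u $ i)"
  have bp: "(x, y) \<in> box a b \<longleftrightarrow> x \<in> box (fst a) (fst b) \<and> y \<in> box (snd a) (snd b)"
    for x :: "'x::euclidean_space" and y :: "'y::euclidean_space" and a b
    by (auto simp: mem_box Basis_prod_def inner_prod_def ball_Un)
  have "phase_of -` box l u \<inter> space (PiM UNIV (\<lambda>_. lborel)) = PiE UNIV (\<lambda>i. box (?l i) (?u i))"
    by (auto simp: space_PiM phase_of_def bp mem_box_cart PiE_iff prod_eq_iff)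
      (metis bp fst_conv prod.collapse snd_conv box_real(1) greaterThanLessThan_iff)+
  then have "emeasure (distr (PiM UNIV (\<lambda>_. lborel)) borel phase_of) (box l u) =
      emeasure (PiM UNIV (\<lambda>_. lborel)) (PiE UNIV (\<lambda>i. box (?l i) (?u i)))"
    by (subst emeasure_distr) auto
  also have "\<dots> = ennreal (\<Prod>i\<in>UNIV. \<Prod>b\<in>Basis. (?u i - ?l i) \<bullet> b)"
    by (rule emeasure_PiM_box) (use le' in \<open>auto simp: Basis_prod_def inner_prod_def\<close>)
  also have "(\<Prod>i\<in>UNIV. \<Prod>b\<in>Basis. (?u i - ?l i) \<bullet> b) = (\<Prod>b\<in>Basis. (u - l) \<bullet> b)"
    unfolding prod_Basis_prod prod_Basis_vec
    by (simp add: cart_eq_inner_axis[symmetric] inner_prod_def prod.distrib del: inner_diff_left)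
  finally show "emeasure (distr (PiM UNIV (\<lambda>_. lborel)) borel phase_of) (box l u) = ennreal (\<Prod>b\<in>Basis. (u - l) \<bullet> b)" .
qed simp

lemma vec_prod_integral:
  fixes F :: "'n::finite \<Rightarrow> real \<Rightarrow> complex"
  assumes F: "\<And>i. integrable lborel (F i)"
  shows "integrable lborel (\<lambda>y::real^'n. \<Prod>i\<in>UNIV. F i (y $ i))"
    and "(LINT y|lborel. (\<Prod>i\<in>UNIV. F i ((y::real^'n) $ i))) = (\<Prod>i\<in>UNIV. LINT t|lborel. F i t)"
proof -
  interpret product_sigma_finite "\<lambda>_::'n. lborel :: real measure" by standard
  have [measurable]: "F i \<in> borel_measurable borel" for i using borel_measurable_integrable[OF F] by simp
  have m: "(\<lambda>y::real^'n. \<Prod>i\<in>UNIV. F i (y $ i)) \<in> borel_measurable borel"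
  proof (rule borel_measurable_prod)
    fix i :: 'n
    have "(\<lambda>y::real^'n. y $ i) \<in> borel_measurable borel"
      by (intro borel_measurable_continuous_onI continuous_intros)
    then show "(\<lambda>y::real^'n. F i (y $ i)) \<in> borel_measurable borel" by measurable
  qed
  have eq: "(\<lambda>f. \<Prod>i\<in>UNIV. F i (vec_of f $ i)) = (\<lambda>f. \<Prod>i\<in>UNIV. F i (f i))" by (simp add: vec_of_def)
  show "integrable lborel (\<lambda>y::real^'n. \<Prod>i\<in>UNIV. F i (y $ i))"
    unfolding lborel_vec
    by (subst integrable_distr_eq[OF vec_of_measurable m]) (simp add: eq product_integrable_prod F)
  show "(LINT y|lborel. (\<Prod>i\<in>UNIV. F i ((y::real^'n) $ i))) = (\<Prod>i\<in>UNIV. LINT t|lborel. F i t)"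
    unfolding lborel_vec
    by (subst integral_distr[OF vec_of_measurable m]) (simp add: eq product_integral_prod F)
qed

lemma phase_prod_integral:
  fixes F :: "'n::finite \<Rightarrow> real \<times> real \<Rightarrow> complex"
  assumes F: "\<And>i. integrable lborel (F i)"
  shows "integrable lborel (\<lambda>w::(real^'n) \<times> (real^'n). \<Prod>i\<in>UNIV. F i (fst w $ i, snd w $ i))"
    and "(LINT w|lborel. (\<Prod>i\<in>UNIV. F i (fst (w::(real^'n) \<times> (real^'n)) $ i, snd w $ i))) = (\<Prod>i\<in>UNIV. LINT t|lborel. F i t)"
proof -
  interpret product_sigma_finite "\<lambda>_::'n. lborel :: (real \<times> real) measure" by standard
  have [measurable]: "F i \<in> borel_measurable borel" for i using borel_measurable_integrable[OF F] by simp
  have m: "(\<lambda>w::(real^'n) \<times> (real^'n). \<Prod>i\<in>UNIV. F i (fst w $ i, snd w $ i)) \<in> borel_measurable borel"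
  proof (rule borel_measurable_prod)
    fix i :: 'n
    have "(\<lambda>w::(real^'n) \<times> (real^'n). (fst w $ i, snd w $ i)) \<in> borel_measurable borel"
      by (intro borel_measurable_continuous_onI continuous_intros)
    then show "(\<lambda>w::(real^'n) \<times> (real^'n). F i (fst w $ i, snd w $ i)) \<in> borel_measurable borel"
      by (rule measurable_compose) measurable
  qed
  have eq: "(\<lambda>f. \<Prod>i\<in>UNIV. F i (fst (phase_of f) $ i, snd (phase_of f) $ i)) = (\<lambda>f. \<Prod>i\<in>UNIV. F i (f i))" by (simp add: phase_of_def)
  show "integrable lborel (\<lambda>w::(real^'n) \<times> (real^'n). \<Prod>i\<in>UNIV. F i (fst w $ i, snd w $ i))"
    unfolding lborel_phase
    by (subst integrable_distr_eq[OF phase_of_measurable m]) (simp add: eq product_integrable_prod F)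
  show "(LINT w|lborel. (\<Prod>i\<in>UNIV. F i (fst (w::(real^'n) \<times> (real^'n)) $ i, snd w $ i))) = (\<Prod>i\<in>UNIV. LINT t|lborel. F i t)"
    unfolding lborel_phase
    by (subst integral_distr[OF phase_of_measurable m]) (simp add: eq product_integral_prod F)
qed

section \<open>The matrix of a Toeplitz operator\<close>

lemma norm_vec_sq: "(norm (y :: real^'n::finite))\<^sup>2 = (\<Sum>j\<in>UNIV. (y $ j)\<^sup>2)"
  unfolding norm_vec_def L2_set_def by (simp add: sum_nonneg)

definition gauss_mderiv :: "('n::finite) mindex \<Rightarrow> real^'n \<Rightarrow> real" where
  "gauss_mderiv m x = (\<Prod>j\<in>UNIV. gauss_deriv (m j) (x $ j))"

lemma partial_gauss_mderiv: "partial i (gauss_mderiv m) = gauss_mderiv (m(i := Suc (m i)))"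
proof
  fix x :: "real^'a"
  let ?C = "\<Prod>j\<in>UNIV - {i}. gauss_deriv (m j) (x $ j)"
  have "gauss_mderiv m (x + t *\<^sub>R axis i 1) = gauss_deriv (m i) (x $ i + t) * ?C" for t
  proof -
    have "(x + t *\<^sub>R axis i 1) $ i = x $ i + t" by (simp add: axis_def)
    moreover have "(\<Prod>j\<in>UNIV - {i}. gauss_deriv (m j) ((x + t *\<^sub>R axis i 1) $ j)) = ?C"
      by (rule prod.cong) (auto simp: axis_def)
    ultimately show ?thesis
      unfolding gauss_mderiv_def by (subst prod.remove[of UNIV i]) simp_all
  qed
  then have f: "(\<lambda>t. gauss_mderiv m (x + t *\<^sub>R axis i 1)) = (\<lambda>t. gauss_deriv (m i) (x $ i + t) * ?C)"
    by (rule ext)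
  have "((\<lambda>t. gauss_deriv (m i) (x $ i + t)) has_real_derivative gauss_deriv (Suc (m i)) (x $ i + 0)) (at 0)"
    using gauss_deriv_has_derivative[of "m i" "x $ i + 0"] DERIV_shift[of "gauss_deriv (m i)" _ 0 "x $ i"]
    by (simp add: add.commute)
  then have "((\<lambda>t. gauss_deriv (m i) (x $ i + t) * ?C) has_real_derivative gauss_deriv (Suc (m i)) (x $ i + 0) * ?C) (at 0)"
    by (rule DERIV_cmult_right)
  then have "partial i (gauss_mderiv m) x = gauss_deriv (Suc (m i)) (x $ i) * ?C"
    unfolding partial_def f by (simp add: DERIV_imp_deriv)
  also have "\<dots> = gauss_mderiv (m(i := Suc (m i))) x"
    unfolding gauss_mderiv_def by (rule sym, subst prod.remove[of UNIV i]) (auto intro!: prod.cong)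
  finally show "partial i (gauss_mderiv m) x = gauss_mderiv (m(i := Suc (m i))) x" .
qed

lemma partial_pow_gauss_mderiv: "(partial i ^^ k) (gauss_mderiv m) = gauss_mderiv (m(i := m i + k))"
  by (induction k) (auto simp: partial_gauss_mderiv fun_upd_def intro!: arg_cong[where f = gauss_mderiv])

text \<open>Each partial derivative raises only its own order, so any enumeration of the coordinates
  without repetition, in particular the chosen one, leads to \<open>\<alpha>\<close>.\<close>

lemma mderiv_gauss:
  "mderiv \<alpha> (\<lambda>y :: real^'n::finite. exp (- (norm y)\<^sup>2)) = gauss_mderiv \<alpha>"
proof -
  have f: "foldr (\<lambda>i. partial i ^^ \<alpha> i) xs (gauss_mderiv (\<lambda>_. 0)) = gauss_mderiv (\<lambda>j. if j \<in> set xs then \<alpha> j else 0)"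
    if "distinct xs" for xs
    using that
  proof (induction xs)
    case (Cons i xs)
    have "(\<lambda>j. if j \<in> set xs then \<alpha> j else 0)(i := (if i \<in> set xs then \<alpha> i else 0) + \<alpha> i) =
        (\<lambda>j. if j \<in> set (i # xs) then \<alpha> j else 0)" using Cons.prems by auto
    then show ?case using Cons by (simp only: foldr.simps o_apply distinct.simps partial_pow_gauss_mderiv)
  qed (simp add: fun_eq_iff)
  have "\<exists>is::'n list. distinct is \<and> set is = UNIV" using finite_distinct_list[of "UNIV :: 'n set"] by auto
  from someI_ex[OF this] have s: "distinct (SOME is::'n list. distinct is \<and> set is = UNIV)"
    "set (SOME is::'n list. distinct is \<and> set is = UNIV) = UNIV" by auto
  have "(\<lambda>y :: real^'n. exp (- (norm y)\<^sup>2)) = gauss_mderiv (\<lambda>_. 0)"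
    by (simp add: fun_eq_iff gauss_mderiv_def gauss_deriv_0 norm_vec_sq exp_sum[symmetric] sum_negf)
  then show ?thesis unfolding mderiv_def using f[OF s(1)] s(2) by simp
qed

section \<open>Hermite functions and their short-time Fourier transforms\<close>

definition hermite1 :: "nat \<Rightarrow> real \<Rightarrow> real" where
  "hermite1 k t = pi powr (- 1 / 4) * (-1) ^ k * (2 ^ k * fact k) powr (- 1 / 2) * exp (t\<^sup>2 / 2) * gauss_deriv k t"

definition gauss1 :: "real \<Rightarrow> real" where
  "gauss1 t = pi powr (- 1 / 4) * exp (- t\<^sup>2 / 2)"

lemma hermite_eq_prod: "hermite \<alpha> (x :: real^'n::finite) = (\<Prod>j\<in>UNIV. hermite1 (\<alpha> j) (x $ j))"
proof -
  have "pi powr (- real CARD('n) / 4) = (\<Prod>j\<in>(UNIV :: 'n set). pi powr (- 1 / 4))"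
    by (simp add: powr_power)
  moreover have "(-1 :: real) ^ mlen \<alpha> = (\<Prod>j\<in>UNIV. (-1) ^ \<alpha> j)" by (simp add: mlen_def power_sum)
  moreover have "(2 ^ mlen \<alpha> * mfact \<alpha>) powr (- 1 / 2) = (\<Prod>j\<in>UNIV. (2 ^ \<alpha> j * fact (\<alpha> j)) powr (- 1 / 2))"
  proof -
    have "2 ^ mlen \<alpha> * mfact \<alpha> = (\<Prod>j\<in>UNIV. 2 ^ \<alpha> j * fact (\<alpha> j))"
      by (simp add: mlen_def power_sum mfact_def prod.distrib)
    then show ?thesis by (simp only: prod_powr_distrib)
  qed
  moreover have "exp ((norm x)\<^sup>2 / 2) = (\<Prod>j\<in>UNIV. exp ((x $ j)\<^sup>2 / 2))"
    by (simp add: norm_vec_sq exp_sum[symmetric] sum_divide_distrib)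
  ultimately show ?thesis
    unfolding hermite_def mderiv_gauss gauss_mderiv_def hermite1_def by (simp only: prod.distrib)
qed

lemma gauss_eq_prod: "gauss (x :: real^'n::finite) = of_real (\<Prod>j\<in>UNIV. gauss1 (x $ j))"
proof -
  have "pi powr (- real CARD('n) / 4) = (\<Prod>j\<in>(UNIV :: 'n set). pi powr (- 1 / 4))"
    by (simp add: powr_power)
  moreover have "exp (- (norm x)\<^sup>2 / 2) = (\<Prod>j\<in>UNIV. exp (- (x $ j)\<^sup>2 / 2))"
    by (simp add: norm_vec_sq exp_sum[symmetric] sum_divide_distrib sum_negf)
  ultimately show ?thesis unfolding gauss_def gauss1_def by (simp only: prod.distrib)
qed

text \<open>The factor between the short-time Fourier transform and the Bargmann transform, up to a
  constant. Its squared modulus is the Gaussian of the moments, see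
  \<open>bargmann_factor_norm\<close>.\<close>

definition bargmann_factor :: "real \<Rightarrow> real \<Rightarrow> complex" where
  "bargmann_factor x \<xi> = exp ((Complex x (- \<xi>))\<^sup>2 / 4 - of_real (x\<^sup>2 / 2))"

lemma bargmann_factor_norm: "bargmann_factor x \<xi> * cnj (bargmann_factor x \<xi>) = of_real (gauss2 x * gauss2 \<xi>)"
proof -
  let ?w = "(Complex x (- \<xi>))\<^sup>2 / 4 - of_real (x\<^sup>2 / 2)"
  have "?w + cnj ?w = of_real (- (1 / 2) * x\<^sup>2 + - (1 / 2) * \<xi>\<^sup>2)"
    by (rule complex_eqI) (simp_all add: power2_eq_square field_simps)
  then show ?thesis
    unfolding bargmann_factor_def gauss2_def exp_cnj exp_add[symmetric] by (simp only: exp_of_real)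
qed

definition stft1_integrand :: "nat \<Rightarrow> real \<Rightarrow> real \<Rightarrow> real \<Rightarrow> complex" where
  "stft1_integrand k x \<xi> y = of_real (hermite1 k y) * of_real (gauss1 (y - x)) * exp (- \<i> * of_real (y * \<xi>))"

text \<open>The terms quadratic in \<open>y\<close> from the prefactor of the Hermite function and
  from the window cancel, leaving \<open>exp (x * y)\<close>; together with the oscillation this is
  a Laplace integrand at x - i \<xi>.\<close>

lemma stft1_integrand_eq:
  "stft1_integrand k x \<xi> y = of_real (pi powr (- 1 / 2) * (-1) ^ k * (2 ^ k * fact k) powr (- 1 / 2) * exp (- (x\<^sup>2 / 2))) *
    (of_real (gauss_deriv k y) * exp (Complex x (- \<xi>) * of_real y))"
proof -
  have p: "pi powr (- 1 / 4) * pi powr (- 1 / 4) = pi powr (- 1 / 2)" by (simp add: powr_add[symmetric])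
  have "exp (y\<^sup>2 / 2) * exp (- (y - x)\<^sup>2 / 2) = exp (- (x\<^sup>2 / 2)) * exp (x * y)"
    unfolding exp_add[symmetric] by (rule arg_cong[where f = exp]) (simp add: power2_eq_square field_simps)
  moreover have "hermite1 k y * gauss1 (y - x) = (pi powr (- 1 / 4) * pi powr (- 1 / 4)) * (-1) ^ k *
      (2 ^ k * fact k) powr (- 1 / 2) * (exp (y\<^sup>2 / 2) * exp (- (y - x)\<^sup>2 / 2)) * gauss_deriv k y"
    unfolding hermite1_def gauss1_def by (simp only: ac_simps)
  ultimately have r: "hermite1 k y * gauss1 (y - x) =
      (pi powr (- 1 / 2) * (-1) ^ k * (2 ^ k * fact k) powr (- 1 / 2) * exp (- (x\<^sup>2 / 2))) * (gauss_deriv k y * exp (x * y))"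
    unfolding p by (simp only: ac_simps)
  have "exp (Complex x (- \<xi>) * of_real y) = exp (of_real (x * y) + - \<i> * of_real (y * \<xi>))"
    by (rule arg_cong[where f = exp]) (rule complex_eqI, simp_all)
  also have "\<dots> = of_real (exp (x * y)) * exp (- \<i> * of_real (y * \<xi>))"
    by (simp only: exp_add exp_of_real)
  finally have e: "exp (Complex x (- \<xi>) * of_real y) = of_real (exp (x * y)) * exp (- \<i> * of_real (y * \<xi>))" .
  show ?thesis
    unfolding stft1_integrand_def e of_real_mult[symmetric] r by (simp only: of_real_mult mult.assoc)
qed

lemma stft1_integrable: "integrable lborel (stft1_integrand k x \<xi>)"
  unfolding stft1_integrand_eq[abs_def] by (intro integrable_mult_right integrable_gauss_deriv_exp)

text \<open>At \<zeta> = x - i \<xi> = sqrt 2 z the sign (-1)^k of the Hermite function cancels that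
  of (-\<zeta>)^k, and (sqrt 2)^k cancels the normalisation 2^(-k/2), leaving z^k / sqrt
  (k!).\<close>

lemma stft1_integral:
  "(LINT y|lborel. stft1_integrand k x \<xi> y) = bargmann_factor x \<xi> * phase_z x \<xi> ^ k / of_real (sqrt (fact k))"
proof -
  let ?c = "pi powr (- 1 / 2) * (-1) ^ k * (2 ^ k * fact k) powr (- 1 / 2) * exp (- (x\<^sup>2 / 2))"
  let ?\<zeta> = "Complex x (- \<xi>)"
  have z: "?\<zeta> = of_real (sqrt 2) * phase_z x \<xi>"
    by (rule complex_eqI) (simp_all add: phase_z_def)
  have "(LINT y|lborel. stft1_integrand k x \<xi> y) = of_real ?c * ((- ?\<zeta>) ^ k * (of_real (sqrt pi) * exp (?\<zeta>\<^sup>2 / 4)))"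
    unfolding stft1_integrand_eq by (simp only: integral_mult_right_zero laplace_gauss_deriv gauss_laplace)
  also have "(- ?\<zeta>) ^ k = of_real ((-1) ^ k * sqrt 2 ^ k) * phase_z x \<xi> ^ k"
    unfolding z by (simp add: power_mult_distrib power_minus[of "_ * _"])
  also have "of_real ?c * (of_real ((-1) ^ k * sqrt 2 ^ k) * phase_z x \<xi> ^ k * (of_real (sqrt pi) * exp (?\<zeta>\<^sup>2 / 4))) =
      of_real (pi powr (- 1 / 2) * sqrt pi * ((-1) ^ k * (-1) ^ k) * ((2 ^ k * fact k) powr (- 1 / 2) * sqrt 2 ^ k)) *
      (of_real (exp (- (x\<^sup>2 / 2))) * exp (?\<zeta>\<^sup>2 / 4)) * phase_z x \<xi> ^ k"
    by (simp only: of_real_mult ac_simps)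
  also have "pi powr (- 1 / 2) * sqrt pi * ((-1) ^ k * (-1) ^ k) * ((2 ^ k * fact k) powr (- 1 / 2) * sqrt 2 ^ k) = 1 / sqrt (fact k)"
  proof -
    have "pi powr (- 1 / 2) * sqrt pi = 1" by (simp add: powr_half_sqrt[symmetric] powr_add[symmetric])
    moreover have "(-1 :: real) ^ k * (-1) ^ k = 1" by (simp add: power_mult_distrib[symmetric])
    moreover have "(2 ^ k * fact k :: real) powr (- 1 / 2) * sqrt 2 ^ k = 1 / sqrt (fact k)"
      by (simp add: powr_minus_divide powr_half_sqrt real_sqrt_mult real_sqrt_power)
    ultimately show ?thesis by simp
  qed
  also have "of_real (exp (- (x\<^sup>2 / 2))) * exp (?\<zeta>\<^sup>2 / 4) = bargmann_factor x \<xi>"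
    unfolding bargmann_factor_def exp_of_real[symmetric] exp_add[symmetric] by simp
  finally show ?thesis by (simp add: field_simps)
qed

definition phase_vec :: "real^'n::finite \<Rightarrow> real^'n \<Rightarrow> complex^'n" where
  "phase_vec x \<xi> = (\<chi> i. phase_z (x $ i) (\<xi> $ i))"

lemma hermite_stft_integrand:
  "complex_of_real (hermite \<gamma> y) * cnj (gauss (y - x)) * exp (- \<i> * of_real (y \<bullet> \<xi>)) =
    (\<Prod>j\<in>UNIV. stft1_integrand (\<gamma> j) (x $ j) (\<xi> $ j) (y $ j))"
  for x y \<xi> :: "real^'n::finite"
proof -
  have "exp (- \<i> * of_real (y \<bullet> \<xi>)) = (\<Prod>j\<in>UNIV. exp (- \<i> * of_real (y $ j * \<xi> $ j)))"
    by (simp add: inner_vec_def exp_sum[symmetric] sum_distrib_left sum_negf)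
  then show ?thesis
    unfolding hermite_eq_prod gauss_eq_prod stft1_integrand_def
    by (simp add: prod.distrib)
qed

lemma stft_hermite_integrable:
  "integrable lborel (\<lambda>y. complex_of_real (hermite \<gamma> y) * cnj (gauss (y - x)) * exp (- \<i> * of_real (y \<bullet> \<xi>)))"
  unfolding hermite_stft_integrand by (rule vec_prod_integral(1)) (rule stft1_integrable)

lemma sqrt_prod: "sqrt (\<Prod>i\<in>A. f i) = (\<Prod>i\<in>A. sqrt (f i))"
  by (induction A rule: infinite_finite_induct) (auto simp: real_sqrt_mult)

text \<open>The Bargmann transform maps Hermite functions to the monomials \<open>e_mono\<close>;
  integrand and result factor over the coordinates.\<close>

lemma stft_hermite:
  fixes x \<xi> :: "real^'n::finite"
  shows "stft (\<lambda>y. of_real (hermite \<gamma> y)) x \<xi> = of_real ((2 * pi) powr (- real CARD('n) / 2)) *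
    (\<Prod>j\<in>UNIV. bargmann_factor (x $ j) (\<xi> $ j)) * e_mono \<gamma> (phase_vec x \<xi>)"
proof -
  have "stft (\<lambda>y. of_real (hermite \<gamma> y)) x \<xi> = of_real ((2 * pi) powr (- real CARD('n) / 2)) *
      (\<Prod>j\<in>UNIV. bargmann_factor (x $ j) (\<xi> $ j) * phase_z (x $ j) (\<xi> $ j) ^ \<gamma> j / of_real (sqrt (fact (\<gamma> j))))"
    unfolding stft_def hermite_stft_integrand vec_prod_integral(2)[OF stft1_integrable] stft1_integral ..
  also have "(\<Prod>j\<in>UNIV. bargmann_factor (x $ j) (\<xi> $ j) * phase_z (x $ j) (\<xi> $ j) ^ \<gamma> j / of_real (sqrt (fact (\<gamma> j)))) =
      (\<Prod>j\<in>UNIV. bargmann_factor (x $ j) (\<xi> $ j)) * e_mono \<gamma> (phase_vec x \<xi>)"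
    by (simp add: prod.distrib prod_dividef e_mono_def phase_vec_def mfact_def sqrt_prod)
  finally show ?thesis by (simp add: mult.assoc)
qed

lemma stft_hermite_sum:
  assumes "f \<in> H_fin"
  shows "stft (hermite_sum f) x \<xi> = (\<Sum>\<gamma> | f \<gamma> \<noteq> 0. f \<gamma> * stft (\<lambda>y. of_real (hermite \<gamma> y)) x \<xi>)"
proof -
  have "(LINT y|lborel. hermite_sum f y * cnj (gauss (y - x)) * exp (- \<i> * of_real (y \<bullet> \<xi>))) =
      (LINT y|lborel. (\<Sum>\<gamma> | f \<gamma> \<noteq> 0. f \<gamma> * (of_real (hermite \<gamma> y) * cnj (gauss (y - x)) * exp (- \<i> * of_real (y \<bullet> \<xi>)))))"
    by (rule Bochner_Integration.integral_cong) (simp_all add: hermite_sum_def sum_distrib_right mult.assoc)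
  also have "\<dots> = (\<Sum>\<gamma> | f \<gamma> \<noteq> 0. f \<gamma> * (LINT y|lborel. of_real (hermite \<gamma> y) * cnj (gauss (y - x)) * exp (- \<i> * of_real (y \<bullet> \<xi>))))"
    by (subst Bochner_Integration.integral_sum)
       (intro integrable_mult_right stft_hermite_integrable, simp only: integral_mult_right_zero)
  finally show ?thesis
    unfolding stft_def by (simp add: sum_distrib_left ac_simps)
qed

section \<open>Matrix entries as Gaussian moments\<close>

definition moment_integrand ::
  "('n::finite) mindex \<times> 'n mindex \<Rightarrow> 'n mindex \<Rightarrow> 'n mindex \<Rightarrow> (real^'n) \<times> (real^'n) \<Rightarrow> complex" where
  "moment_integrand i \<gamma> \<delta> w = e_mono (fst i) (phase_vec (fst w) (snd w)) *
     e_mono (snd i) (\<chi> j. cnj (phase_vec (fst w) (snd w) $ j)) *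
     stft (\<lambda>y. of_real (hermite \<gamma> y)) (fst w) (snd w) * cnj (stft (\<lambda>y. of_real (hermite \<delta> y)) (fst w) (snd w))"

text \<open>The monomials of the symbol and of the two transforms merge into powers of z and cnj z,
  and the Bargmann factors into a Gaussian.\<close>

lemma moment_integrand_eq:
  fixes w :: "(real^'n::finite) \<times> (real^'n)"
  shows "moment_integrand i \<gamma> \<delta> w =
    of_real ((2 * pi) powr (- real CARD('n)) / sqrt (mfact (fst i) * mfact (snd i) * mfact \<gamma> * mfact \<delta>)) *
    (\<Prod>j\<in>UNIV. (\<lambda>v. zmono (fst i j + \<gamma> j) (snd i j + \<delta> j) (fst v) (snd v) * of_real (gauss2 (fst v) * gauss2 (snd v)))
      (fst w $ j, snd w $ j))"
proof -
  let ?z = "\<lambda>j. phase_z (fst w $ j) (snd w $ j)" and ?B = "\<lambda>j. bargmann_factor (fst w $ j) (snd w $ j)"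
  let ?c = "complex_of_real ((2 * pi) powr (- real CARD('n) / 2))"
  have cc: "?c * ?c = of_real ((2 * pi) powr (- real CARD('n)))"
    unfolding of_real_mult[symmetric] powr_add[symmetric] by simp
  have "moment_integrand i \<gamma> \<delta> w = ?c * ?c *
      (\<Prod>j\<in>UNIV. (?z j ^ fst i j * ?z j ^ \<gamma> j) * (cnj (?z j) ^ snd i j * cnj (?z j) ^ \<delta> j) * (?B j * cnj (?B j))) /
      of_real (sqrt (mfact (fst i)) * sqrt (mfact (snd i)) * sqrt (mfact \<gamma>) * sqrt (mfact \<delta>))"
    unfolding moment_integrand_def stft_hermite e_mono_def phase_vec_def prod.distrib
    by (simp add: mult_ac)
  also have "\<dots> = of_real ((2 * pi) powr (- real CARD('n))) *
      (\<Prod>j\<in>UNIV. zmono (fst i j + \<gamma> j) (snd i j + \<delta> j) (fst w $ j) (snd w $ j) * of_real (gauss2 (fst w $ j) * gauss2 (snd w $ j))) /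
      of_real (sqrt (mfact (fst i)) * sqrt (mfact (snd i)) * sqrt (mfact \<gamma>) * sqrt (mfact \<delta>))"
    unfolding cc bargmann_factor_norm zmono_def power_add ..
  also have "sqrt (mfact (fst i)) * sqrt (mfact (snd i)) * sqrt (mfact \<gamma>) * sqrt (mfact \<delta>) =
      sqrt (mfact (fst i) * mfact (snd i) * mfact \<gamma> * mfact \<delta>)" by (simp only: real_sqrt_mult)
  finally show ?thesis by simp
qed

lemma moment_integrand_integrable: "integrable lborel (moment_integrand i \<gamma> \<delta>)"
  unfolding moment_integrand_eq[abs_def]
  by (intro integrable_mult_right phase_prod_integral(1) integrable_zmono)

text \<open>Orthogonality and factorials come from \<open>gmoment_eq\<close> in each coordinate; the
  factors 2 pi cancel the squared normalisation of the transform.\<close>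

lemma moment_integral: "(LINT w|lborel. moment_integrand i \<gamma> \<delta> w) = of_real (toep \<delta> i \<gamma>)"
  for i :: "('n::finite) mindex \<times> 'n mindex"
proof -
  let ?r = "sqrt (mfact (fst i) * mfact (snd i) * mfact \<gamma> * mfact \<delta>)"
  have "(LINT w|lborel. moment_integrand i \<gamma> \<delta> w) =
      of_real ((2 * pi) powr (- real CARD('n)) / ?r) * (\<Prod>j\<in>UNIV. gmoment (fst i j + \<gamma> j) (snd i j + \<delta> j))"
    unfolding moment_integrand_eq integral_mult_right_zero
    by (subst phase_prod_integral(2)[OF integrable_zmono]) (simp only: gmoment_def)
  also have "\<dots> = of_real (toep \<delta> i \<gamma>)"
  proof (cases "\<forall>j. fst i j + \<gamma> j = snd i j + \<delta> j")
    case True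
    then have "(\<Prod>j\<in>UNIV. gmoment (fst i j + \<gamma> j) (snd i j + \<delta> j)) =
        (\<Prod>j\<in>UNIV. complex_of_real (2 * pi * fact (fst i j + \<gamma> j)))"
      by (intro prod.cong) (auto simp: gmoment_eq)
    also have "\<dots> = of_real ((2 * pi) ^ CARD('n) * mfact (\<lambda>j. fst i j + \<gamma> j))"
      by (simp add: prod.distrib mfact_def)
    finally have g: "(\<Prod>j\<in>UNIV. gmoment (fst i j + \<gamma> j) (snd i j + \<delta> j)) =
        of_real ((2 * pi) ^ CARD('n) * mfact (\<lambda>j. fst i j + \<gamma> j))" .
    have "(2 * pi) powr (- real CARD('n)) * (2 * pi) ^ CARD('n) = 1"
      by (simp add: powr_minus powr_realpow field_simps)
    moreover have "(2 * pi) powr (- real CARD('n)) / ?r * ((2 * pi) ^ CARD('n) * M) =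
        ((2 * pi) powr (- real CARD('n)) * (2 * pi) ^ CARD('n)) * (M / ?r)" for M
      by (simp only: divide_inverse ac_simps)
    ultimately have "(2 * pi) powr (- real CARD('n)) / ?r * ((2 * pi) ^ CARD('n) * mfact (\<lambda>j. fst i j + \<gamma> j)) = toep \<delta> i \<gamma>"
      unfolding toep_def if_P[OF True] by (simp only: mult_1)
    then show ?thesis unfolding g of_real_mult[symmetric] by (simp only:)
  next
    case False
    then obtain j where "fst i j + \<gamma> j \<noteq> snd i j + \<delta> j" by blast
    then have "gmoment (fst i j + \<gamma> j) (snd i j + \<delta> j) = 0" by (simp add: gmoment_eq)
    then have "(\<Prod>j\<in>UNIV. gmoment (fst i j + \<gamma> j) (snd i j + \<delta> j)) = 0" by (intro prod_zero) auto
    moreover have "toep \<delta> i \<gamma> = 0" unfolding toep_def using False by (rule if_not_P)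
    ultimately show ?thesis by simp
  qed
  finally show ?thesis .
qed

lemma toeplitz_symb_eq:
  "toeplitz_symb a x \<xi> = (\<Sum>i | a i \<noteq> 0. a i * (e_mono (fst i) (phase_vec x \<xi>) *
    e_mono (snd i) (\<chi> j. cnj (phase_vec x \<xi> $ j))))"
  unfolding toeplitz_symb_def Let_def symb_eval_def phase_vec_def phase_z_def
  by (rule sum.cong) (auto simp: mult.assoc)

lemma kop_finite:
  assumes "a \<in> fin_families" "f \<in> fin_families"
  shows "kop k a f \<delta> = (\<Sum>\<gamma> | f \<gamma> \<noteq> 0. \<Sum>i | a i \<noteq> 0. of_real (k \<delta> i \<gamma>) * a i * f \<gamma>)"
proof -
  let ?A = "{i. a i \<noteq> 0}" and ?F = "{\<gamma>. f \<gamma> \<noteq> 0}"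
  let ?g = "\<lambda>x. complex_of_real (k \<delta> (fst x) (snd x)) * a (fst x) * f (snd x)"
  have fin: "finite ?A" "finite ?F" using assms by (auto simp: fin_families_def)
  have sub: "{x \<in> UNIV. ?g x \<noteq> 0} \<subseteq> ?A \<times> ?F" by auto
  have "kop k a f \<delta> = (\<Sum>x | x \<in> UNIV \<and> ?g x \<noteq> 0. ?g x)"
    unfolding kop_def
    by (rule lebesgue_integral_count_space_finite_support) (rule finite_subset[OF sub], use fin in simp)
  also have "\<dots> = sum ?g (?A \<times> ?F)"
    using fin by (intro sum.mono_neutral_left) auto
  also have "\<dots> = (\<Sum>i\<in>?A. \<Sum>\<gamma>\<in>?F. ?g (i, \<gamma>))" using fin by (simp add: sum.cartesian_product case_prod_unfold)
  also have "\<dots> = (\<Sum>\<gamma>\<in>?F. \<Sum>i\<in>?A. ?g (i, \<gamma>))" by (rule sum.swap)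
  finally show ?thesis by simp
qed

text \<open>With finite supports all sums leave the integral, and \<open>moment_integral\<close>
  evaluates what remains.\<close>

theorem Tp_eq_kop:
  fixes a :: "('n::finite) symb"
  assumes a: "a \<in> A_fin" and f: "f \<in> H_fin"
  shows "Tp a f = kop toep a f"
  unfolding Tp_def
proof (rule the_equality)
  let ?I = "\<lambda>g. LINT (x, \<xi>)|lborel. toeplitz_symb a x \<xi> * stft (hermite_sum f) x \<xi> * cnj (stft (hermite_sum g) x \<xi>)"
  let ?A = "{i. a i \<noteq> 0}" and ?F = "{\<gamma>. f \<gamma> \<noteq> 0}"
  show *: "\<forall>g\<in>H_fin. L2_pairing (kop toep a f) g = ?I g"
  proof
    fix g :: "'n mindex \<Rightarrow> complex" assume g: "g \<in> H_fin"
    let ?G = "{\<delta>. g \<delta> \<noteq> 0}"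
    have "?I g = (LINT w|lborel. (\<Sum>\<delta>\<in>?G. \<Sum>\<gamma>\<in>?F. \<Sum>i\<in>?A. (a i * f \<gamma> * cnj (g \<delta>)) * moment_integrand i \<gamma> \<delta> w))"
    proof (rule Bochner_Integration.integral_cong[OF refl])
      fix w :: "(real^'n) \<times> (real^'n)"
      obtain x \<xi> where w: "w = (x, \<xi>)" by (cases w)
      show "(case w of (x, \<xi>) \<Rightarrow> toeplitz_symb a x \<xi> * stft (hermite_sum f) x \<xi> * cnj (stft (hermite_sum g) x \<xi>)) =
          (\<Sum>\<delta>\<in>?G. \<Sum>\<gamma>\<in>?F. \<Sum>i\<in>?A. (a i * f \<gamma> * cnj (g \<delta>)) * moment_integrand i \<gamma> \<delta> w)"
        unfolding w prod.case toeplitz_symb_eq stft_hermite_sum[OF f] stft_hermite_sum[OF g] moment_integrand_def fst_conv snd_conv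
        by (simp only: sum_product sum_distrib_left sum_distrib_right cnj_sum complex_cnj_mult)
           (rule sum.cong[OF refl], rule sum.cong[OF refl], rule sum.cong[OF refl], simp only: ac_simps)
    qed
    also have "\<dots> = (\<Sum>\<delta>\<in>?G. \<Sum>\<gamma>\<in>?F. \<Sum>i\<in>?A. (a i * f \<gamma> * cnj (g \<delta>)) * (LINT w|lborel. moment_integrand i \<gamma> \<delta> w))"
      by (subst Bochner_Integration.integral_sum, (intro Bochner_Integration.integrable_sum integrable_mult_right moment_integrand_integrable)[1])+
         (simp only: integral_mult_right_zero)
    also have "\<dots> = (\<Sum>\<delta>\<in>?G. kop toep a f \<delta> * cnj (g \<delta>))"
      unfolding moment_integral kop_finite[OF a f] sum_distrib_right
      by (intro sum.cong refl) (simp only: ac_simps)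
    finally show "L2_pairing (kop toep a f) g = ?I g" by (simp add: L2_pairing_def)
  qed
  fix u assume u: "\<forall>g\<in>H_fin. L2_pairing u g = ?I g"
  show "u = kop toep a f"
  proof
    fix \<delta> :: "'n mindex"
    \<comment> \<open>Testing with unit families recovers every coefficient, which is the uniqueness
      behind the definition of \<open>Tp\<close>.\<close>
    let ?e = "\<lambda>\<gamma>. if \<gamma> = \<delta> then 1 else 0 :: complex"
    have "?e \<in> H_fin" by (simp add: fin_families_def)
    then have "L2_pairing u ?e = L2_pairing (kop toep a f) ?e" using u * by simp
    moreover have "L2_pairing v ?e = v \<delta>" for v
      unfolding L2_pairing_def by (subst sum.cong[of _ "{\<delta>}" _ v]) auto
    ultimately show "u \<delta> = kop toep a f \<delta>" by simp
  qed
qed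

section \<open>The four extensions\<close>

lemma proj_lim_cong:
  assumes "\<And>r. r \<in> I \<Longrightarrow> X r = Y r"
  shows "proj_lim I X = proj_lim I Y"
proof -
  have "{U \<inter> (\<Inter>j\<in>I. topspace (X j)) | U i. i \<in> I \<and> openin (X i) U} =
      {U \<inter> (\<Inter>j\<in>I. topspace (Y j)) | U i. i \<in> I \<and> openin (Y i) U}"
    using assms by (intro Collect_cong) (metis (no_types, lifting) INF_cong)
  then show ?thesis by (simp add: proj_lim_def)
qed

lemma ind_lim_cong:
  assumes "\<And>r. r \<in> I \<Longrightarrow> X r = Y r"
  shows "ind_lim I X = ind_lim I Y"
proof -
  have "ind_base I X = ind_base I Y" "(\<Union>r\<in>I. topspace (X r)) = (\<Union>r\<in>I. topspace (Y r))"
    using assms by (auto simp: ind_base_def fun_eq_iff)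
  then show ?thesis by (simp add: ind_lim_def ind_open_def[abs_def])
qed

theorem theorem5p1:
  fixes s1 s2 :: pindex and p :: ennreal
  assumes "0 < p"
    and "s1 \<in> R_flat" and "s2 \<in> R_flat"
    and "s1 < Num (1/2)"
    and "Num 0 < s2" and "s2 \<le> Num (1/2)"
  shows "(uniquely_extendable (A_fin \<times> H_fin) (\<lambda>(a :: ('n::finite) symb, f). Tp a f)
            (C_sp p s1) (H_sp p s1) (H_sp p s1) \<and>
          uniquely_extendable (A_fin \<times> H_fin) (\<lambda>(a :: 'n symb, f). Tp a f)
            (C_star p s1) (H_dual p s1) (H_dual p s1)) \<and>
         (uniquely_extendable (A_fin \<times> H_fin) (\<lambda>(a :: 'n symb, f). Tp a f)
            (C0_sp p s2) (H0_sp p s2) (H0_sp p s2) \<and>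
          uniquely_extendable (A_fin \<times> H_fin) (\<lambda>(a :: 'n symb, f). Tp a f)
            (C0_star p s2) (H0_dual p s2) (H0_dual p s2))"
proof (intro conjI)
  obtain \<theta>1 where "cofinal_weights \<theta>1 (\<lambda>r. vartheta r s1 :: 'n mindex \<Rightarrow> ennreal)"
    using cofinal_vartheta assms by blast
  then interpret W1: cofinal_weights \<theta>1 "\<lambda>r. vartheta r s1 :: 'n mindex \<Rightarrow> ennreal" .
  show "uniquely_extendable (A_fin \<times> H_fin) (\<lambda>(a :: 'n symb, f). Tp a f) (C_sp p s1) (H_sp p s1) (H_sp p s1)"
    unfolding C_sp_def H_sp_def omega_def
    by (rule W1.uniquely_extendable_decay[OF assms(1)]) (simp add: Tp_eq_kop)
  show "uniquely_extendable (A_fin \<times> H_fin) (\<lambda>(a :: 'n symb, f). Tp a f) (C_star p s1) (H_dual p s1) (H_dual p s1)"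
    unfolding C_star_def H_dual_def omega_star_def
    by (rule W1.uniquely_extendable_growth[OF assms(1)]) (simp add: Tp_eq_kop)
  \<comment> \<open>For \<open>s2\<close> the decreasing family is \<open>1 / vartheta\<close> with
    growing parameter. Inverting it again gives back \<open>vartheta\<close>, because the values are
    positive and finite at nonzero indices.\<close>
  let ?\<eta> = "\<lambda>r (\<alpha> :: 'n mindex). 1 / vartheta r s2 \<alpha>"
  obtain \<theta>2 where "cofinal_weights \<theta>2 ?\<eta>"
    using cofinal_inverse_vartheta assms by blast
  then interpret W2: cofinal_weights \<theta>2 ?\<eta> .
  have one: "1 / ennreal x = ennreal (1 / x)" if "0 < x" for x
    using divide_ennreal[of 1 x] that by simp
  have q: "?\<eta> r \<alpha> / ?\<eta> r' \<beta> = vartheta r' s2 \<beta> / vartheta r s2 \<alpha>" if r: "0 < r" "0 < r'" for r r' \<alpha> \<beta>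
  proof -
    obtain x where x: "0 < x" "vartheta r s2 \<alpha> = ennreal x" by (rule vartheta_real[OF assms(3,5) r(1)])
    obtain y where y: "0 < y" "vartheta r' s2 \<beta> = ennreal y" by (rule vartheta_real[OF assms(3,5) r(2)])
    show ?thesis using x y by (simp add: one divide_ennreal)
  qed
  have i: "1 / ?\<eta> r \<alpha> = vartheta r s2 \<alpha>" if r: "0 < r" for r \<alpha>
  proof -
    obtain x where x: "0 < x" "vartheta r s2 \<alpha> = ennreal x" by (rule vartheta_real[OF assms(3,5) r])
    show ?thesis using x by (simp add: one)
  qed
  \<comment> \<open>The identities for quotients hold for positive parameters, so they are inserted
    under the limits by congruence.\<close>
  have C0: "C0_sp p s2 = ind_lim {0<..} (\<lambda>r. proj_lim {0<..} (\<lambda>r'. wlp p (\<lambda>(\<alpha>, \<beta>). ?\<eta> r \<beta> / ?\<eta> r' \<alpha>)))"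
    unfolding C0_sp_def omega_def
    by (intro ind_lim_cong proj_lim_cong arg_cong[where f = "wlp p"] ext) (auto simp only: q greaterThan_iff split: prod.splits)
  have C0s: "C0_star p s2 = ind_lim {0<..} (\<lambda>r. proj_lim {0<..} (\<lambda>r'. wlp p (\<lambda>(\<alpha>, \<beta>). ?\<eta> r \<alpha> / ?\<eta> r' \<beta>)))"
    unfolding C0_star_def omega_star_def
    by (intro ind_lim_cong proj_lim_cong arg_cong[where f = "wlp p"] ext) (auto simp only: q greaterThan_iff split: prod.splits)
  have H0: "H0_sp p s2 = proj_lim {0<..} (\<lambda>r. wlp p (\<lambda>\<alpha>. 1 / ?\<eta> r \<alpha>))"
    unfolding H0_sp_def
    by (intro proj_lim_cong arg_cong[where f = "wlp p"] ext) (simp only: i greaterThan_iff)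
  show "uniquely_extendable (A_fin \<times> H_fin) (\<lambda>(a :: 'n symb, f). Tp a f) (C0_sp p s2) (H0_sp p s2) (H0_sp p s2)"
    unfolding C0 H0
    by (rule W2.uniquely_extendable_growth[OF assms(1)]) (simp add: Tp_eq_kop)
  show "uniquely_extendable (A_fin \<times> H_fin) (\<lambda>(a :: 'n symb, f). Tp a f) (C0_star p s2) (H0_dual p s2) (H0_dual p s2)"
    unfolding C0s H0_dual_def
    by (rule W2.uniquely_extendable_decay[OF assms(1)]) (simp add: Tp_eq_kop)
qed

end
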